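(* Let $N\ge1$. (1) Let $\phi=(\phi^i,\phi^b)\in L^q(\Omega)\times L^q(\partial\Omega)$, where $q\in[1,\infty]$. Then $\mathsf{G}(t)\phi$ is bounded and smooth on $\overline{\Omega}\times[T,\infty)$ for every $T>0$, and it satisfies $$\partial_t(\mathsf{G}(t)\phi)-\Delta(\mathsf{G}(t)\phi)=0\ \text{ in }\ \Omega\times(0,\infty),\qquad \partial_t(\mathsf{G}(t)\phi)+\partial_\nu(\mathsf{G}(t)\phi)=0\ \text{ on }\ \partial\Omega\times(0,\infty),$$ in the classical sense. Furthermore, $$\lim_{t\to+0}\|\mathsf{G}(t)\phi-\phi\|_{L^q(\Omega)\times L^q(\partial\Omega)}=0\quad\text{if}\quad 1\le q<\infty.$$ (2) There exists $C_1=C_1(N)>0$ such that $$\|\mathsf{G}(t)\phi\|_{L^r(\Omega)\times L^r(\partial\Omega)}\le C_1\left(t^{-\frac N2\left(\frac1q-\frac1r\right)}+t^{-(N-1)\left(\frac1q-\frac1r\right)}\right)\|\phi\|_{L^q(\Omega)\times L^q(\partial\Omega)}$$ for $t>0$, $\phi\in L^q(\Omega)\times L^q(\partial\Omega)$, and $1\le q\le r\le\infty$. In particular, $$\|\mathsf{G}(t)\phi\|_{L^q(\Omega)\times L^q(\partial\Omega)}\le\|\phi\|_{L^q(\Omega)\times L^q(\partial\Omega)}$$ for $t>0$, $\phi\in L^q(\Omega)\times L^q(\partial\Omega)$, and $1\le q\le\infty$. (3) Let $\phi=(\phi^i,\phi^b)$, where $\phi^i$ and $\phi^b$ are nonnegative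 measurable functions in $\Omega$ and on $\partial\Omega$, respectively. Then there exists $C_2=C_2(N)>0$ (depending only on $N$) such that $$[\mathsf{G}(t)\phi](x)\ge C_2\int_\Omega\Gamma_N\left(x-y^*,\frac t2\right)\phi^i(y)\,dy+C_2\int_{\partial\Omega}\Gamma_N\left(x-y^*,\frac t2\right)\phi^b(y)\,d\sigma(y)$$ for $(x,t)\in\overline\Omega\times[1,\infty)$.
   Context: $N\ge1$ is an integer and $\Omega:=\{x=(x',x_N)\in\mathbb R^N: x'\in\mathbb R^{N-1},\ x_N\in(0,\infty)\}$; if $N=1$, then $\Omega=(0,\infty)$ and $\partial\Omega=\{0\}$. $\partial_\nu:=-\partial/\partial x_N$. $\sigma$ is the surface measure on $\partial\Omega$ if $N\ge2$, and $\sigma(\{0\})=1$ if $N=1$; $L^q(\partial\Omega)$ is taken with respect to $\sigma$. For $y=(y',y_N)\in\overline\Omega$, $y^*=(y',-y_N)$; $e_N=(0,\dots,0,1)$. $\Gamma_N(x,t):=(4\pi t)^{-N/2}e^{-|x|^2/(4t)}$ for $(x,t)\in\mathbb R^N\times(0,\infty)$. For $(x,y,t)\in\overline\Omega\times\overline\Omega\times(0,\infty)$, $$G(x,y,t):=\Gamma_N(x-y,t)-\Gamma_N(x-y^*,t)-2\int_0^t(\partial_{x_N}\Gamma_N)(x-y^*+\tau e_N,t-\tau)\,d\tau .$$ For $\phi=(\phi^i,\phi^b)$ with $\phi^i$, $\phi^b$ measurable in $\Omega$ and on $\partial\Omega$, respectively, $$[\mathsf{G}(t)\phi](x):=\int_\Omega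 G(x,y,t)\phi^i(y)\,dy+\int_{\partial\Omega}G(x,y,t)\phi^b(y)\,d\sigma(y),\qquad (x,t)\in\overline\Omega\times(0,\infty),$$ if it is well-defined. For $(f,g)\in L^r(\Omega)\times L^r(\partial\Omega)$, $r\in[1,\infty]$, $\|(f,g)\|_{L^r(\Omega)\times L^r(\partial\Omega)}:=\|f\|_{L^r(\Omega)}+\|g\|_{L^r(\partial\Omega)}$; a function $f\in C(\overline\Omega)$ with $f\in L^r(\Omega)$ and $f|_{\partial\Omega}\in L^r(\partial\Omega)$ is identified with the pair $(f,f|_{\partial\Omega})$, so $\|f\|_{L^r(\Omega)\times L^r(\partial\Omega)}:=\|(f,f|_{\partial\Omega})\|_{L^r(\Omega)\times L^r(\partial\Omega)}$, and $\mathsf{G}(t)\phi-\phi$ means $(\mathsf{G}(t)\phi-\phi^i,(\mathsf{G}(t)\phi)|_{\partial\Omega}-\phi^b)$.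
   Formalization: The final contraction in (2) is false for the sum norm when q>1 (e.g. q=∞, φ=(1,0)); it is proved instead for the norm (‖f‖_q^q+‖g‖_q^q)^{1/q} (maximum if q=∞), which is the sum norm for q=1. *)

theory Defs
  imports "HOL-Analysis.Analysis" "HOL-Probability.Essential_Supremum"
begin

section \<open>The half space\<close>

text \<open>
  The space \<open>\<real>\<^sup>N\<close> is \<open>real ^ 'n\<close>, where the index type carries a linear order so that "the last
  coordinate" makes sense; every \<open>N \<ge> 1\<close> is the cardinality of such a type.
\<close>

definition lastc :: "'n::{finite,linorder}" where
  "lastc = Max UNIV"

definition eN :: "real ^ 'n::{finite,linorder}" where
  "eN = axis lastc 1"

definition Omega :: "(real ^ 'n::{finite,linorder}) set" where
  "Omega = {x. 0 < x $ lastc}"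

definition refl_pt ::
  "real ^ 'n::{finite,linorder} \<Rightarrow> real ^ 'n::{finite,linorder}" where
  "refl_pt y = (\<chi> i. if i = lastc then - (y $ i) else y $ i)"

text \<open>
  Surface measure on the boundary: the image of \<open>(N-1)\<close>-dimensional Lebesgue measure under
  \<open>x' \<mapsto> (x', 0)\<close>, completed. For \<open>N = 1\<close> the product over the empty index set is a unit mass
  at a point, so the result is the unit mass at the origin.
\<close>

definition hyperplane_embed ::
  "('n::{finite,linorder} \<Rightarrow> real) \<Rightarrow> real ^ 'n::{finite,linorder}" where
  "hyperplane_embed f = (\<chi> i. if i = lastc then 0 else f i)"

definition surface_measure :: "(real ^ 'n::{finite,linorder}) measure" where
  "surface_measure =
     completion (distr (\<Pi>\<^sub>M i\<in>UNIV - {lastc :: 'n::{finite,linorder}}. (lborel :: real measure))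
                       (restrict_space borel (frontier Omega)) hyperplane_embed)"


section \<open>Differential operators and smoothness\<close>

definition pd :: "'n::finite \<Rightarrow> (real ^ 'n::finite \<Rightarrow> real) \<Rightarrow> real ^ 'n::finite \<Rightarrow> real" where
  "pd i f x = deriv (\<lambda>h. f (x + h *\<^sub>R axis i 1)) 0"

definition laplacian :: "(real ^ 'n::finite \<Rightarrow> real) \<Rightarrow> real ^ 'n::finite \<Rightarrow> real" where
  "laplacian f x = (\<Sum>i\<in>UNIV. pd i (pd i f) x)"

text \<open>
  The outer normal derivative \<open>-\<partial>/\<partial>x\<^sub>N\<close> at a boundary point, taken from inside the domain.
\<close>

definition normal_deriv ::
  "(real ^ 'n::{finite,linorder} \<Rightarrow> real) \<Rightarrow>
    real ^ 'n::{finite,linorder} \<Rightarrow> real" where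
  "normal_deriv f x = - vector_derivative (\<lambda>h. f (x + h *\<^sub>R eN)) (at 0 within {0..})"

text \<open>
  Smoothness up to the boundary of a set that need not be open, by iterated derivatives within the
  set. It is only meant for convex sets with nonempty interior, where derivatives within the set
  are unique.
\<close>

primrec Ck_on :: "nat \<Rightarrow> 'a::euclidean_space set \<Rightarrow> ('a \<Rightarrow> real) \<Rightarrow> bool" where
  "Ck_on 0 S f \<longleftrightarrow> continuous_on S f"
| "Ck_on (Suc k) S f \<longleftrightarrow>
     (\<exists>D. (\<forall>x\<in>S. (f has_derivative D x) (at x within S)) \<and>
          (\<forall>b\<in>Basis. Ck_on k S (\<lambda>x. D x b)))"

definition smooth_on :: "'a::euclidean_space set \<Rightarrow> ('a \<Rightarrow> real) \<Rightarrow> bool" where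
  "smooth_on S f \<longleftrightarrow> (\<forall>k. Ck_on k S f)"


section \<open>Lebesgue norms\<close>

definition ennpow :: "ennreal \<Rightarrow> real \<Rightarrow> ennreal" where
  "ennpow a p = (if a = \<infinity> then \<infinity> else ennreal (enn2real a powr p))"

definition Lnorm :: "ennreal \<Rightarrow> 'a measure \<Rightarrow> ('a \<Rightarrow> real) \<Rightarrow> ennreal" where
  "Lnorm q M f =
     (if q = \<infinity> then esssup M (\<lambda>x. ennreal \<bar>f x\<bar>)
      else ennpow (\<integral>\<^sup>+ x. ennreal (\<bar>f x\<bar> powr enn2real q) \<partial>M) (1 / enn2real q))"

definition in_Lq :: "ennreal \<Rightarrow> 'a measure \<Rightarrow> ('a \<Rightarrow> real) \<Rightarrow> bool" where
  "in_Lq q M f \<longleftrightarrow> f \<in> borel_measurable M \<and> Lnorm q M f < \<infinity>"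

definition in_Lq_pair ::
  "ennreal \<Rightarrow> (real ^ 'n::{finite,linorder} \<Rightarrow> real) \<Rightarrow>
    (real ^ 'n::{finite,linorder} \<Rightarrow> real) \<Rightarrow>
    bool" where
  "in_Lq_pair q f g \<longleftrightarrow> in_Lq q (lebesgue_on Omega) f \<and> in_Lq q surface_measure g"

definition pair_norm ::
  "ennreal \<Rightarrow> (real ^ 'n::{finite,linorder} \<Rightarrow> real) \<Rightarrow>
    (real ^ 'n::{finite,linorder} \<Rightarrow> real) \<Rightarrow>
    ennreal" where
  "pair_norm q f g = Lnorm q (lebesgue_on Omega) f + Lnorm q surface_measure g"

text \<open>
  The norm of the \<open>L\<^sup>q\<close> space over the disjoint union of the domain and its boundary. It is
  equivalent to \<open>pair_norm\<close> and equal to it for \<open>q = 1\<close>. The evolution is a contraction in this norm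
  for every \<open>q\<close>, but for \<open>q > 1\<close> it is not one in \<open>pair_norm\<close>: with \<open>q = \<infinity>\<close> and initial value
  \<open>(1, 0)\<close> the supremum over the domain remains \<open>1\<close> while the boundary value becomes positive.
\<close>

definition joint_norm ::
  "ennreal \<Rightarrow> (real ^ 'n::{finite,linorder} \<Rightarrow> real) \<Rightarrow>
    (real ^ 'n::{finite,linorder} \<Rightarrow> real) \<Rightarrow>
    ennreal" where
  "joint_norm q f g =
     (if q = \<infinity> then max (Lnorm q (lebesgue_on Omega) f) (Lnorm q surface_measure g)
      else ennpow (ennpow (Lnorm q (lebesgue_on Omega) f) (enn2real q)
                   + ennpow (Lnorm q surface_measure g) (enn2real q)) (1 / enn2real q))"


section \<open>The kernel and the evolution operator\<close>

definition Gauss :: "real ^ 'n::finite \<Rightarrow> real \<Rightarrow> real" where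
  "Gauss x t = (4 * pi * t) powr (- (real CARD('n) / 2)) * exp (- ((norm x)\<^sup>2 / (4 * t)))"

definition Gker ::
  "real ^ 'n::{finite,linorder} \<Rightarrow> real ^ 'n::{finite,linorder} \<Rightarrow>
    real \<Rightarrow> real" where
  "Gker x y t =
     Gauss (x - y) t - Gauss (x - refl_pt y) t
     - 2 * (LBINT \<tau>:{0<..<t}. pd lastc (\<lambda>z. Gauss z (t - \<tau>)) (x - refl_pt y + \<tau> *\<^sub>R eN))"

definition Gop ::
  "real \<Rightarrow> (real ^ 'n::{finite,linorder} \<Rightarrow> real) \<Rightarrow>
    (real ^ 'n::{finite,linorder} \<Rightarrow> real) \<Rightarrow>
    real ^ 'n::{finite,linorder} \<Rightarrow> real" where
  "Gop t \<phi>i \<phi>b x =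
     (\<integral> y. Gker x y t * \<phi>i y \<partial>lebesgue_on Omega) + (\<integral> y. Gker x y t * \<phi>b y \<partial>surface_measure)"

definition Gop_well_defined ::
  "real \<Rightarrow> (real ^ 'n::{finite,linorder} \<Rightarrow> real) \<Rightarrow>
    (real ^ 'n::{finite,linorder} \<Rightarrow> real) \<Rightarrow>
    real ^ 'n::{finite,linorder} \<Rightarrow> bool" where
  "Gop_well_defined t \<phi>i \<phi>b x \<longleftrightarrow>
     integrable (lebesgue_on Omega) (\<lambda>y. Gker x y t * \<phi>i y) \<and>
     integrable surface_measure (\<lambda>y. Gker x y t * \<phi>b y)"

text \<open>
  The same operator on nonnegative data, with values in \<open>[0, \<infinity>]\<close>. The coercion
  \<open>ennreal\<close> loses nothing only because the kernel is nonnegative.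
\<close>

definition Gop_nn ::
  "real \<Rightarrow> (real ^ 'n::{finite,linorder} \<Rightarrow> ennreal) \<Rightarrow>
    (real ^ 'n::{finite,linorder} \<Rightarrow> ennreal) \<Rightarrow>
    real ^ 'n::{finite,linorder} \<Rightarrow> ennreal" where
  "Gop_nn t \<phi>i \<phi>b x =
     (\<integral>\<^sup>+ y. ennreal (Gker x y t) * \<phi>i y \<partial>lebesgue_on Omega)
     + (\<integral>\<^sup>+ y. ennreal (Gker x y t) * \<phi>b y \<partial>surface_measure)"

end

theory Submission
  imports Defs "HOL-Probability.Probability"
begin

text \<open>
  Let \<open>\<mu>\<close> be Lebesgue measure on the open half space plus surface measure on its boundary. A pair
  \<open>(\<phi>\<^sup>i, \<phi>\<^sup>b)\<close> is a single function \<open>\<phi>\<close> up to \<open>\<mu>\<close>-null sets, \<open>joint_norm q\<close> is its norm in \<open>L\<^sup>q(\<mu>)\<close>,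
  and the evolution is the integral operator with kernel \<open>G\<close> against \<open>\<mu>\<close>. The kernel is nonnegative,
  symmetric and of \<open>\<mu>\<close>-mass one: integrating the third term of \<open>G\<close> first over the tangential and then
  over the normal variable leaves the \<open>\<tau>\<close>-derivative of an error function, which is exactly the
  mass lost by the Dirichlet heat kernel. Jensen's inequality gives the contraction on every
  \<open>L\<^sup>q(\<mu>)\<close>; a pointwise bound of \<open>G\<close> by \<open>t\<^sup>-\<^sup>N\<^sup>/\<^sup>2 + t\<^sup>-\<^sup>(\<^sup>N\<^sup>-\<^sup>1\<^sup>)\<close> and interpolation give the smoothing
  estimate. Since the first moment of \<open>G(x, \<cdot>, t)\<close> around \<open>x\<close> is of order \<open>sqrt t\<close>, the
  initial values are attained for Lipschitz data and then for all data by density.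

  Smoothness up to the boundary rests on extending the heat kernel by zero to nonpositive times: it
  is then smooth away from the space-time origin. The third term of \<open>G\<close> is an
  integral over \<open>\<tau> > 0\<close> of translates of such an extended kernel along \<open>(e\<^sub>N, -1)\<close>, and the poles stay
  away from the open set \<open>t > 0, x\<^sub>N + t > 0\<close>, which contains the closed half space. So one can differentiate
  under the integral there, and the boundary condition follows by integrating the derivative
  in the direction \<open>(-e\<^sub>N, 1)\<close> over \<open>\<tau>\<close>.
\<close>

section \<open>The half space and its measures\<close>

text \<open>Volume and boundary have to be treated as one measure because neither part of the flux
  is exact alone: at height a = x_N + \<tau> and elapsed time s = t - \<tau> the volume contributes
  2 Gamma_1(a, s), the boundary contributes (a / s) Gamma_1(a, s), and only the sum is a total
  \<tau>-derivative.

  The lower bound for t >= 1 discards the difference of the two Gaussians, which is nonnegative, and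
  keeps of the \<tau>-integral only the window from sqrt t / 8 to sqrt t / 4. Its length is of order
  sqrt t, and the integrand there is at least a multiple of the Gaussian at time t / 2 divided by
  sqrt t, so the powers of t cancel.

  Strong continuity is proved for the double integral \<open>Jt\<close> of G(x, y, t) |\<phi> x -
  \<phi> y|^q, which dominates the q-th power of the distance to the initial datum and is controlled
  by the norm of \<phi> uniformly in t; hence the data for which it tends to zero are closed under
  limits in L^q.

  Contraction lives in the joint norm; the other estimates pass to the pair norm at the cost of a
  factor 2.\<close>

lemma open_Omega: "open (Omega :: (real ^ 'n::{finite,linorder}) set)"
  unfolding Omega_def by (intro open_Collect_less continuous_intros)

lemma closure_Omega: "closure (Omega :: (real ^ 'n::{finite,linorder}) set) = {x. 0 \<le> x $ lastc}"
proof
  have "closed {x :: (real, 'n) vec. 0 \<le> x $ lastc}"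
    by (intro closed_Collect_le continuous_intros)
  moreover have "Omega \<subseteq> {x :: (real, 'n) vec. 0 \<le> x $ lastc}"
    unfolding Omega_def by auto
  ultimately show "closure (Omega :: ((real, 'n) vec) set) \<subseteq> {x. 0 \<le> x $ lastc}"
    by (rule closure_minimal[rotated])
  show "{x. 0 \<le> x $ lastc} \<subseteq> closure (Omega :: ((real, 'n) vec) set)"
  proof
    fix x :: "(real, 'n) vec" assume "x \<in> {x. 0 \<le> x $ lastc}"
    then have "\<forall>n. x + inverse (real (Suc n)) *\<^sub>R eN \<in> Omega"
      by (auto simp: Omega_def eN_def intro!: add_nonneg_pos)
    moreover have "(\<lambda>n. x + inverse (real (Suc n)) *\<^sub>R eN) \<longlonglongrightarrow> x + 0 *\<^sub>R eN"
      by (intro tendsto_intros LIMSEQ_inverse_real_of_nat)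
    ultimately show "x \<in> closure Omega"
      unfolding closure_sequential by auto
  qed
qed

lemma frontier_Omega: "frontier (Omega :: (real ^ 'n::{finite,linorder}) set) = {x. x $ lastc = 0}"
  unfolding frontier_def closure_Omega interior_open[OF open_Omega] by (auto simp: Omega_def)

lemma frontier_subset_closure_Omega: "frontier Omega \<subseteq> closure (Omega :: (real ^ 'n::{finite,linorder}) set)"
  by (auto simp: closure_Omega frontier_Omega)

lemma eN_lastc [simp]: "eN $ lastc = 1"
  by (simp add: eN_def)

lemma refl_pt_lastc [simp]: "refl_pt y $ lastc = - (y $ lastc)"
  by (simp add: refl_pt_def)

lemma refl_pt_eq: "refl_pt y = y - (2 * y $ lastc) *\<^sub>R eN"
  by (auto simp: refl_pt_def vec_eq_iff eN_def axis_def)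

lemma norm_eN [simp]: "norm eN = 1"
  by (simp add: eN_def)

lemma inner_eN [simp]: "x \<bullet> eN = x $ lastc"
  by (simp add: eN_def inner_axis)

lemma continuous_refl_pt: "continuous_on UNIV (refl_pt :: real ^ 'n::{finite,linorder} \<Rightarrow> _)"
  unfolding refl_pt_eq by (intro continuous_intros)

lemma borel_measurable_refl_pt [measurable]: "refl_pt \<in> borel_measurable borel"
  using continuous_refl_pt by (rule borel_measurable_continuous_onI)

text \<open>The correction is nonnegative on the closed half space: the reflected image is the
  farther one. This orders the two Gaussians of G and the distances to the two image points.\<close>

lemma norm_diff_refl_pt_sq:
  "(norm (x - refl_pt y))\<^sup>2 = (norm (x - y))\<^sup>2 + 4 * x $ lastc * y $ lastc"
proof -
  have "x - refl_pt y = (x - y) + (2 * y $ lastc) *\<^sub>R eN"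
    by (simp add: refl_pt_eq)
  then show ?thesis
    by (simp only: power2_norm_eq_inner inner_add_left inner_add_right inner_scaleR_left
          inner_scaleR_right inner_eN inner_commute[of eN])
       (simp add: algebra_simps)
qed

lemma sets_Omega [measurable]: "Omega \<in> sets borel"
  by (rule borel_open[OF open_Omega])

lemma sets_frontier_Omega [measurable]: "frontier (Omega :: (real ^ 'n::{finite,linorder}) set) \<in> sets borel"
  by (intro borel_closed) simp

lemma sets_closure_Omega [measurable]: "closure (Omega :: (real ^ 'n::{finite,linorder}) set) \<in> sets borel"
  by (intro borel_closed closed_closure)

section \<open>Surface measure as a Borel measure, and slicing by height\<close>

text \<open>The surface measure before completion and restriction, on the Borel sets of the whole
  space, where product measure arguments apply directly.\<close>

definition bdry :: "(real ^ 'n::{finite,linorder}) measure" where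
  "bdry = distr (\<Pi>\<^sub>M i\<in>UNIV - {lastc :: 'n}. (lborel :: real measure)) borel hyperplane_embed"

lemma sets_bdry [simp, measurable_cong]: "sets bdry = sets borel"
  and space_bdry [simp]: "space bdry = UNIV"
  by (simp_all add: bdry_def)

lemma hyperplane_embed_measurable [measurable]:
  "(hyperplane_embed :: _ \<Rightarrow> real ^ 'n::{finite,linorder})
     \<in> (\<Pi>\<^sub>M i\<in>UNIV - {lastc :: 'n}. (lborel :: real measure)) \<rightarrow>\<^sub>M borel"
proof (rule borel_measurable_euclidean_space[THEN iffD2], rule ballI)
  fix b :: "(real, 'n) vec" assume "b \<in> Basis"
  then obtain j where b: "b = axis j 1" by (auto simp: Basis_vec_def)
  show "(\<lambda>f. (hyperplane_embed f :: (real, 'n) vec) \<bullet> b)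
      \<in> borel_measurable (\<Pi>\<^sub>M i\<in>UNIV - {lastc :: 'n}. (lborel :: real measure))"
  proof (cases "j = lastc")
    case True
    then show ?thesis by (simp add: b inner_axis hyperplane_embed_def)
  next
    case False
    then have "j \<in> UNIV - {lastc}" by auto
    from measurable_component_singleton[OF this, of "\<lambda>_. lborel :: real measure"]
    have "(\<lambda>f. f j) \<in> borel_measurable (\<Pi>\<^sub>M i\<in>UNIV - {lastc :: 'n}. (lborel :: real measure))"
      by simp
    with False show ?thesis by (simp add: b inner_axis hyperplane_embed_def)
  qed
qed

lemma hyperplane_embed_lastc [simp]: "hyperplane_embed f $ lastc = 0"
  by (simp add: hyperplane_embed_def)

lemma surface_measure_eq: "surface_measure = completion (restrict_space bdry (frontier Omega))"
  unfolding surface_measure_def bdry_def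
  by (subst restrict_distr) (auto simp: frontier_Omega)

lemma AE_bdry: "AE y in (bdry :: (real ^ 'n::{finite,linorder}) measure). y $ lastc = 0"
  unfolding bdry_def by (subst AE_distr_iff) auto

lemma nn_integral_bdry:
  assumes [measurable]: "f \<in> borel_measurable borel"
  shows "(\<integral>\<^sup>+y. f y \<partial>bdry) = (\<integral>\<^sup>+z. f (hyperplane_embed z) \<partial>(\<Pi>\<^sub>M i\<in>UNIV - {lastc :: 'n::{finite,linorder}}. lborel))"
  unfolding bdry_def by (subst nn_integral_distr) auto

interpretation lborel_prod: product_sigma_finite "\<lambda>_. lborel :: real measure"
  by standard

lemma measurable_vec_lambda_PiM [measurable]:
  "(\<lambda>f. \<chi> i. f i) \<in> (\<Pi>\<^sub>M i\<in>(UNIV :: 'n::finite set). (lborel :: real measure)) \<rightarrow>\<^sub>M (borel :: ((real, 'n) vec) measure)"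
proof (rule borel_measurable_euclidean_space[THEN iffD2], rule ballI)
  fix b :: "(real, 'n) vec" assume "b \<in> Basis"
  then obtain j where b: "b = axis j 1" by (auto simp: Basis_vec_def)
  have "(\<lambda>f. f j) \<in> borel_measurable (\<Pi>\<^sub>M i\<in>(UNIV :: 'n set). (lborel :: real measure))"
    by measurable
  then show "(\<lambda>f. (\<chi> i. f i) \<bullet> b) \<in> borel_measurable (\<Pi>\<^sub>M i\<in>(UNIV :: 'n set). (lborel :: real measure))"
    by (simp add: b inner_axis)
qed

text \<open>Lebesgue measure is determined by the volumes of boxes, and the preimage of a box is a
  product of intervals.\<close>

lemma lborel_vec_eq:
  "(lborel :: (real ^ 'n::finite) measure) = distr (\<Pi>\<^sub>M i\<in>(UNIV :: 'n set). lborel) borel (\<lambda>f. \<chi> i. f i)"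
proof (rule lborel_eqI)
  fix l u :: "(real, 'n) vec" assume lu: "\<And>b. b \<in> Basis \<Longrightarrow> l \<bullet> b \<le> u \<bullet> b"
  have lu': "l $ i \<le> u $ i" for i
    using lu[of "axis i 1"] by (simp add: inner_axis)
  have eq: "(\<lambda>f. \<chi> i. f i) -` box l u \<inter> space (\<Pi>\<^sub>M i\<in>(UNIV :: 'n set). (lborel :: real measure))
      = (\<Pi>\<^sub>E i\<in>UNIV. box (l $ i) (u $ i))"
    by (auto simp: space_PiM mem_box_cart PiE_def Pi_def)
  have "emeasure (distr (\<Pi>\<^sub>M i\<in>(UNIV :: 'n set). lborel) borel (\<lambda>f. \<chi> i. f i)) (box l u)
      = (\<Prod>i\<in>UNIV. emeasure lborel (box (l $ i) (u $ i)))"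
    by (subst emeasure_distr) (auto simp: eq lborel_prod.emeasure_PiM)
  also have "\<dots> = (\<Prod>i\<in>UNIV. ennreal ((u - l) $ i))"
    using lu' by (intro prod.cong) auto
  also have "\<dots> = ennreal (\<Prod>i\<in>UNIV. (u - l) $ i)"
    using lu' by (intro prod_ennreal) auto
  also have "(\<Prod>i\<in>UNIV. (u - l) $ i) = (\<Prod>b\<in>Basis. (u - l) \<bullet> b)"
  proof -
    have B: "(Basis :: ((real, 'n) vec) set) = (\<lambda>i. axis i 1) ` UNIV"
      by (auto simp: Basis_vec_def)
    show ?thesis
      unfolding B by (subst prod.reindex) (auto simp: inj_on_def axis_eq_axis inner_axis)
  qed
  finally show "emeasure (distr (\<Pi>\<^sub>M i\<in>(UNIV :: 'n set). lborel) borel (\<lambda>f. \<chi> i. f i)) (box l u)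
     = ennreal (\<Prod>b\<in>Basis. (u - l) \<bullet> b)" .
qed simp

text \<open>Singling out the index \<open>lastc\<close> in the product measure leaves exactly the
  product that defines \<open>bdry\<close>; the removed coordinate becomes the height
  \<open>h\<close>.\<close>

lemma nn_integral_lborel_slices:
  fixes f :: "real ^ 'n::{finite,linorder} \<Rightarrow> ennreal"
  assumes [measurable]: "f \<in> borel_measurable borel"
  shows "(\<integral>\<^sup>+x. f x \<partial>lborel) = (\<integral>\<^sup>+h. (\<integral>\<^sup>+y. f (y + h *\<^sub>R eN) \<partial>bdry) \<partial>lborel)"
proof -
  have ins: "(UNIV :: 'n set) = insert lastc (UNIV - {lastc})" by auto
  have m: "(\<lambda>g. f (\<chi> i. g i)) \<in> borel_measurable (\<Pi>\<^sub>M i\<in>(UNIV :: 'n set). lborel)"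
    by measurable
  have "(\<integral>\<^sup>+x. f x \<partial>lborel) = (\<integral>\<^sup>+g. f (\<chi> i. g i) \<partial>(\<Pi>\<^sub>M i\<in>(UNIV :: 'n set). lborel))"
    by (subst lborel_vec_eq, subst nn_integral_distr) auto
  also have "\<dots> = (\<integral>\<^sup>+h. (\<integral>\<^sup>+g. f (\<chi> i. (g(lastc := h)) i) \<partial>(\<Pi>\<^sub>M i\<in>UNIV - {lastc :: 'n}. lborel)) \<partial>lborel)"
    apply (subst ins)
    apply (rule lborel_prod.product_nn_integral_insert_rev)
    using m ins by auto
  also have "\<dots> = (\<integral>\<^sup>+h. (\<integral>\<^sup>+y. f (y + h *\<^sub>R eN) \<partial>bdry) \<partial>lborel)"
  proof (intro nn_integral_cong)
    fix h
    have "vec_lambda (g(lastc := h)) = hyperplane_embed g + h *\<^sub>R (eN :: (real, 'n) vec)" for g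
      by (auto simp: vec_eq_iff hyperplane_embed_def eN_def axis_def)
    then show "(\<integral>\<^sup>+g. f (\<chi> i. (g(lastc := h)) i) \<partial>(\<Pi>\<^sub>M i\<in>UNIV - {lastc :: 'n}. lborel))
        = (\<integral>\<^sup>+y. f (y + h *\<^sub>R eN) \<partial>bdry)"
      by (simp add: nn_integral_bdry del: fun_upd_apply)
  qed
  finally show ?thesis .
qed

lemma sigma_finite_bdry: "sigma_finite_measure (bdry :: (real ^ 'n::{finite,linorder}) measure)"
proof -
  let ?B = "\<lambda>k::nat. {x :: (real, 'n) vec. \<forall>i. \<bar>x $ i\<bar> \<le> real k}"
  have meas: "?B k \<in> sets borel" for k
    by (intro borel_closed closed_Collect_all closed_Collect_le continuous_intros)
  have fin: "emeasure bdry (?B k) \<noteq> \<infinity>" for k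
  proof -
    have "(hyperplane_embed -` ?B k) \<inter> space (\<Pi>\<^sub>M i\<in>UNIV - {lastc :: 'n}. (lborel :: real measure))
       = (\<Pi>\<^sub>E i\<in>UNIV - {lastc :: 'n}. {- real k .. real k})"
      by (auto simp: space_PiM hyperplane_embed_def PiE_def Pi_def abs_le_iff split: if_splits;
          metis minus_le_iff)
    then have "emeasure bdry (?B k) = (\<Prod>i\<in>UNIV - {lastc :: 'n}. emeasure lborel {- real k .. real k})"
      unfolding bdry_def using meas[of k]
      by (subst emeasure_distr) (auto simp: lborel_prod.emeasure_PiM)
    then show ?thesis by (simp add: ennreal_mult_eq_top_iff power_eq_top_ennreal)
  qed
  have "(\<Union>k. ?B k) = UNIV"
  proof (intro set_eqI iffI; simp)
    fix x :: "(real, 'n) vec"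
    obtain k :: nat where "norm x \<le> real k" using real_arch_simple by blast
    then show "\<exists>k::nat. \<forall>i. \<bar>x $ i\<bar> \<le> real k"
      by (meson component_le_norm_cart order_trans)
  qed
  then show ?thesis
    using meas fin by (intro sigma_finite_measure.intro exI[of _ "range ?B"]) auto
qed

section \<open>Sums of measures and the measure \<open>mu\<close>\<close>

text \<open>A sum on a common space rather than a measure on a disjoint union: the half space and
  its boundary are disjoint subsets of one space, so data, kernel and solution remain functions on
  that space.\<close>

definition add_measure :: "'a measure \<Rightarrow> 'a measure \<Rightarrow> 'a measure" where
  "add_measure M N = measure_of (space M) (sets M) (\<lambda>A. emeasure M A + emeasure N A)"

lemma sets_add_measure [simp, measurable_cong]: "sets (add_measure M N) = sets M"
  and space_add_measure [simp]: "space (add_measure M N) = space M"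
  by (auto simp: add_measure_def)

lemma emeasure_add_measure:
  assumes "sets N = sets M" "A \<in> sets M"
  shows "emeasure (add_measure M N) A = emeasure M A + emeasure N A"
  unfolding add_measure_def
proof (subst emeasure_measure_of_sigma)
  show "countably_additive (sets M) (\<lambda>A. emeasure M A + emeasure N A)"
    using assms(1) by (auto simp: countably_additive_def suminf_add[symmetric] suminf_emeasure)
qed (use assms in \<open>auto simp: positive_def sets.sigma_algebra_axioms\<close>)

lemma nn_integral_add_measure:
  assumes N: "sets N = sets M" and f: "f \<in> borel_measurable M"
  shows "(\<integral>\<^sup>+x. f x \<partial>add_measure M N) = (\<integral>\<^sup>+x. f x \<partial>M) + (\<integral>\<^sup>+x. f x \<partial>N)"
  using f
proof (induction rule: borel_measurable_induct)
  case (cong f g)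
  then have "(\<integral>\<^sup>+x. f x \<partial>P) = (\<integral>\<^sup>+x. g x \<partial>P)" if "space P = space M" for P :: "'a measure"
    using that by (intro nn_integral_cong) auto
  with cong(4) show ?case
    by (simp add: sets_eq_imp_space_eq[OF N])
next
  case (set A)
  then show ?case using N by (simp add: emeasure_add_measure)
next
  case (mult u c)
  then have "u \<in> borel_measurable N" using N by (simp cong: measurable_cong_sets)
  then show ?case using mult by (simp add: nn_integral_cmult distrib_left cong: measurable_cong_sets)
next
  case (add u v)
  then have "u \<in> borel_measurable N" "v \<in> borel_measurable N"
    using N by (simp_all cong: measurable_cong_sets)
  then show ?case using add by (simp add: nn_integral_add ac_simps cong: measurable_cong_sets)
next
  case (seq U)
  have incU: "incseq U" using seq by blast
  have U: "U i \<in> borel_measurable N" "U i \<in> borel_measurable (add_measure M N)" for i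
    using N seq(1) by (simp_all cong: measurable_cong_sets)
  have *: "(\<integral>\<^sup>+x. (SUP i. U i) x \<partial>P) = (SUP i. \<integral>\<^sup>+x. U i x \<partial>P)"
    if "\<And>i. U i \<in> borel_measurable P" for P :: "'a measure"
    using nn_integral_monotone_convergence_SUP[OF incU, of P] that by (simp add: SUP_apply image_comp)
  have inc: "incseq (\<lambda>i. \<integral>\<^sup>+x. U i x \<partial>P)" for P
    using incU by (auto simp: incseq_def le_fun_def intro!: nn_integral_mono)
  have IH: "integral\<^sup>N (add_measure M N) (U i) = integral\<^sup>N M (U i) + integral\<^sup>N N (U i)" for i
    using seq by blast
  show ?case
    by (simp only: *[OF U(1)] *[OF U(2)] *[OF seq(1)])
 (simp only: IH, rule ennreal_SUP_add[OF inc inc])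
qed

text \<open>Both summands are Borel measures on the whole space. The completions and restrictions of
  the statement return only when results are transferred to pairs of data.\<close>

definition mu :: "(real ^ 'n::{finite,linorder}) measure" where
  "mu = add_measure (density lborel (indicator Omega)) bdry"

lemma sets_mu [simp, measurable_cong]: "sets mu = sets borel"
  and space_mu [simp]: "space mu = UNIV"
  by (simp_all add: mu_def)

lemma nn_integral_mu:
  assumes [measurable]: "f \<in> borel_measurable borel"
  shows "(\<integral>\<^sup>+x. f x \<partial>mu) = (\<integral>\<^sup>+x. indicator Omega x * f x \<partial>lborel) + (\<integral>\<^sup>+x. f x \<partial>bdry)"
  unfolding mu_def by (subst nn_integral_add_measure) (auto simp: nn_integral_density)

lemma AE_mu_iff:
  assumes [measurable]: "Measurable.pred borel P"
  shows "(AE x in mu. P x) \<longleftrightarrow> (AE x in lborel. x \<in> Omega \<longrightarrow> P x) \<and> (AE x in bdry. P x)"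
proof -
  have [measurable]: "{x. \<not> P x} \<in> sets borel" by measurable
  have "(AE x in mu. P x) \<longleftrightarrow> emeasure mu {x. \<not> P x} = 0"
    by (subst AE_iff_measurable[OF _ refl]) auto
  also have "emeasure mu {x. \<not> P x} = emeasure (density lborel (indicator Omega)) {x. \<not> P x} + emeasure bdry {x. \<not> P x}"
    unfolding mu_def by (rule emeasure_add_measure) auto
  also have "\<dots> = 0 \<longleftrightarrow> (AE x in density lborel (indicator Omega). P x) \<and> (AE x in bdry. P x)"
    by (subst (1 2) AE_iff_measurable[OF _ refl]) auto
  also have "(AE x in density lborel (indicator Omega). P x) \<longleftrightarrow> (AE x in lborel. x \<in> Omega \<longrightarrow> P x)"
    by (subst AE_density) (auto simp: indicator_def intro!: AE_cong)
  finally show ?thesis .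
qed

text \<open>The bounds on G hold on the closed half space only; this turns them into almost
  everywhere bounds for integrals against \<open>mu\<close>.\<close>

lemma AE_mu_closure: "AE x in mu. x \<in> closure (Omega :: (real ^ 'n::{finite,linorder}) set)"
proof (subst AE_mu_iff)
  show "Measurable.pred borel (\<lambda>x. x \<in> closure (Omega :: ((real, 'n) vec) set))" by measurable
  show "(AE x in lborel. x \<in> (Omega :: ((real, 'n) vec) set) \<longrightarrow> x \<in> closure Omega) \<and> (AE x in bdry. x \<in> closure (Omega :: ((real, 'n) vec) set))"
    using AE_bdry by (auto simp: closure_Omega Omega_def)
qed

section \<open>One-dimensional Gaussian integrals\<close>

text \<open>For x > 1 the exponent is rounded up to an integer n, and x^n / n! is a single term of
  the exponential series.\<close>

lemma powr_exp_le:
  fixes x p :: real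
  assumes "0 \<le> x" "0 \<le> p"
  shows "x powr p * exp (- x) \<le> fact (nat \<lceil>p\<rceil>)"
proof (cases "x \<le> 1")
  case True
  have "x powr p \<le> 1"
    using True assms by (intro powr_le1) auto
  moreover have "exp (- x) \<le> 1" using assms by simp
  ultimately have "x powr p * exp (- x) \<le> 1 * 1" by (intro mult_mono) auto
  also have "\<dots> \<le> fact (nat \<lceil>p\<rceil>)" by simp
  finally show ?thesis .
next
  case False
  let ?n = "nat \<lceil>p\<rceil>"
  have "x powr p \<le> x powr (real ?n)"
    using False by (intro powr_mono) (auto simp: le_nat_iff, linarith)
  also have "\<dots> = x ^ ?n" using False by (simp add: powr_realpow)
  also have "\<dots> \<le> fact ?n * exp x"
  proof -
    have "(\<Sum>k\<in>{?n}. x ^ k /\<^sub>R fact k) \<le> (\<Sum>k. x ^ k /\<^sub>R fact k)"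
      using assms by (intro sum_le_suminf summable_exp_generic) auto
    then show ?thesis by (simp add: exp_def field_simps)
  qed
  finally have "x powr p * exp (- x) \<le> fact ?n * exp x * exp (- x)"
    by (intro mult_right_mono) auto
  also have "\<dots> = fact ?n" by (simp add: exp_minus)
  finally show ?thesis .
qed

text \<open>One-sided limits of the primitive replace its endpoint values: at \<tau> = t the
  denominators of the flux integrals vanish.\<close>

lemma nn_integral_FTC_Ioo:
  fixes f F :: "real \<Rightarrow> real"
  assumes "a < b"
    and F: "\<And>x. a < x \<Longrightarrow> x < b \<Longrightarrow> DERIV F x :> f x"
    and f: "\<And>x. a < x \<Longrightarrow> x < b \<Longrightarrow> isCont f x"
    and nn: "\<And>x. a < x \<Longrightarrow> x < b \<Longrightarrow> 0 \<le> f x"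
    and A: "(F \<longlongrightarrow> A) (at_right a)" and B: "(F \<longlongrightarrow> B) (at_left b)"
  shows "(\<integral>\<^sup>+x\<in>{a<..<b}. ennreal (f x) \<partial>lborel) = ennreal (B - A)"
proof -
  have A': "((F \<circ> real_of_ereal) \<longlongrightarrow> A) (at_right (ereal a))"
    and B': "((F \<circ> real_of_ereal) \<longlongrightarrow> B) (at_left (ereal b))"
    using A B by (simp_all add: ereal_tendsto_simps)
  have 1: "set_integrable lborel (einterval (ereal a) (ereal b)) f"
    and 2: "(LBINT x=ereal a..ereal b. f x) = B - A"
    by (rule interval_integral_FTC_nonneg[where F = F and f = f, OF _ _ _ _ A' B'];
        use assms in auto)+
  have "(\<integral>\<^sup>+x\<in>{a<..<b}. ennreal (f x) \<partial>lborel) = (\<integral>\<^sup>+x. ennreal (indicator {a<..<b} x *\<^sub>R f x) \<partial>lborel)"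
    by (intro nn_integral_cong) (auto simp: indicator_def)
  also have "\<dots> = ennreal (\<integral>x. indicator {a<..<b} x *\<^sub>R f x \<partial>lborel)"
    using 1 nn by (intro nn_integral_eq_integral) (auto simp: set_integrable_def indicator_def)
  also have "(\<integral>x. indicator {a<..<b} x *\<^sub>R f x \<partial>lborel) = B - A"
    using 2 \<open>a < b\<close> by (simp add: interval_lebesgue_integral_def set_lebesgue_integral_def)
  finally show ?thesis .
qed

section \<open>The one-dimensional heat kernel and its tail function\<close>

text \<open>The heat kernel on the line, Gamma_1, as a function of position and elapsed
  time.\<close>

definition gss :: "real \<Rightarrow> real \<Rightarrow> real" where
  "gss v s = exp (- (v\<^sup>2 / (4 * s))) / sqrt (4 * pi * s)"

lemma gss_nonneg [simp]: "0 < s \<Longrightarrow> 0 \<le> gss v s"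
  by (simp add: gss_def)

lemma gss_minus [simp]: "gss (- v) s = gss v s"
  by (simp add: gss_def)

lemma gss_diff_commute: "gss (a - b) s = gss (b - a) s"
  by (simp add: gss_def power2_commute)

lemma DERIV_gss:
  assumes "0 < s"
  shows "DERIV (\<lambda>h. gss (a + h) s) h :> - ((a + h) / (2 * s)) * gss (a + h) s"
proof -
  have "DERIV (\<lambda>h. exp (- ((a + h)\<^sup>2 / (4 * s)))) h :> exp (- ((a + h)\<^sup>2 / (4 * s))) * - ((a + h) / (2 * s))"
    using assms by (auto intro!: derivative_eq_intros simp: field_simps power2_eq_square)
  from DERIV_cdivide[OF this, of "sqrt (4 * pi * s)"] show ?thesis
    by (simp add: gss_def mult_ac)
qed

lemma borel_measurable_gss [measurable (raw)]:
  assumes [measurable]: "f \<in> borel_measurable M" "g \<in> borel_measurable M"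
  shows "(\<lambda>x. gss (f x) (g x)) \<in> borel_measurable M"
  unfolding gss_def by measurable

lemma gss_eq_normal_density: "0 < s \<Longrightarrow> gss v s = normal_density 0 (sqrt (2 * s)) v"
  by (simp add: gss_def normal_density_def)

lemma nn_integral_gss: "0 < s \<Longrightarrow> (\<integral>\<^sup>+v. ennreal (gss v s) \<partial>lborel) = 1"
  by (simp add: gss_eq_normal_density nn_integral_eq_integral)

lemma nn_integral_gss_diff: "0 < s \<Longrightarrow> (\<integral>\<^sup>+v. ennreal (gss (a - v) s) \<partial>lborel) = 1"
  using nn_integral_real_affine[of "\<lambda>v. ennreal (gss v s)" "-1" a] nn_integral_gss[of s] by simp

lemma gss_scale: "0 < s \<Longrightarrow> gss (v / sqrt s) 1 / sqrt s = gss v s"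
  by (simp add: gss_def power_divide real_sqrt_mult)

lemma gss_upper: "0 < s \<Longrightarrow> gss v s \<le> 1 / sqrt (4 * pi * s)"
  by (simp add: gss_def divide_right_mono)

text \<open>The upper tail of the normal law with variance 2, that is erfc(b / 2) / 2. Going through
  \<open>cdf\<close> supplies its bounds and its limit at infinity.\<close>

definition Psi :: "real \<Rightarrow> real" where
  "Psi b = 1 - cdf (density lborel (\<lambda>v. ennreal (gss v 1))) b"

lemma real_distribution_gss: "real_distribution (density lborel (\<lambda>v. ennreal (gss v 1)))"
proof -
  have "prob_space (density lborel (\<lambda>v. ennreal (gss v 1)))"
    using prob_space_normal_density[of "sqrt 2" 0] by (simp add: gss_eq_normal_density)
  then show ?thesis
    by (auto simp: real_distribution_def real_distribution_axioms_def)
qed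

lemma Psi_bounds: "0 \<le> Psi b" "Psi b \<le> 1"
proof -
  interpret real_distribution "density lborel (\<lambda>v. ennreal (gss v 1))" by (rule real_distribution_gss)
  show "0 \<le> Psi b" "Psi b \<le> 1"
    using cdf_bounded_prob[of b] cdf_nonneg[of b] by (auto simp: Psi_def)
qed

lemma Psi_at_top: "(Psi \<longlongrightarrow> 0) at_top"
proof -
  interpret real_distribution "density lborel (\<lambda>v. ennreal (gss v 1))" by (rule real_distribution_gss)
  show ?thesis
    unfolding Psi_def[abs_def] using tendsto_diff[OF tendsto_const[of 1] cdf_lim_at_top_prob] by simp
qed

text \<open>Near b the distribution function is a constant plus an integral with variable upper
  limit, so continuity of the density gives the derivative.\<close>

lemma DERIV_Psi: "DERIV Psi b :> - gss b 1"
proof -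
  let ?M = "density lborel (\<lambda>v. ennreal (gss v 1))"
  interpret real_distribution ?M by (rule real_distribution_gss)
  have cont: "continuous_on S (\<lambda>v. gss v 1)" for S
    unfolding gss_def by (intro continuous_intros) auto
  have eq: "cdf ?M x = cdf ?M (b - 1) + integral {b - 1..x} (\<lambda>v. gss v 1)" if "x \<in> {b - 1 .. b + 1}" for x
  proof (cases "x = b - 1")
    case False
    have i: "(\<lambda>v. gss v 1) integrable_on {b - 1..x}"
      by (rule integrable_continuous_interval[OF cont])
    have "emeasure ?M {b - 1<..x} = (\<integral>\<^sup>+v\<in>{b - 1..x}. ennreal (gss v 1) \<partial>lborel)"
      using AE_lborel_singleton[of "b - 1"]
      by (subst emeasure_density)
         (auto intro!: nn_integral_cong_AE elim!: eventually_mono simp: indicator_def)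
    also have "\<dots> = ennreal (integral {b - 1..x} (\<lambda>v. gss v 1))"
      by (subst nn_integral_has_integral_lebesgue[OF _ integrable_integral[OF i], symmetric])
         (auto intro!: nn_integral_cong simp: indicator_def)
    finally have "measure ?M {b - 1<..x} = integral {b - 1..x} (\<lambda>v. gss v 1)"
      by (simp add: measure_def Henstock_Kurzweil_Integration.integral_nonneg i)
    then show ?thesis
      using cdf_diff_eq[of "b - 1" x] that False by auto
  qed simp
  have "((\<lambda>x. integral {b - 1..x} (\<lambda>v. gss v 1)) has_real_derivative gss b 1) (at b within {b - 1 .. b + 1})"
    by (rule integral_has_real_derivative[OF cont]) auto
  from DERIV_diff[OF DERIV_const[of 1] DERIV_add[OF DERIV_const[of "cdf ?M (b - 1)"] this]]
  have "((\<lambda>x. 1 - (cdf ?M (b - 1) + integral {b - 1..x} (\<lambda>v. gss v 1))) has_real_derivative - gss b 1)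
      (at b within {b - 1 .. b + 1})"
    by simp
  then have "(Psi has_real_derivative - gss b 1) (at b within {b - 1 .. b + 1})"
  proof (rule has_field_derivative_transform_within[where d = 1])
    show "1 - (cdf ?M (b - 1) + integral {b - 1..x} (\<lambda>v. gss v 1)) = Psi x" if "x \<in> {b - 1 .. b + 1}" for x
      unfolding Psi_def eq[OF that] ..
  qed auto
  then show ?thesis
    by (simp add: at_within_Icc_at)
qed

lemma isCont_Psi: "isCont Psi b"
  using DERIV_Psi by (rule DERIV_isCont)

lemma filterlim_divide_sqrt_at_top:
  "0 < s \<Longrightarrow> filterlim (\<lambda>h. (a + h) / sqrt s) at_top at_top"
proof -
  assume "0 < s"
  have "filterlim (\<lambda>h. a + h) at_top at_top"
    by (rule filterlim_tendsto_add_at_top[OF tendsto_const filterlim_ident])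
  then have "filterlim (\<lambda>h. 1 / sqrt s * (a + h)) at_top at_top"
    using \<open>0 < s\<close> by (intro filterlim_tendsto_pos_mult_at_top[OF tendsto_const]) auto
  then show ?thesis by simp
qed

text \<open>Scaling by sqrt s reduces to s = 1, where -Psi is a primitive of the Gaussian.\<close>

lemma nn_integral_gss_tail:
  assumes "0 < s"
  shows "(\<integral>\<^sup>+h\<in>{0..}. ennreal (gss (a + h) s) \<partial>lborel) = ennreal (Psi (a / sqrt s))"
proof -
  have "(\<integral>\<^sup>+h\<in>{0..}. ennreal (gss (a + h) s) \<partial>lborel) = ennreal (0 - - Psi ((a + 0) / sqrt s))"
  proof (rule nn_integral_FTC_atLeast)
    show "DERIV (\<lambda>h. - Psi ((a + h) / sqrt s)) h :> gss (a + h) s" for h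
    proof -
      have "((\<lambda>h. (a + h) / sqrt s) has_real_derivative 1 / sqrt s) (at h)"
        by (rule DERIV_cdivide) (auto intro!: derivative_eq_intros)
      from DERIV_minus[OF DERIV_chain2[OF DERIV_Psi this]]
      have "((\<lambda>h. - Psi ((a + h) / sqrt s)) has_real_derivative gss ((a + h) / sqrt s) 1 / sqrt s) (at h)"
        by (simp only: times_divide_eq_right mult_1_right minus_divide_left minus_minus)
      then show ?thesis
        using gss_scale[OF assms, of "a + h"] by simp
    qed
    have "((\<lambda>h. Psi ((a + h) / sqrt s)) \<longlongrightarrow> 0) at_top"
      by (rule filterlim_compose[OF Psi_at_top filterlim_divide_sqrt_at_top[OF assms]])
    then show "((\<lambda>h. - Psi ((a + h) / sqrt s)) \<longlongrightarrow> 0) at_top"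
      using tendsto_minus by fastforce
  qed (use assms in auto)
  then show ?thesis by simp
qed

text \<open>The total mass 1 is split at v = 0; since the Gaussian is even, reflecting the negative
  half turns it into the other tail.\<close>

lemma Psi_minus: "Psi (- b) = 1 - Psi b"
proof -
  have "ennreal 1 = (\<integral>\<^sup>+v. ennreal (gss (b + v) 1) \<partial>lborel)"
    using nn_integral_gss_diff[of 1 "-b"] by (simp add: gss_diff_commute[of "-b"] add.commute)
  also have "\<dots> = (\<integral>\<^sup>+v. ennreal (gss (b + v) 1) * indicator {0..} v + ennreal (gss (b + v) 1) * indicator {..<0} v \<partial>lborel)"
    by (intro nn_integral_cong) (auto simp: indicator_def)
  also have "\<dots> = (\<integral>\<^sup>+v\<in>{0..}. ennreal (gss (b + v) 1) \<partial>lborel) + (\<integral>\<^sup>+v\<in>{..<0}. ennreal (gss (b + v) 1) \<partial>lborel)"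
    by (rule nn_integral_add) auto
  also have "(\<integral>\<^sup>+v\<in>{..<0}. ennreal (gss (b + v) 1) \<partial>lborel) = (\<integral>\<^sup>+v. ennreal (gss (b - v) 1) * indicator {..<0} (- v) \<partial>lborel)"
    using nn_integral_real_affine[of "\<lambda>v. ennreal (gss (b + v) 1) * indicator {..<0} v" "-1" 0] by simp
  also have "\<dots> = (\<integral>\<^sup>+v\<in>{0..}. ennreal (gss (- b + v) 1) \<partial>lborel)"
    using AE_lborel_singleton[of 0] gss_diff_commute[of b _ 1]
    by (intro nn_integral_cong_AE) (auto elim!: eventually_mono simp: indicator_def)
  finally have "ennreal 1 = ennreal (Psi b + Psi (- b))"
    using nn_integral_gss_tail[of 1 b] nn_integral_gss_tail[of 1 "- b"] by (simp add: Psi_bounds)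
  then have "1 = Psi b + Psi (- b)"
    using Psi_bounds by (subst (asm) ennreal_inj) (auto intro: add_nonneg_nonneg)
  then show ?thesis by simp
qed

text \<open>The integrand is the derivative of -2 \<open>gss\<close>. It serves twice: for the flux
  integrated over all heights in \<open>nn_integral_Kn_mu\<close>, and for the early part of the
  \<tau>-integral in \<open>Kn_le\<close>.\<close>

lemma nn_integral_moment_tail:
  assumes "0 < s" "0 \<le> a"
  shows "(\<integral>\<^sup>+h\<in>{0..}. ennreal ((a + h) / s * gss (a + h) s) \<partial>lborel) = ennreal (2 * gss a s)"
proof -
  have "(\<integral>\<^sup>+h\<in>{0..}. ennreal ((a + h) / s * gss (a + h) s) \<partial>lborel) = ennreal (0 - - 2 * gss (a + 0) s)"
  proof (rule nn_integral_FTC_atLeast)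
    show "DERIV (\<lambda>h. - 2 * gss (a + h) s) h :> (a + h) / s * gss (a + h) s" for h
      using DERIV_cmult[OF DERIV_gss[OF assms(1), of a h], of "- 2"] by simp
    have "((\<lambda>v. gss v s) \<longlongrightarrow> 0) at_top"
    proof -
      have "filterlim (\<lambda>v::real. 1 / (4 * s) * v\<^sup>2) at_top at_top"
        using assms by (intro filterlim_tendsto_pos_mult_at_top[OF tendsto_const] filterlim_pow_at_top filterlim_ident) auto
      then have "filterlim (\<lambda>v. - (v\<^sup>2 / (4 * s))) at_bot at_top"
        by (simp add: filterlim_uminus_at_bot)
      then have "((\<lambda>v. exp (- (v\<^sup>2 / (4 * s)))) \<longlongrightarrow> 0) at_top"
        by (rule filterlim_compose[OF exp_at_bot])
      then show ?thesis
        unfolding gss_def using tendsto_divide_zero by blast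
    qed
    then have "((\<lambda>h. gss (a + h) s) \<longlongrightarrow> 0) at_top"
      by (rule filterlim_compose) (rule filterlim_tendsto_add_at_top[OF tendsto_const filterlim_ident])
    from tendsto_mult_right_zero[OF this, of "-2"]
    show "((\<lambda>h. - 2 * gss (a + h) s) \<longlongrightarrow> 0) at_top"
      by simp
  qed (use assms in auto)
  then show ?thesis by simp
qed

text \<open>The integrand is the total derivative of \<open>- Psi (k (z + \<tau>) / sqrt (t - \<tau>))\<close>.\<close>

lemma nn_integral_flux:
  assumes "0 < t" "0 \<le> z" "0 < k"
  shows "(\<integral>\<^sup>+\<tau>\<in>{0<..<t}. ennreal (k * (1 + (z + \<tau>) / (2 * (t - \<tau>))) * gss (k * (z + \<tau>)) (t - \<tau>)) \<partial>lborel)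
     = ennreal (Psi (k * z / sqrt t))"
proof -
  \<comment> \<open>The parameter k is 1 in the mass computation, and 1 / sqrt 2 in the pointwise
    bound, where half of the exponent has already been spent.\<close>
  let ?F = "\<lambda>\<tau>. - Psi (k * (z + \<tau>) / sqrt (t - \<tau>))"
  have "(\<integral>\<^sup>+\<tau>\<in>{0<..<t}. ennreal (k * (1 + (z + \<tau>) / (2 * (t - \<tau>))) * gss (k * (z + \<tau>)) (t - \<tau>)) \<partial>lborel)
     = ennreal (0 - (- Psi (k * (z + 0) / sqrt (t - 0))))"
  proof (rule nn_integral_FTC_Ioo[where F = ?F])
    fix \<tau> assume \<tau>: "0 < \<tau>" "\<tau> < t"
    have "((\<lambda>\<tau>. k * (z + \<tau>) / sqrt (t - \<tau>)) has_real_derivative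
        k * (1 + (z + \<tau>) / (2 * (t - \<tau>))) / sqrt (t - \<tau>)) (at \<tau>)"
    proof -
      define r where "r = sqrt (t - \<tau>)"
      have r: "0 < r" "t - \<tau> = r\<^sup>2" using \<tau> by (auto simp: r_def)
      have 1: "((\<lambda>\<tau>. sqrt (t - \<tau>)) has_real_derivative - (1 / (2 * r))) (at \<tau>)"
        using \<tau> by (auto intro!: derivative_eq_intros simp: r_def field_simps)
      have 2: "((\<lambda>\<tau>. k * (z + \<tau>)) has_real_derivative k) (at \<tau>)"
        by (auto intro!: derivative_eq_intros)
      from DERIV_divide[OF 2 1] have "((\<lambda>\<tau>. k * (z + \<tau>) / sqrt (t - \<tau>)) has_real_derivative
          (k * r - k * (z + \<tau>) * - (1 / (2 * r))) / (r * r)) (at \<tau>)"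
        using r(1) by (simp add: r_def)
      also have "(k * r - k * (z + \<tau>) * - (1 / (2 * r))) / (r * r) = k * (1 + (z + \<tau>) / (2 * (t - \<tau>))) / r"
        unfolding r(2) using r(1) by (simp add: field_simps power2_eq_square)
      finally show ?thesis unfolding r_def .
    qed
    note d = DERIV_minus[OF DERIV_chain2[OF DERIV_Psi this]]
    have g: "gss (k * (z + \<tau>) / sqrt (t - \<tau>)) 1 / sqrt (t - \<tau>) = gss (k * (z + \<tau>)) (t - \<tau>)"
      using \<tau> by (intro gss_scale) simp
    show "DERIV ?F \<tau> :> k * (1 + (z + \<tau>) / (2 * (t - \<tau>))) * gss (k * (z + \<tau>)) (t - \<tau>)"
      by (rule DERIV_cong[OF d], unfold g[symmetric]) (simp only: minus_mult_left[symmetric] minus_minus times_divide_eq_right times_divide_eq_left mult.commute)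
    show "isCont (\<lambda>\<tau>. k * (1 + (z + \<tau>) / (2 * (t - \<tau>))) * gss (k * (z + \<tau>)) (t - \<tau>)) \<tau>"
    proof -
      have "4 * (t - \<tau>) \<noteq> 0" "2 * (t - \<tau>) \<noteq> 0" "sqrt (4 * pi * (t - \<tau>)) \<noteq> 0"
        using \<tau> by simp_all
      then show ?thesis
        unfolding gss_def by (intro continuous_intros)
    qed
    show "0 \<le> k * (1 + (z + \<tau>) / (2 * (t - \<tau>))) * gss (k * (z + \<tau>)) (t - \<tau>)"
      using \<tau> assms by (intro mult_nonneg_nonneg add_nonneg_nonneg divide_nonneg_nonneg) auto
  next
    have "isCont ?F 0"
      using assms by (intro continuous_intros isCont_o2[OF _ isCont_Psi]) auto
    then show "(?F \<longlongrightarrow> - Psi (k * (z + 0) / sqrt (t - 0))) (at_right 0)"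
      unfolding isCont_def by (rule tendsto_mono[rotated]) (simp add: at_le)
    \<comment> \<open>The numerator stays near k (z + t) > 0, also for z = 0, while the root
      vanishes; the argument of \<open>Psi\<close> escapes to infinity and \<tau> = t contributes
      nothing.\<close>
    have "filterlim (\<lambda>\<tau>. k * (z + \<tau>) / sqrt (t - \<tau>)) at_top (at_left t)"
    proof (rule LIM_at_top_divide)
      show "((\<lambda>\<tau>. k * (z + \<tau>)) \<longlongrightarrow> k * (z + t)) (at_left t)" by (intro tendsto_intros)
      show "0 < k * (z + t)" using assms by simp
      have "((\<lambda>\<tau>. sqrt (t - \<tau>)) \<longlongrightarrow> sqrt (t - t)) (at_left t)" by (intro tendsto_intros)
      then show "((\<lambda>\<tau>. sqrt (t - \<tau>)) \<longlongrightarrow> 0) (at_left t)" by simp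
      show "\<forall>\<^sub>F \<tau> in at_left t. 0 < sqrt (t - \<tau>)" by (auto simp: eventually_at_filter)
    qed
    from tendsto_minus[OF filterlim_compose[OF Psi_at_top this]]
    show "(?F \<longlongrightarrow> 0) (at_left t)" by simp
  qed (use assms in auto)
  then show ?thesis by simp
qed

lemma nn_integral_inverse_sqrt:
  assumes "0 < t"
  shows "(\<integral>\<^sup>+\<tau>\<in>{0<..<t}. ennreal (1 / sqrt (t - \<tau>)) \<partial>lborel) = ennreal (2 * sqrt t)"
proof -
  have "(\<integral>\<^sup>+\<tau>\<in>{0<..<t}. ennreal (1 / sqrt (t - \<tau>)) \<partial>lborel) = ennreal (- 2 * sqrt (t - t) - - 2 * sqrt (t - 0))"
  proof (rule nn_integral_FTC_Ioo)
    fix \<tau> assume \<tau>: "0 < \<tau>" "\<tau> < t"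
    show "DERIV (\<lambda>\<tau>. - 2 * sqrt (t - \<tau>)) \<tau> :> 1 / sqrt (t - \<tau>)"
      using \<tau> by (auto intro!: derivative_eq_intros simp: field_simps)
    show "isCont (\<lambda>\<tau>. 1 / sqrt (t - \<tau>)) \<tau>"
      using \<tau> by (intro continuous_intros) auto
    show "0 \<le> 1 / sqrt (t - \<tau>)" using \<tau> by simp
  next
    show "((\<lambda>\<tau>. - 2 * sqrt (t - \<tau>)) \<longlongrightarrow> - 2 * sqrt (t - 0)) (at_right 0)"
      and "((\<lambda>\<tau>. - 2 * sqrt (t - \<tau>)) \<longlongrightarrow> - 2 * sqrt (t - t)) (at_left t)"
      by (intro tendsto_intros)+
  qed (use assms in auto)
  then show ?thesis by simp
qed

section \<open>The boundary flux kernel\<close>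

lemma Gauss_nonneg [simp]: "0 \<le> Gauss x t"
  by (simp add: Gauss_def)

lemma borel_measurable_Gauss [measurable (raw)]:
  assumes [measurable]: "f \<in> borel_measurable M" "g \<in> borel_measurable M"
  shows "(\<lambda>x. Gauss (f x) (g x)) \<in> borel_measurable M"
  unfolding Gauss_def by measurable

lemma Gauss_prod:
  fixes x :: "real ^ 'n::finite"
  assumes "0 < s"
  shows "Gauss x s = (\<Prod>i\<in>UNIV. gss (x $ i) s)"
proof -
  have "(norm x)\<^sup>2 = (\<Sum>i\<in>UNIV. (x $ i)\<^sup>2)"
    by (simp add: norm_vec_def L2_set_def sum_nonneg)
  then have "exp (- ((norm x)\<^sup>2 / (4 * s))) = (\<Prod>i\<in>UNIV. exp (- ((x $ i)\<^sup>2 / (4 * s))))"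
    by (simp add: exp_sum sum_divide_distrib flip: sum_negf)
  moreover have "(4 * pi * s) powr (- (real CARD('n) / 2)) = (\<Prod>i\<in>(UNIV :: 'n set). 1 / sqrt (4 * pi * s))"
  proof -
    have "(4 * pi * s) powr (- (real CARD('n) / 2)) = ((4 * pi * s) powr (- 1 / 2)) powr real CARD('n)"
      by (simp add: powr_powr)
    also have "\<dots> = (1 / sqrt (4 * pi * s)) ^ CARD('n)"
      using assms by (simp add: powr_realpow powr_minus_divide powr_half_sqrt)
    finally show ?thesis by simp
  qed
  ultimately show ?thesis
    unfolding Gauss_def gss_def by (simp add: prod_dividef power_one_over)
qed

text \<open>The N - 1 tangential factors have mass one each, and the normal factor is constant on
  the boundary.\<close>

lemma nn_integral_Gauss_bdry:
  fixes x :: "real ^ 'n::{finite,linorder}"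
  assumes "0 < s"
  shows "(\<integral>\<^sup>+y. ennreal (Gauss (x - y) s) \<partial>bdry) = ennreal (gss (x $ lastc) s)"
proof -
  let ?I = "UNIV - {lastc :: 'n}"
  have "(\<integral>\<^sup>+y. ennreal (Gauss (x - y) s) \<partial>bdry)
      = (\<integral>\<^sup>+z. ennreal (gss (x $ lastc) s) * (\<Prod>i\<in>?I. ennreal (gss (x $ i - z i) s)) \<partial>(\<Pi>\<^sub>M i\<in>?I. lborel))"
  proof (subst nn_integral_bdry, measurable, rule nn_integral_cong)
    fix z :: "'n \<Rightarrow> real"
    have "Gauss (x - hyperplane_embed z) s = gss (x $ lastc) s * (\<Prod>i\<in>?I. gss (x $ i - z i) s)"
      unfolding Gauss_prod[OF assms]
      by (subst prod.remove[of _ lastc]) (auto simp: hyperplane_embed_def)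
    then show "ennreal (Gauss (x - hyperplane_embed z) s)
       = ennreal (gss (x $ lastc) s) * (\<Prod>i\<in>?I. ennreal (gss (x $ i - z i) s))"
      using assms by (simp add: ennreal_mult prod_nonneg prod_ennreal)
  qed
  also have "\<dots> = ennreal (gss (x $ lastc) s) * (\<Prod>i\<in>?I. \<integral>\<^sup>+v. ennreal (gss (x $ i - v) s) \<partial>lborel)"
    by (subst nn_integral_cmult, measurable, subst lborel_prod.product_nn_integral_prod) auto
  also have "\<dots> = ennreal (gss (x $ lastc) s)"
    using assms by (simp add: nn_integral_gss_diff)
  finally show ?thesis .
qed

lemma nn_integral_Gauss_lborel:
  fixes x :: "real ^ 'n::{finite,linorder}"
  assumes "0 < s"
  shows "(\<integral>\<^sup>+y. ennreal (Gauss (x - y) s) \<partial>lborel) = 1"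
proof -
  have "(\<integral>\<^sup>+y. ennreal (Gauss (x - (y + h *\<^sub>R eN)) s) \<partial>bdry) = ennreal (gss (x $ lastc - h) s)" for h
    using nn_integral_Gauss_bdry[OF assms, of "x - h *\<^sub>R eN"] by (simp add: algebra_simps)
  then show ?thesis
    using assms by (simp add: nn_integral_lborel_slices nn_integral_gss_diff)
qed

text \<open>The single height h = 0 is a null set for the volume, so the closed half line may be
  used; the boundary enters only through the second summand.\<close>

lemma nn_integral_mu_slices:
  assumes [measurable]: "f \<in> borel_measurable borel"
  shows "(\<integral>\<^sup>+x. f x \<partial>mu) = (\<integral>\<^sup>+h\<in>{0..}. (\<integral>\<^sup>+y. f (y + h *\<^sub>R eN) \<partial>bdry) \<partial>lborel) + (\<integral>\<^sup>+y. f y \<partial>bdry)"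
proof -
  have "(\<integral>\<^sup>+x. indicator Omega x * f x \<partial>lborel)
     = (\<integral>\<^sup>+h. (\<integral>\<^sup>+y. indicator Omega (y + h *\<^sub>R eN) * f (y + h *\<^sub>R eN) \<partial>bdry) \<partial>lborel)"
    by (subst nn_integral_lborel_slices) auto
  also have "\<dots> = (\<integral>\<^sup>+h\<in>{0..}. (\<integral>\<^sup>+y. f (y + h *\<^sub>R eN) \<partial>bdry) \<partial>lborel)"
  proof (rule nn_integral_cong_AE)
    have "(\<integral>\<^sup>+y. indicator Omega (y + h *\<^sub>R eN) * f (y + h *\<^sub>R eN) \<partial>bdry)
       = (\<integral>\<^sup>+y. f (y + h *\<^sub>R eN) \<partial>bdry) * indicator {0..} h" if "h \<noteq> 0" for h
    proof -
      have "(\<integral>\<^sup>+y. indicator Omega (y + h *\<^sub>R eN) * f (y + h *\<^sub>R eN) \<partial>bdry)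
        = (\<integral>\<^sup>+y. f (y + h *\<^sub>R eN) * indicator {0..} h \<partial>bdry)"
        using AE_bdry that
        by (intro nn_integral_cong_AE) (auto elim!: eventually_mono simp: indicator_def Omega_def)
      then show ?thesis by (simp add: nn_integral_multc)
    qed
    then show "AE h in lborel. (\<integral>\<^sup>+y. indicator Omega (y + h *\<^sub>R eN) * f (y + h *\<^sub>R eN) \<partial>bdry)
       = (\<integral>\<^sup>+y. f (y + h *\<^sub>R eN) \<partial>bdry) * indicator {0..} h"
      using AE_lborel_singleton[of 0] by (auto elim!: eventually_mono)
  qed
  finally show ?thesis by (simp add: nn_integral_mu)
qed

lemma sigma_finite_mu: "sigma_finite_measure (mu :: (real ^ 'n::{finite,linorder}) measure)"
proof -
  obtain A :: "nat \<Rightarrow> ((real, 'n) vec) set" where A: "range A \<subseteq> sets lborel" "(\<Union>i. A i) = space lborel"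
    "\<And>i. emeasure lborel (A i) \<noteq> \<infinity>"
    using sigma_finite_measure.sigma_finite[OF sigma_finite_lborel] by metis
  obtain C :: "nat \<Rightarrow> ((real, 'n) vec) set" where C: "range C \<subseteq> sets bdry" "(\<Union>i. C i) = space bdry"
    "\<And>i. emeasure bdry (C i) \<noteq> \<infinity>"
    using sigma_finite_measure.sigma_finite[OF sigma_finite_bdry] by metis
  have [measurable]: "A i \<in> sets borel" "C i \<in> sets borel" for i
    using A C by auto
  let ?D = "\<lambda>(i, j). A i \<inter> C j"
  have fin: "emeasure mu (A i \<inter> C j) \<noteq> \<infinity>" for i j
  proof -
    have "emeasure mu (A i \<inter> C j) = (\<integral>\<^sup>+x. indicator (A i \<inter> C j) x \<partial>mu)" by simp
    also have "\<dots> = (\<integral>\<^sup>+x. indicator Omega x * indicator (A i \<inter> C j) x \<partial>lborel) + (\<integral>\<^sup>+x. indicator (A i \<inter> C j) x \<partial>bdry)"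
      by (rule nn_integral_mu) auto
    also have "\<dots> \<le> (\<integral>\<^sup>+x. indicator (A i) x \<partial>lborel) + (\<integral>\<^sup>+x. indicator (C j) x \<partial>bdry)"
      by (intro add_mono nn_integral_mono) (auto simp: indicator_def)
    also have "\<dots> = emeasure lborel (A i) + emeasure bdry (C j)" by simp
    also have "\<dots> < \<infinity>" using A(3)[of i] C(3)[of j] by (simp add: less_top)
    finally show ?thesis by simp
  qed
  have "(\<Union>p. ?D p) = UNIV"
  proof (intro set_eqI iffI UNIV_I)
    fix x :: "(real, 'n) vec"
    have "x \<in> (\<Union>i. A i)" "x \<in> (\<Union>i. C i)" using A C by auto
    then show "x \<in> (\<Union>p. ?D p)" by auto
  qed
  then show ?thesis
    using fin by (intro sigma_finite_measure.intro exI[of _ "range ?D"]) auto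
qed

section \<open>The integrand of the third term of G and a pointwise bound on its integral\<close>

text \<open>By \<open>pd_Gauss\<close> this is -2 times the x_N-derivative of the heat kernel at
  elapsed time t - \<tau>, shifted by \<tau> along \<open>eN\<close>: the integrand of the third
  term of G with its sign and factor.\<close>

definition flux :: "real ^ 'n::{finite,linorder} \<Rightarrow> real \<Rightarrow> real \<Rightarrow> real" where
  "flux w t \<tau> = (w $ lastc + \<tau>) / (t - \<tau>) * Gauss (w + \<tau> *\<^sub>R eN) (t - \<tau>)"

lemma borel_measurable_vec_nth [measurable (raw)]:
  fixes f :: "'a \<Rightarrow> real ^ 'n::finite"
  assumes "f \<in> borel_measurable M"
  shows "(\<lambda>x. f x $ i) \<in> borel_measurable M"
  using assms by (rule measurable_compose) (intro borel_measurable_continuous_onI continuous_intros)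

lemma borel_measurable_flux [measurable (raw)]:
  assumes [measurable]: "f \<in> borel_measurable M" "g \<in> borel_measurable M" "h \<in> borel_measurable M"
  shows "(\<lambda>x. flux (f x) (g x) (h x)) \<in> borel_measurable M"
  unfolding flux_def by measurable

lemma flux_nonneg: "0 \<le> w $ lastc \<Longrightarrow> 0 < \<tau> \<Longrightarrow> \<tau> < t \<Longrightarrow> 0 \<le> flux w t \<tau>"
  by (auto simp: flux_def intro!: mult_nonneg_nonneg)

lemma pd_Gauss: "0 < s \<Longrightarrow> pd lastc (\<lambda>z. Gauss z s) w = - (w $ lastc / (2 * s)) * Gauss w s"
proof -
  assume s: "0 < s"
  have "norm (w + h *\<^sub>R axis lastc 1) ^ 2 = (norm w)\<^sup>2 + 2 * h * w $ lastc + h\<^sup>2" for h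
    unfolding eN_def[symmetric] power2_norm_eq_inner
    by (simp add: inner_add_left inner_add_right inner_commute[of eN] power2_eq_square algebra_simps)
  then have "(\<lambda>h. Gauss (w + h *\<^sub>R axis lastc 1) s)
     = (\<lambda>h. (4 * pi * s) powr (- (real CARD('a) / 2)) * exp (- (((norm w)\<^sup>2 + 2 * h * w $ lastc + h\<^sup>2) / (4 * s))))"
    by (simp add: Gauss_def)
  moreover have "((\<lambda>h. exp (- (((norm w)\<^sup>2 + 2 * h * w $ lastc + h\<^sup>2) / (4 * s)))) has_real_derivative
     exp (- ((norm w)\<^sup>2 / (4 * s))) * - (w $ lastc / (2 * s))) (at 0)"
    using s by (auto intro!: derivative_eq_intros simp: field_simps)
  ultimately have "((\<lambda>h. Gauss (w + h *\<^sub>R axis lastc 1) s) has_real_derivative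
     (4 * pi * s) powr (- (real CARD('a) / 2)) * (exp (- ((norm w)\<^sup>2 / (4 * s))) * - (w $ lastc / (2 * s)))) (at 0)"
    by (simp only: DERIV_cmult)
  from DERIV_imp_deriv[OF this] show ?thesis
    by (simp add: pd_def Gauss_def mult_ac)
qed

definition Kker :: "real ^ 'n::{finite,linorder} \<Rightarrow> real \<Rightarrow> real" where
  "Kker w t = (LBINT \<tau>:{0<..<t}. flux w t \<tau>)"

lemma Gker_eq: "Gker x y t = Gauss (x - y) t - Gauss (x - refl_pt y) t + Kker (x - refl_pt y) t"
proof -
  have "- 2 * (LBINT \<tau>:{0<..<t}. pd lastc (\<lambda>z. Gauss z (t - \<tau>)) (x - refl_pt y + \<tau> *\<^sub>R eN))
     = (LBINT \<tau>:{0<..<t}. - 2 * pd lastc (\<lambda>z. Gauss z (t - \<tau>)) (x - refl_pt y + \<tau> *\<^sub>R eN))"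
    by (rule set_integral_mult_right[symmetric])
  also have "\<dots> = Kker (x - refl_pt y) t"
    unfolding Kker_def
    by (rule set_lebesgue_integral_cong) (auto simp: pd_Gauss flux_def divide_simps)
  finally show ?thesis by (simp add: Gker_def)
qed

text \<open>The same integral with values in \<open>ennreal\<close>, so that integrals can be
  interchanged before finiteness is known. After \<open>Kn_le\<close> it is identified with
  \<open>Kker\<close>.\<close>

definition Kn :: "real ^ 'n::{finite,linorder} \<Rightarrow> real \<Rightarrow> ennreal" where
  "Kn w t = (\<integral>\<^sup>+\<tau>\<in>{0<..<t}. ennreal (flux w t \<tau>) \<partial>lborel)"

lemma borel_measurable_Kn [measurable (raw)]:
  fixes f :: "'a \<Rightarrow> real ^ 'n::{finite,linorder}"
  assumes [measurable]: "f \<in> borel_measurable M" "g \<in> borel_measurable M"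
  shows "(\<lambda>x. Kn (f x) (g x)) \<in> borel_measurable M"
proof -
  have "Kn w t = (\<integral>\<^sup>+\<tau>. (if 0 < \<tau> \<and> \<tau> < t then ennreal (flux w t \<tau>) else 0) \<partial>lborel)" for w :: "(real, 'n) vec" and t
    unfolding Kn_def by (intro nn_integral_cong) (auto simp: indicator_def)
  then show ?thesis by simp
qed

text \<open>With x = a^2 / (8 s) one has 4 pi s = (pi / 2) a^2 / x. The power of x is absorbed by
  the exponential through \<open>powr_exp_le\<close>, and the power of a^2 is estimated by a >= t /
  2.\<close>

lemma powr_exp_gauss_le:
  fixes a s t p :: real
  assumes "0 < s" "0 < t" "t / 2 \<le> a" "0 \<le> p"
  shows "(4 * pi * s) powr (- p) * exp (- (a\<^sup>2 / (8 * s)))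
     \<le> fact (nat \<lceil>p\<rceil>) * (pi / 8) powr (- p) * t powr (- 2 * p)"
proof -
  define x where "x = a\<^sup>2 / (8 * s)"
  have a: "0 < a" using assms by linarith
  have x: "0 < x" using a assms by (simp add: x_def)
  have "4 * pi * s = (pi / 2 * a\<^sup>2) / x"
    using a assms by (simp add: x_def field_simps)
  then have "(4 * pi * s) powr (- p) = (pi / 2 * a\<^sup>2) powr (- p) / x powr (- p)"
    using x a by (simp only: powr_divide)
  also have "\<dots> = (pi / 2 * a\<^sup>2) powr (- p) * x powr p"
    by (simp add: powr_minus_divide)
  finally have "(4 * pi * s) powr (- p) = (pi / 2 * a\<^sup>2) powr (- p) * x powr p" .
  moreover have "(pi / 2 * a\<^sup>2) powr (- p) \<le> (pi / 8 * t\<^sup>2) powr (- p)"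
  proof -
    have "(t / 2)\<^sup>2 \<le> a\<^sup>2" using assms by (intro power_mono) auto
    then have "pi / 8 * t\<^sup>2 \<le> pi / 2 * a\<^sup>2" by (simp add: power_divide)
    then show ?thesis using assms by (intro powr_mono2') auto
  qed
  moreover have "(pi / 8 * t\<^sup>2) powr (- p) = (pi / 8) powr (- p) * t powr (- 2 * p)"
  proof -
    have "(pi / 8 * t powr 2) powr (- p) = (pi / 8) powr (- p) * t powr (2 * - p)"
      by (simp only: powr_mult powr_powr)
    then show ?thesis using assms by simp
  qed
  ultimately have "(4 * pi * s) powr (- p) \<le> (pi / 8) powr (- p) * t powr (- 2 * p) * x powr p"
    by (simp only: mult_right_mono powr_ge_zero)
  then have "(4 * pi * s) powr (- p) * exp (- x)
     \<le> ((pi / 8) powr (- p) * t powr (- 2 * p) * x powr p) * exp (- x)"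
    by (rule mult_right_mono) simp
  also have "\<dots> = ((pi / 8) powr (- p) * t powr (- 2 * p)) * (x powr p * exp (- x))"
    by (simp only: mult.assoc)
  also have "\<dots> \<le> ((pi / 8) powr (- p) * t powr (- 2 * p)) * fact (nat \<lceil>p\<rceil>)"
    using x assms by (intro mult_left_mono powr_exp_le) auto
  finally show ?thesis by (simp add: x_def mult_ac)
qed

text \<open>For \<open>\<tau> \<le> t / 2\<close> the elapsed time \<open>t - \<tau>\<close> is comparable to \<open>t\<close>; for \<open>\<tau> > t / 2\<close> the point is at
  distance at least \<open>t / 2\<close> from the pole, and half of the exponential absorbs the \<open>N - 1\<close>
  tangential powers of the elapsed time.\<close>

definition flux_const :: "nat \<Rightarrow> real" where
  "flux_const N = fact (nat \<lceil>(real N - 1) / 2\<rceil>) * (pi / 8) powr (- ((real N - 1) / 2)) * (2 * sqrt 2)"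

lemma flux_const_nonneg: "0 \<le> flux_const N"
  by (simp add: flux_const_def)

lemma norm_shift_ge: "\<bar>w $ lastc + \<tau>\<bar> \<le> norm (w + \<tau> *\<^sub>R eN)"
  using component_le_norm_cart[of "w + \<tau> *\<^sub>R eN" lastc] by simp

lemma flux_le:
  fixes w :: "real ^ 'n::{finite,linorder}"
  assumes "0 \<le> w $ lastc" "0 < \<tau>" "\<tau> < t"
  defines "a \<equiv> w $ lastc + \<tau>" and "k \<equiv> 1 / sqrt 2" and "N \<equiv> real CARD('n)"
  shows "flux w t \<tau> \<le> (2 * pi * t) powr (- N / 2) * (2 * sqrt (4 * pi * t)) * (a / t * gss a t)
     + flux_const CARD('n) * t powr (- (N - 1)) * (k * (1 + a / (2 * (t - \<tau>))) * gss (k * a) (t - \<tau>))"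
    (is "_ \<le> ?A + ?B")
proof -
  define s where "s = t - \<tau>"
  have s: "0 < s" "s < t" "0 < a" "0 < t" using assms by (auto simp: s_def a_def)
  have N1: "1 \<le> N" by (simp add: N_def Suc_le_eq)
  have "(w $ lastc + \<tau>)\<^sup>2 \<le> (norm (w + \<tau> *\<^sub>R eN))\<^sup>2"
    using norm_shift_ge[of w \<tau>] by (rule power2_le_iff_abs_le[THEN iffD2, rotated]) simp
  then have "exp (- ((norm (w + \<tau> *\<^sub>R eN))\<^sup>2 / (4 * s))) \<le> exp (- (a\<^sup>2 / (4 * s)))"
    using s by (simp add: a_def divide_right_mono)
  then have G: "Gauss (w + \<tau> *\<^sub>R eN) s \<le> (4 * pi * s) powr (- N / 2) * exp (- (a\<^sup>2 / (4 * s)))"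
    unfolding Gauss_def N_def by (simp add: mult_left_mono)
  have f: "flux w t \<tau> \<le> a / s * ((4 * pi * s) powr (- N / 2) * exp (- (a\<^sup>2 / (4 * s))))"
    unfolding flux_def s_def[symmetric] a_def[symmetric]
    using s by (intro mult_left_mono G) auto
  have k: "0 < k" "k\<^sup>2 = 1 / 2" "1 / k = sqrt 2" by (auto simp: k_def power_divide)
  have A: "0 \<le> ?A" using s by (intro mult_nonneg_nonneg) auto
  have B: "0 \<le> ?B" unfolding s_def[symmetric]
    using s k(1) by (intro mult_nonneg_nonneg flux_const_nonneg) auto
  show ?thesis
  proof (cases "t / 2 \<le> s")
    case True
    \<comment> \<open>For s between t / 2 and t every factor is replaced by its extreme value, so
      \<tau> survives only through a, in the form that \<open>nn_integral_moment_tail\<close>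
      integrates.\<close>
    have "a / s * ((4 * pi * s) powr (- N / 2) * exp (- (a\<^sup>2 / (4 * s))))
       \<le> a / (t / 2) * ((2 * pi * t) powr (- N / 2) * exp (- (a\<^sup>2 / (4 * t))))"
    proof (intro mult_mono)
      show "a / s \<le> a / (t / 2)" using True s by (intro divide_left_mono) auto
      show "(4 * pi * s) powr (- N / 2) \<le> (2 * pi * t) powr (- N / 2)"
        using True s N1 by (intro powr_mono2') auto
      show "exp (- (a\<^sup>2 / (4 * s))) \<le> exp (- (a\<^sup>2 / (4 * t)))"
        using s by (auto intro!: divide_left_mono)
    qed (use s in auto)
    also have "\<dots> = ?A"
      using s by (simp add: gss_def field_simps)
    finally show ?thesis using f B by linarith
  next
    case False
    define p where "p = (N - 1) / 2"
    have "t / 2 \<le> a" using False assms by (auto simp: s_def a_def)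
    then have P: "(4 * pi * s) powr (- p) * exp (- (a\<^sup>2 / (8 * s)))
       \<le> fact (nat \<lceil>p\<rceil>) * (pi / 8) powr (- p) * t powr (- 2 * p)"
      using s N1 by (intro powr_exp_gauss_le) (auto simp: p_def)
    have e: "exp (- (a\<^sup>2 / (4 * s))) = exp (- (a\<^sup>2 / (8 * s))) * exp (- (a\<^sup>2 / (8 * s)))"
      by (simp add: exp_add[symmetric])
    have "- N / 2 = - p + - 1 / 2" by (simp add: p_def field_simps)
    then have "(4 * pi * s) powr (- N / 2) = (4 * pi * s) powr (- p) * (4 * pi * s) powr (- 1 / 2)"
      by (simp only: powr_add)
    also have "(4 * pi * s) powr (- 1 / 2) = 1 / sqrt (4 * pi * s)"
      using s by (simp add: powr_minus_divide powr_half_sqrt)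
    finally have pw: "(4 * pi * s) powr (- N / 2) = (4 * pi * s) powr (- p) / sqrt (4 * pi * s)" by simp
    have gk: "gss (k * a) s = exp (- (a\<^sup>2 / (8 * s))) / sqrt (4 * pi * s)"
      by (simp add: gss_def power_mult_distrib k)
    \<comment> \<open>Origin of the factor 2 sqrt 2 in \<open>flux_const\<close>: it enlarges a / s
      to 2 + a / s, which makes the integrand the total derivative of
      \<open>nn_integral_flux\<close>.\<close>
    have ak: "a / s \<le> 2 * sqrt 2 * (k * (1 + a / (2 * s)))"
    proof -
      have "2 * sqrt 2 * (k * (1 + a / (2 * s))) = 2 + a / s"
        by (simp add: k_def field_simps)
      then show ?thesis by simp
    qed
    have "a / s * ((4 * pi * s) powr (- N / 2) * exp (- (a\<^sup>2 / (4 * s))))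
      = ((4 * pi * s) powr (- p) * exp (- (a\<^sup>2 / (8 * s)))) * (a / s * gss (k * a) s)"
      unfolding gk e pw by simp
    also have "\<dots> \<le> (fact (nat \<lceil>p\<rceil>) * (pi / 8) powr (- p) * t powr (- 2 * p)) *
       (2 * sqrt 2 * (k * (1 + a / (2 * s))) * gss (k * a) s)"
      using s k(1) by (intro mult_mono P ak order_refl mult_nonneg_nonneg) auto
    also have "- 2 * p = - (N - 1)" by (simp add: p_def)
    also have "(fact (nat \<lceil>p\<rceil>) * (pi / 8) powr (- p) * t powr - (N - 1)) *
       (2 * sqrt 2 * (k * (1 + a / (2 * s))) * gss (k * a) s) = ?B"
      by (simp add: flux_const_def p_def N_def s_def mult_ac)
    finally show ?thesis using f A by linarith
  qed
qed

lemma Kn_le: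
  fixes w :: "real ^ 'n::{finite,linorder}"
  assumes "0 \<le> w $ lastc" "0 < t"
  shows "Kn w t \<le> ennreal (4 * t powr (- (real CARD('n) / 2)) + flux_const CARD('n) * t powr (- (real CARD('n) - 1)))"
proof -
  let ?z = "w $ lastc" and ?k = "1 / sqrt 2" and ?N = "real CARD('n)"
  let ?c = "(2 * pi * t) powr (- ?N / 2) * (2 * sqrt (4 * pi * t))"
  let ?d = "flux_const CARD('n) * t powr (- (?N - 1))"
  let ?f = "\<lambda>\<tau>. (?z + \<tau>) / t * gss (?z + \<tau>) t"
  let ?g = "\<lambda>\<tau>. ?k * (1 + (?z + \<tau>) / (2 * (t - \<tau>))) * gss (?k * (?z + \<tau>)) (t - \<tau>)"
  have c: "0 \<le> ?c" using assms by simp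
  have d: "0 \<le> ?d" by (simp add: flux_const_nonneg)
  have "Kn w t \<le> (\<integral>\<^sup>+\<tau>. ennreal ?c * (ennreal (?f \<tau>) * indicator {0..} \<tau>) + ennreal ?d * (ennreal (?g \<tau>) * indicator {0<..<t} \<tau>) \<partial>lborel)"
    unfolding Kn_def
  proof (rule nn_integral_mono)
    fix \<tau>
    show "ennreal (flux w t \<tau>) * indicator {0<..<t} \<tau>
      \<le> ennreal ?c * (ennreal (?f \<tau>) * indicator {0..} \<tau>) + ennreal ?d * (ennreal (?g \<tau>) * indicator {0<..<t} \<tau>)"
    proof (cases "\<tau> \<in> {0<..<t}")
      case True
      then have "ennreal (flux w t \<tau>) \<le> ennreal (?c * ?f \<tau> + ?d * ?g \<tau>)"
        using assms by (intro ennreal_leI flux_le) auto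
      also have "\<dots> = ennreal ?c * ennreal (?f \<tau>) + ennreal ?d * ennreal (?g \<tau>)"
      proof -
        have "0 \<le> ?f \<tau>" using True assms by (intro mult_nonneg_nonneg) auto
        moreover have "0 \<le> ?g \<tau>" using True assms
          by (intro mult_nonneg_nonneg add_nonneg_nonneg divide_nonneg_nonneg) auto
        ultimately show ?thesis using c d
          by (simp only: ennreal_plus ennreal_mult mult_nonneg_nonneg)
      qed
      finally show ?thesis using True by simp
    qed simp
  qed
  also have "\<dots> = ennreal ?c * (\<integral>\<^sup>+\<tau>\<in>{0..}. ennreal (?f \<tau>) \<partial>lborel) + ennreal ?d * (\<integral>\<^sup>+\<tau>\<in>{0<..<t}. ennreal (?g \<tau>) \<partial>lborel)"
    by (simp add: nn_integral_add nn_integral_cmult)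
  also have "\<dots> = ennreal ?c * ennreal (2 * gss ?z t) + ennreal ?d * ennreal (Psi (?k * ?z / sqrt t))"
    using assms by (simp only: nn_integral_moment_tail nn_integral_flux divide_pos_pos zero_less_one real_sqrt_gt_zero zero_less_numeral)
  also have "\<dots> = ennreal (?c * (2 * gss ?z t) + ?d * Psi (?k * ?z / sqrt t))"
    using c d assms Psi_bounds by (simp only: ennreal_plus ennreal_mult mult_nonneg_nonneg gss_nonneg zero_le_numeral)
  also have "\<dots> \<le> ennreal (4 * t powr (- (?N / 2)) + ?d)"
  proof (intro ennreal_leI add_mono)
    \<comment> \<open>The square root in \<open>?c\<close> cancels against the maximum of the
      Gaussian; the two factors 2 leave the constant 4.\<close>
    have "?c * (2 * gss ?z t) \<le> ?c * (2 * (1 / sqrt (4 * pi * t)))"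
      using c gss_upper[OF assms(2), of ?z] by (intro mult_left_mono) auto
    also have "\<dots> = 4 * (2 * pi * t) powr (- (?N / 2))" using assms by simp
    also have "\<dots> \<le> 4 * t powr (- (?N / 2))"
    proof -
      have "t \<le> 2 * pi * t" using pi_ge_two assms by simp
      then show ?thesis using assms by (intro mult_left_mono powr_mono2') auto
    qed
    finally show "?c * (2 * gss ?z t) \<le> 4 * t powr (- (?N / 2))" .
    show "?d * Psi (?k * ?z / sqrt t) \<le> ?d"
      using d Psi_bounds by (simp add: mult_left_le)
  qed
  finally show ?thesis .
qed

lemma Kker_eq_Kn:
  assumes "0 \<le> w $ lastc" "0 < t"
  shows "ennreal (Kker w t) = Kn w t" "0 \<le> Kker w t"
proof -
  have "Kn w t = (\<integral>\<^sup>+\<tau>. ennreal (indicator {0<..<t} \<tau> *\<^sub>R flux w t \<tau>) \<partial>lborel)"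
    unfolding Kn_def by (intro nn_integral_cong) (auto simp: indicator_def)
  moreover have "Kker w t = enn2real (\<integral>\<^sup>+\<tau>. ennreal (indicator {0<..<t} \<tau> *\<^sub>R flux w t \<tau>) \<partial>lborel)"
    unfolding Kker_def set_lebesgue_integral_def
    using assms by (intro integral_eq_nn_integral) (auto simp: indicator_def flux_nonneg)
  ultimately have "Kker w t = enn2real (Kn w t)" by simp
  moreover have "Kn w t < \<infinity>" using Kn_le[OF assms] by (rule le_less_trans) simp
  ultimately show "ennreal (Kker w t) = Kn w t" "0 \<le> Kker w t" by auto
qed

section \<open>Smooth superpositions of heat kernels\<close>

lemma Ck_on_mono: "Ck_on k T f \<Longrightarrow> S \<subseteq> T \<Longrightarrow> Ck_on k S f"
proof (induction k arbitrary: f)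
  case 0
  then show ?case by (auto intro: continuous_on_subset)
next
  case (Suc k)
  then obtain D where "\<forall>x\<in>T. (f has_derivative D x) (at x within T)" "\<forall>b\<in>Basis. Ck_on k T (\<lambda>x. D x b)"
    by auto
  with Suc show ?case
    by (auto intro!: exI[of _ D] intro: has_derivative_subset)
qed

lemma Ck_on_cong: "Ck_on k S f \<Longrightarrow> (\<And>x. x \<in> S \<Longrightarrow> f x = g x) \<Longrightarrow> Ck_on k S g"
proof (cases k)
  case 0
  assume "Ck_on k S f" "\<And>x. x \<in> S \<Longrightarrow> f x = g x"
  with 0 show ?thesis using continuous_on_cong[of S S f g] by simp
next
  case (Suc j)
  assume f: "Ck_on k S f" and eq: "\<And>x. x \<in> S \<Longrightarrow> f x = g x"
  then obtain D where D: "\<forall>x\<in>S. (f has_derivative D x) (at x within S)" "\<forall>b\<in>Basis. Ck_on j S (\<lambda>x. D x b)"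
    using Suc by auto
  have "(g has_derivative D x) (at x within S)" if "x \<in> S" for x
    using has_derivative_transform[OF that _ D(1)[rule_format, OF that], of g] eq by simp
  then show ?thesis
    using D Suc by auto
qed

lemma Ck_on_add: "Ck_on k S f \<Longrightarrow> Ck_on k S g \<Longrightarrow> Ck_on k S (\<lambda>x. f x + g x)"
proof (induction k arbitrary: f g)
  case 0
  then show ?case by (auto intro: continuous_on_add)
next
  case (Suc k)
  from Suc.prems obtain D E where
    "\<forall>x\<in>S. (f has_derivative D x) (at x within S)" "\<forall>b\<in>Basis. Ck_on k S (\<lambda>x. D x b)"
    "\<forall>x\<in>S. (g has_derivative E x) (at x within S)" "\<forall>b\<in>Basis. Ck_on k S (\<lambda>x. E x b)"
    by auto
  with Suc.IH show ?case
    by (auto intro!: exI[of _ "\<lambda>x v. D x v + E x v"] has_derivative_add)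
qed

lemma Ck_on_scale: "Ck_on k S f \<Longrightarrow> Ck_on k S (\<lambda>x. c * f x)"
proof (induction k arbitrary: f)
  case 0
  then show ?case by (auto intro: continuous_intros)
next
  case (Suc k)
  from Suc.prems obtain D where
    "\<forall>x\<in>S. (f has_derivative D x) (at x within S)" "\<forall>b\<in>Basis. Ck_on k S (\<lambda>x. D x b)"
    by auto
  with Suc.IH show ?case
    by (auto intro!: exI[of _ "\<lambda>x v. c * D x v"] has_derivative_mult_right)
qed

section \<open>Differentiation under the integral sign\<close>

text \<open>The mean value inequality on the ball, with the bound on basis directions extended
  linearly, dominates the remainder quotient by a multiple of g. The quotient tends to zero
  pointwise, so dominated convergence along sequences applies.\<close>

lemma has_derivative_integral_param:
  fixes F :: "'a::euclidean_space \<Rightarrow> 'y \<Rightarrow> real" and D :: "'a \<Rightarrow> 'y \<Rightarrow> 'a \<Rightarrow> real"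
  assumes r: "0 < r"
    and deriv: "\<And>x y. x \<in> ball x0 r \<Longrightarrow> y \<in> space M \<Longrightarrow> ((\<lambda>x. F x y) has_derivative D x y) (at x)"
    and int: "\<And>x. x \<in> ball x0 r \<Longrightarrow> integrable M (F x)"
    and measD: "\<And>v. (\<lambda>y. D x0 y v) \<in> borel_measurable M"
    and g: "integrable M g"
    and bound: "\<And>x y b. x \<in> ball x0 r \<Longrightarrow> y \<in> space M \<Longrightarrow> b \<in> Basis \<Longrightarrow> \<bar>D x y b\<bar> \<le> g y"
  shows "((\<lambda>x. \<integral>y. F x y \<partial>M) has_derivative (\<lambda>v. \<integral>y. D x0 y v \<partial>M)) (at x0)"
proof -
  let ?d = "real DIM('a)"
  have x0: "x0 \<in> ball x0 r" using r by simp
  have linD: "bounded_linear (D x y)" if "x \<in> ball x0 r" "y \<in> space M" for x y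
    using deriv[OF that] by (rule has_derivative_bounded_linear)
  have Dle: "\<bar>D x y v\<bar> \<le> ?d * g y * norm v" if xy: "x \<in> ball x0 r" "y \<in> space M" for x y v
  proof -
    interpret bounded_linear "D x y" using linD[OF xy] .
    have "D x y v = D x y (\<Sum>b\<in>Basis. (v \<bullet> b) *\<^sub>R b)" by (simp add: euclidean_representation)
    also have "\<dots> = (\<Sum>b\<in>Basis. (v \<bullet> b) * D x y b)" by (simp add: sum scaleR)
    also have "\<bar>\<dots>\<bar> \<le> (\<Sum>b\<in>(Basis :: 'a set). norm v * g y)"
      by (intro order_trans[OF sum_abs] sum_mono)
         (auto simp: abs_mult intro!: mult_mono Basis_le_norm bound xy)
    finally show ?thesis by (simp add: mult_ac)
  qed
  have intD: "integrable M (\<lambda>y. D x0 y v)" for v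
  proof (rule Bochner_Integration.integrable_bound)
    show "integrable M (\<lambda>y. ?d * g y * norm v)" using g by simp
    show "AE y in M. norm (D x0 y v) \<le> norm (?d * g y * norm v)"
      using Dle[OF x0] by (intro AE_I2) (metis abs_ge_self order_trans real_norm_def)
  qed (rule measD)
  have lip: "\<bar>F x y - F x0 y\<bar> \<le> ?d * g y * norm (x - x0)" if "x \<in> ball x0 r" "y \<in> space M" for x y
  proof -
    have "norm (F x y - F x0 y) \<le> ?d * g y * norm (x - x0)"
    proof (rule differentiable_bound)
      show "((\<lambda>x. F x y) has_derivative D z y) (at z within ball x0 r)" if "z \<in> ball x0 r" for z
        using deriv[OF that \<open>y \<in> space M\<close>] by (rule has_derivative_at_withinI)
      show "onorm (D z y) \<le> ?d * g y" if "z \<in> ball x0 r" for z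
        using Dle[OF that \<open>y \<in> space M\<close>] by (intro onorm_le) auto
    qed (use that r in auto)
    then show ?thesis by simp
  qed
  have lin: "bounded_linear (\<lambda>v. \<integral>y. D x0 y v \<partial>M)"
  proof (rule bounded_linear_intro[where K = "?d * (\<integral>y. g y \<partial>M)"])
    fix u v :: 'a and c :: real
    have "(\<integral>y. D x0 y (u + v) \<partial>M) = (\<integral>y. D x0 y u + D x0 y v \<partial>M)"
      using linD[OF x0] by (intro Bochner_Integration.integral_cong) (auto simp: linear_simps)
    then show "(\<integral>y. D x0 y (u + v) \<partial>M) = (\<integral>y. D x0 y u \<partial>M) + (\<integral>y. D x0 y v \<partial>M)"
      using intD by simp
    have "(\<integral>y. D x0 y (c *\<^sub>R u) \<partial>M) = (\<integral>y. c *\<^sub>R D x0 y u \<partial>M)"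
      using linD[OF x0] by (intro Bochner_Integration.integral_cong) (auto simp: linear_simps)
    then show "(\<integral>y. D x0 y (c *\<^sub>R u) \<partial>M) = c *\<^sub>R (\<integral>y. D x0 y u \<partial>M)" by simp
    have "norm (\<integral>y. D x0 y u \<partial>M) \<le> (\<integral>y. ?d * g y * norm u \<partial>M)"
      using intD g Dle[OF x0]
      by (intro order_trans[OF integral_norm_bound] Bochner_Integration.integral_mono integrable_norm) auto
    then show "norm (\<integral>y. D x0 y u \<partial>M) \<le> norm u * (?d * (\<integral>y. g y \<partial>M))"
      by (simp add: mult_ac)
  qed
  have "((\<lambda>x. (1 / norm (x - x0)) *\<^sub>R ((\<integral>y. F x y \<partial>M) - ((\<integral>y. F x0 y \<partial>M) + (\<integral>y. D x0 y (x - x0) \<partial>M)))) \<longlongrightarrow> 0)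
      (at x0 within ball x0 r)"
    unfolding tendsto_at_iff_sequentially
  proof (intro allI impI)
    fix X assume X: "\<forall>i. X i \<in> ball x0 r - {x0}" "X \<longlonglongrightarrow> x0"
    define R where "R i y = (1 / norm (X i - x0)) *\<^sub>R (F (X i) y - (F x0 y + D x0 y (X i - x0)))" for i y
    have Xb: "X i \<in> ball x0 r" "0 < norm (X i - x0)" for i using X(1) by auto
    have "(\<lambda>i. \<integral>y. R i y \<partial>M) \<longlonglongrightarrow> (\<integral>y. 0 \<partial>M)"
    proof (rule integral_dominated_convergence[where w = "\<lambda>y. 2 * (?d * g y)"])
      show "R i \<in> borel_measurable M" for i
        unfolding R_def using int[OF Xb(1)] int[OF x0] intD by auto
      show "AE y in M. (\<lambda>i. R i y) \<longlonglongrightarrow> 0"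
      proof (rule AE_I2)
        fix y assume "y \<in> space M"
        from deriv[OF x0 this] have "((\<lambda>x. (1 / norm (x - x0)) *\<^sub>R (F x y - (F x0 y + D x0 y (x - x0)))) \<longlongrightarrow> 0) (at x0 within UNIV)"
          by (simp add: has_derivative_within)
        then show "(\<lambda>i. R i y) \<longlonglongrightarrow> 0"
          using X unfolding tendsto_at_iff_sequentially R_def comp_def by auto
      qed
      show "AE y in M. norm (R i y) \<le> 2 * (?d * g y)" for i
      proof (rule AE_I2)
        fix y assume y: "y \<in> space M"
        have "\<bar>F (X i) y - (F x0 y + D x0 y (X i - x0))\<bar> \<le> \<bar>F (X i) y - F x0 y\<bar> + \<bar>D x0 y (X i - x0)\<bar>" by linarith
        also have "\<dots> \<le> ?d * g y * norm (X i - x0) + ?d * g y * norm (X i - x0)"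
          by (intro add_mono lip Dle Xb y x0)
        finally show "norm (R i y) \<le> 2 * (?d * g y)"
          using Xb(2)[of i] by (simp add: R_def abs_mult pos_divide_le_eq mult_ac)
      qed
    qed (use g in auto)
    moreover have "(\<integral>y. R i y \<partial>M) = (1 / norm (X i - x0)) *\<^sub>R ((\<integral>y. F (X i) y \<partial>M) - ((\<integral>y. F x0 y \<partial>M) + (\<integral>y. D x0 y (X i - x0) \<partial>M)))" for i
      unfolding R_def using int[OF Xb(1), of i] int[OF x0] intD by simp
    ultimately show "((\<lambda>x. (1 / norm (x - x0)) *\<^sub>R ((\<integral>y. F x y \<partial>M) - ((\<integral>y. F x0 y \<partial>M) + (\<integral>y. D x0 y (x - x0) \<partial>M)))) \<circ> X) \<longlonglongrightarrow> 0"
      by (simp add: comp_def)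
  qed
  then have "((\<lambda>x. \<integral>y. F x y \<partial>M) has_derivative (\<lambda>v. \<integral>y. D x0 y v \<partial>M)) (at x0 within ball x0 r)"
    using lin by (simp add: has_derivative_within)
  then show ?thesis using at_within_open[OF x0 open_ball] by simp
qed

section \<open>Heat-type kernels extended by zero\<close>

text \<open>The heat kernel is a multiple of \<open>ek (- N / 2)\<close>. The exponent is kept free
  because differentiation lowers it by 1 or 2.\<close>

definition ek :: "real \<Rightarrow> 'a::euclidean_space \<times> real \<Rightarrow> real" where
  "ek m p = (if 0 < snd p then snd p powr m * exp (- ((norm (fst p))\<^sup>2 / (4 * snd p))) else 0)"

text \<open>Combinations of polynomials in the space variable times kernels \<open>ek m\<close>. The
  class is closed under differentiation, so one induction yields derivatives of all orders, and
  another yields Gaussian bounds for all of them.\<close>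

inductive kclass :: "('a::euclidean_space \<times> real \<Rightarrow> real) \<Rightarrow> bool" where
  base: "kclass (ek m)"
| add: "kclass f \<Longrightarrow> kclass g \<Longrightarrow> kclass (\<lambda>p. f p + g p)"
| scale: "kclass f \<Longrightarrow> kclass (\<lambda>p. c * f p)"
| mul: "kclass f \<Longrightarrow> kclass (\<lambda>p. (fst p \<bullet> b) * f p)"

lemma kclass_zero: "kclass (\<lambda>p. 0)"
  using kclass.scale[OF kclass.base[of 0], of 0] by simp

lemma kclass_sum: "finite I \<Longrightarrow> (\<And>i. i \<in> I \<Longrightarrow> kclass (f i)) \<Longrightarrow> kclass (\<lambda>p. \<Sum>i\<in>I. f i p)"
  by (induction I rule: finite_induct) (auto intro: kclass_zero kclass.add)

lemma kclass_norm2: "kclass f \<Longrightarrow> kclass (\<lambda>p. (norm (fst p))\<^sup>2 * f p)"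
proof -
  assume f: "kclass f"
  have "kclass (\<lambda>p. \<Sum>b\<in>Basis. (fst p \<bullet> b) * ((fst p \<bullet> b) * f p))"
    by (intro kclass_sum kclass.mul f) auto
  moreover have "(\<Sum>b\<in>Basis. (x \<bullet> b) * ((x \<bullet> b) * c)) = (norm x)\<^sup>2 * c" for x :: 'a and c
    by (subst power2_norm_eq_inner, subst euclidean_inner) (simp add: sum_distrib_right mult.assoc)
  ultimately show ?thesis by simp
qed

lemma borel_measurable_ek: "ek m \<in> borel_measurable borel"
  unfolding ek_def[abs_def] borel_prod[symmetric] by measurable

lemma borel_measurable_kclass: "kclass f \<Longrightarrow> f \<in> borel_measurable borel"
proof (induction rule: kclass.induct)
  case (mul f b)
  have "(\<lambda>p :: 'a \<times> real. fst p \<bullet> b) \<in> borel_measurable borel"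
    by (intro borel_measurable_continuous_onI continuous_intros)
  with mul show ?case by simp
qed (auto intro: borel_measurable_ek)

lemma kclass_nonpos: "kclass f \<Longrightarrow> s \<le> 0 \<Longrightarrow> f (w, s) = 0"
  by (induction rule: kclass.induct) (auto simp: ek_def)

text \<open>For m < 0 the variable \<eta> / s turns the negative power into one that
  \<open>powr_exp_le\<close> controls.\<close>

lemma powr_exp_inverse_bounded:
  fixes m \<eta> S :: real
  assumes "0 < \<eta>" "0 < S"
  shows "\<exists>C\<ge>0. \<forall>s. 0 < s \<longrightarrow> s \<le> S \<longrightarrow> s powr m * exp (- (\<eta> / s)) \<le> C"
proof (cases "0 \<le> m")
  case True
  have "s powr m * exp (- (\<eta> / s)) \<le> S powr m * 1" if "0 < s" "s \<le> S" for s
    using that True assms by (intro mult_mono powr_mono2) auto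
  then show ?thesis by (intro exI[of _ "S powr m"]) auto
next
  case False
  let ?n = "nat \<lceil>- m\<rceil>"
  have "s powr m * exp (- (\<eta> / s)) \<le> \<eta> powr m * fact ?n" if "0 < s" for s
  proof -
    have "s powr m = \<eta> powr m * (\<eta> / s) powr (- m)"
      using that assms by (simp add: powr_divide powr_minus_divide)
    then have "s powr m * exp (- (\<eta> / s)) = \<eta> powr m * ((\<eta> / s) powr (- m) * exp (- (\<eta> / s)))"
      by simp
    also have "\<dots> \<le> \<eta> powr m * fact ?n"
      using that assms False by (intro mult_left_mono powr_exp_le) auto
    finally show ?thesis .
  qed
  then show ?thesis by (intro exI[of _ "\<eta> powr m * fact ?n"]) auto
qed

text \<open>The exponent 1 / 4 is split into (1 / 4 - c) + c. The first part beats the power of s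
  near time zero as long as the space-time origin is kept at distance; the second remains as
  Gaussian decay.\<close>

lemma ek_bound:
  fixes S \<delta> c :: real
  assumes "0 < S" "0 < \<delta>" "0 < c" "c < 1 / 4"
  shows "\<exists>C\<ge>0. \<forall>(w::'a::euclidean_space) s. s \<le> S \<longrightarrow> \<delta> \<le> norm w + \<bar>s\<bar> \<longrightarrow> \<bar>ek m (w, s)\<bar> \<le> C * exp (- (c * (norm w)\<^sup>2 / S))"
proof -
  \<comment> \<open>The least value of (1 / 4 - c) |w|^2 when s < \<delta> / 2, because then |w| >=
    \<delta> / 2.\<close>
  define \<eta> where "\<eta> = (1 / 4 - c) * (\<delta> / 2)\<^sup>2"
  have \<eta>: "0 < \<eta>" using assms by (simp add: \<eta>_def)
  obtain C where C: "0 \<le> C" "\<And>s. 0 < s \<Longrightarrow> s \<le> S \<Longrightarrow> s powr m * exp (- (\<eta> / s)) \<le> C"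
    using powr_exp_inverse_bounded[OF \<eta> assms(1), of m] by auto
  \<comment> \<open>The constant \<open>C\<close> serves s < \<delta> / 2; the other two terms bound
    s^m between \<delta> / 2 and S for either sign of m.\<close>
  define K where "K = C + S powr m + (\<delta> / 2) powr m"
  have "\<bar>ek m (w, s)\<bar> \<le> K * exp (- (c * (norm w)\<^sup>2 / S))" if s: "s \<le> S" "\<delta> \<le> norm w + \<bar>s\<bar>" for w :: 'a and s
  proof (cases "0 < s")
    case True
    have cs: "exp (- (c * (norm w)\<^sup>2 / s)) \<le> exp (- (c * (norm w)\<^sup>2 / S))"
      using True s assms by (auto intro!: divide_left_mono)
    have split: "exp (- ((norm w)\<^sup>2 / (4 * s))) = exp (- ((1 / 4 - c) * (norm w)\<^sup>2 / s)) * exp (- (c * (norm w)\<^sup>2 / s))"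
      using True by (simp add: exp_add[symmetric] field_simps)
    have main: "s powr m * exp (- ((1 / 4 - c) * (norm w)\<^sup>2 / s)) \<le> K"
    proof (cases "\<delta> / 2 \<le> s")
      case d: True
      have "s powr m \<le> S powr m + (\<delta> / 2) powr m"
      proof (cases "0 \<le> m")
        case True
        then have "s powr m \<le> S powr m" using s d assms by (intro powr_mono2) auto
        then show ?thesis by (simp add: add_increasing2)
      next
        case False
        then have "s powr m \<le> (\<delta> / 2) powr m" using s d assms by (intro powr_mono2') auto
        then show ?thesis by (simp add: add_increasing)
      qed
      moreover have "exp (- ((1 / 4 - c) * (norm w)\<^sup>2 / s)) \<le> 1"
        using True assms by (simp add: divide_nonneg_pos)
      ultimately have "s powr m * exp (- ((1 / 4 - c) * (norm w)\<^sup>2 / s)) \<le> (S powr m + (\<delta> / 2) powr m) * 1"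
        by (intro mult_mono) auto
      then show ?thesis using C by (simp add: K_def)
    next
      case False
      then have "(\<delta> / 2)\<^sup>2 \<le> (norm w)\<^sup>2" using s True assms by (intro power_mono) auto
      then have "\<eta> / s \<le> (1 / 4 - c) * (norm w)\<^sup>2 / s"
        unfolding \<eta>_def using True assms by (intro divide_right_mono mult_left_mono) auto
      then have "s powr m * exp (- ((1 / 4 - c) * (norm w)\<^sup>2 / s)) \<le> s powr m * exp (- (\<eta> / s))"
        by (intro mult_left_mono) auto
      also have "\<dots> \<le> C" using C True s by auto
      finally show ?thesis by (simp add: K_def add_increasing2)
    qed
    have "ek m (w, s) = (s powr m * exp (- ((1 / 4 - c) * (norm w)\<^sup>2 / s))) * exp (- (c * (norm w)\<^sup>2 / s))"
      using True by (simp add: ek_def split)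
    also have "\<dots> \<le> K * exp (- (c * (norm w)\<^sup>2 / S))"
      using C main cs by (intro mult_mono) (auto simp: K_def)
    finally show ?thesis by (simp add: ek_def)
  next
    case False
    then show ?thesis using C by (simp add: ek_def K_def)
  qed
  then show ?thesis using C by (intro exI[of _ K]) (auto simp: K_def)
qed

lemma norm_le_exp_sq:
  fixes \<epsilon> :: real
  assumes "0 < \<epsilon>"
  shows "norm w \<le> (1 + 1 / \<epsilon>) * exp (\<epsilon> * (norm w)\<^sup>2)"
proof -
  have "norm w \<le> 1 + (norm w)\<^sup>2"
    using zero_le_power2[of "norm w - 1 / 2"] by (simp add: power2_eq_square algebra_simps)
  also have "\<dots> \<le> (1 + 1 / \<epsilon>) * (1 + \<epsilon> * (norm w)\<^sup>2)"
    using assms by (simp add: field_simps)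
  also have "\<dots> \<le> (1 + 1 / \<epsilon>) * exp (\<epsilon> * (norm w)\<^sup>2)"
    using assms by (intro mult_left_mono exp_ge_add_one_self) auto
  finally show ?thesis .
qed

text \<open>A linear factor in w is paid for with a little of the exponent. Hence c stays general in
  the induction, and the factor case calls the hypothesis at c', halfway between c and 1 /
  4.\<close>

lemma kclass_bound:
  assumes "kclass f" "0 < S" "0 < \<delta>" "0 < c" "c < 1 / 4"
  shows "\<exists>C\<ge>0. \<forall>(w::'a::euclidean_space) s. s \<le> S \<longrightarrow> \<delta> \<le> norm w + \<bar>s\<bar> \<longrightarrow> \<bar>f (w, s)\<bar> \<le> C * exp (- (c * (norm w)\<^sup>2 / S))"
  using assms
proof (induction arbitrary: c rule: kclass.induct)
  case (base m)
  then show ?case using ek_bound by blast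
next
  case (add f g)
  obtain A where A: "A \<ge> 0" "\<And>w s. s \<le> S \<Longrightarrow> \<delta> \<le> norm w + \<bar>s\<bar> \<Longrightarrow> \<bar>f (w, s)\<bar> \<le> A * exp (- (c * (norm w)\<^sup>2 / S))"
    using add by meson
  obtain B where B: "B \<ge> 0" "\<And>w s. s \<le> S \<Longrightarrow> \<delta> \<le> norm w + \<bar>s\<bar> \<Longrightarrow> \<bar>g (w, s)\<bar> \<le> B * exp (- (c * (norm w)\<^sup>2 / S))"
    using add by meson
  have "\<bar>f (w, s) + g (w, s)\<bar> \<le> (A + B) * exp (- (c * (norm w)\<^sup>2 / S))" if "s \<le> S" "\<delta> \<le> norm w + \<bar>s\<bar>" for w s
    using A(2)[OF that] B(2)[OF that] by (simp add: distrib_right)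
  then show ?case using A B by (intro exI[of _ "A + B"]) auto
next
  case (scale f k)
  obtain A where A: "A \<ge> 0" "\<And>w s. s \<le> S \<Longrightarrow> \<delta> \<le> norm w + \<bar>s\<bar> \<Longrightarrow> \<bar>f (w, s)\<bar> \<le> A * exp (- (c * (norm w)\<^sup>2 / S))"
    using scale by meson
  have "\<bar>k * f (w, s)\<bar> \<le> (\<bar>k\<bar> * A) * exp (- (c * (norm w)\<^sup>2 / S))" if "s \<le> S" "\<delta> \<le> norm w + \<bar>s\<bar>" for w s
    using mult_left_mono[OF A(2)[OF that], of "\<bar>k\<bar>"] by (simp add: abs_mult mult.assoc)
  then show ?case using A by (intro exI[of _ "\<bar>k\<bar> * A"]) auto
next
  case (mul f b)
  define c' where "c' = (c + 1 / 4) / 2"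
  have c': "c < c'" "0 < c'" "c' < 1 / 4" using mul by (auto simp: c'_def)
  obtain A where A: "A \<ge> 0" "\<And>w s. s \<le> S \<Longrightarrow> \<delta> \<le> norm w + \<bar>s\<bar> \<Longrightarrow> \<bar>f (w, s)\<bar> \<le> A * exp (- (c' * (norm w)\<^sup>2 / S))"
    using mul.IH[of c'] mul.prems c' by meson
  define \<epsilon> where "\<epsilon> = (c' - c) / S"
  have \<epsilon>: "0 < \<epsilon>" using c' mul.prems by (simp add: \<epsilon>_def)
  define B where "B = norm b * (1 + 1 / \<epsilon>) * A"
  have "\<bar>(fst (w, s) \<bullet> b) * f (w, s)\<bar> \<le> B * exp (- (c * (norm w)\<^sup>2 / S))"
    if ws: "s \<le> S" "\<delta> \<le> norm w + \<bar>s\<bar>" for w s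
  proof -
    have "\<bar>w \<bullet> b\<bar> \<le> norm b * norm w" using Cauchy_Schwarz_ineq2[of w b] by (simp add: mult.commute)
    also have "\<dots> \<le> norm b * ((1 + 1 / \<epsilon>) * exp (\<epsilon> * (norm w)\<^sup>2))"
      by (intro mult_left_mono norm_le_exp_sq \<epsilon>) auto
    finally have "\<bar>w \<bullet> b\<bar> * \<bar>f (w, s)\<bar> \<le> (norm b * ((1 + 1 / \<epsilon>) * exp (\<epsilon> * (norm w)\<^sup>2))) * (A * exp (- (c' * (norm w)\<^sup>2 / S)))"
      using A(2)[OF ws] by (intro mult_mono) auto
    also have "\<dots> = B * (exp (\<epsilon> * (norm w)\<^sup>2) * exp (- (c' * (norm w)\<^sup>2 / S)))"
      by (simp add: B_def)
    also have "exp (\<epsilon> * (norm w)\<^sup>2) * exp (- (c' * (norm w)\<^sup>2 / S)) = exp (- (c * (norm w)\<^sup>2 / S))"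
      by (simp add: exp_add[symmetric] \<epsilon>_def diff_divide_distrib left_diff_distrib)
    finally show ?thesis by (simp add: abs_mult)
  qed
  moreover have "0 \<le> B" using A \<epsilon> by (simp add: B_def)
  ultimately show ?case by blast
qed

text \<open>The derivative of \<open>ek m\<close> in direction v. Powers of 1 / s are hidden in
  lower exponents of \<open>ek\<close>, so the formula stays in the class and is zero for
  nonpositive times.\<close>

definition ekD :: "real \<Rightarrow> 'a::euclidean_space \<times> real \<Rightarrow> 'a \<times> real \<Rightarrow> real" where
  "ekD m p v = snd v * (m * ek (m - 1) p + (norm (fst p))\<^sup>2 / 4 * ek (m - 2) p) - (fst p \<bullet> fst v) / 2 * ek (m - 1) p"

lemma ek_powr_diff: "0 < s \<Longrightarrow> ek (m - real k) (w, s) * s ^ k = ek m (w, s)"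
  by (simp add: ek_def powr_diff powr_realpow)

lemma ek_has_derivative:
  fixes p :: "'a::euclidean_space \<times> real"
  assumes "p \<noteq> 0"
  shows "(ek m has_derivative ekD m p) (at p)"
proof -
  obtain w s where p: "p = (w, s)" by (cases p)
  have lin: "bounded_linear (ekD m p)"
    unfolding linear_conv_bounded_linear[symmetric]
    by (rule linearI) (auto simp: ekD_def inner_add_right algebra_simps add_divide_distrib)
  consider "0 < s" | "s < 0" | "s = 0" "w \<noteq> 0"
    using assms p by (metis linorder_neqE_linordered_idom zero_prod_def)
  then show ?thesis
  proof cases
    case 1
    let ?h = "\<lambda>p::'a \<times> real. snd p powr m * exp (- ((fst p \<bullet> fst p) / (4 * snd p)))"
    have "(?h has_derivative ekD m p) (at p)"
    proof -
      let ?E = "\<lambda>p::'a \<times> real. - ((fst p \<bullet> fst p) / (4 * snd p))"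
      let ?e = "exp (- ((w \<bullet> w) / (4 * s)))"
      have d1: "((\<lambda>p::'a \<times> real. snd p powr m) has_derivative (\<lambda>v. snd v * (m * s powr (m - 1)))) (at p)"
        using 1 p by (intro DERIV_compose_FDERIV[OF _ has_derivative_snd[OF has_derivative_ident]])
          (auto intro!: has_real_derivative_powr)
      have n: "((\<lambda>p::'a \<times> real. fst p \<bullet> fst p) has_derivative (\<lambda>v. w \<bullet> fst v + fst v \<bullet> w)) (at p)"
        using has_derivative_inner[OF has_derivative_fst[OF has_derivative_ident] has_derivative_fst[OF has_derivative_ident], of p UNIV]
        by (simp add: p)
      have d: "((\<lambda>p::'a \<times> real. 4 * snd p) has_derivative (\<lambda>v. 4 * snd v)) (at p)"
        by (intro has_derivative_mult_right has_derivative_snd has_derivative_ident)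
      have "((\<lambda>p::'a \<times> real. (fst p \<bullet> fst p) / (4 * snd p)) has_derivative
          (\<lambda>v. ((w \<bullet> fst v + fst v \<bullet> w) * (4 * s) - (w \<bullet> w) * (4 * snd v)) / (4 * s * (4 * s)))) (at p)"
        using has_derivative_divide'[OF n d] 1 p by simp
      from DERIV_compose_FDERIV[OF DERIV_exp has_derivative_minus[OF this]]
      have d2: "((\<lambda>p. exp (?E p)) has_derivative
          (\<lambda>v. - (((w \<bullet> fst v + fst v \<bullet> w) * (4 * s) - (w \<bullet> w) * (4 * snd v)) / (4 * s * (4 * s))) * ?e)) (at p)"
        by (simp add: p)
      have "ekD m p = (\<lambda>v. s powr m * (- (((w \<bullet> fst v + fst v \<bullet> w) * (4 * s) - (w \<bullet> w) * (4 * snd v)) / (4 * s * (4 * s))) * ?e)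
          + snd v * (m * s powr (m - 1)) * ?e)"
      proof
        fix v :: "'a \<times> real"
        define P where "P = s powr (m - 2)"
        have P: "s powr m = P * (s * s)" "s powr (m - 1) = P * s"
          using 1 by (auto simp: P_def powr_diff power2_eq_square)
        have "ek (m - 1) p = P * s * ?e" "ek (m - 2) p = P * ?e"
          using 1 by (auto simp: ek_def p P(2) P_def power2_norm_eq_inner)
        then show "ekD m p v = s powr m * (- (((w \<bullet> fst v + fst v \<bullet> w) * (4 * s) - (w \<bullet> w) * (4 * snd v)) / (4 * s * (4 * s))) * ?e)
          + snd v * (m * s powr (m - 1)) * ?e"
          using 1 by (simp add: ekD_def P p power2_norm_eq_inner inner_commute[of "fst v" w] field_simps)
      qed
      then show ?thesis
        using has_derivative_mult[OF d1 d2] by (simp add: p)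
    qed
    moreover have "open {q::'a \<times> real. 0 < snd q}" by (intro open_Collect_less continuous_intros)
    moreover have "p \<in> {q::'a \<times> real. 0 < snd q}" using 1 p by simp
    moreover have "?h q = ek m q" if "q \<in> {q::'a \<times> real. 0 < snd q}" for q
      using that by (simp add: ek_def power2_norm_eq_inner)
    ultimately show ?thesis
      by (rule has_derivative_transform_within_open)
  next
    case 2
    have D0: "ekD m p = (\<lambda>_. 0)" using 2 p by (auto simp: ekD_def ek_def)
    have "open {q::'a \<times> real. snd q < 0}" by (intro open_Collect_less continuous_intros)
    moreover have "p \<in> {q::'a \<times> real. snd q < 0}" using 2 p by simp
    moreover have "0 = ek m q" if "q \<in> {q::'a \<times> real. snd q < 0}" for q
      using that by (simp add: ek_def)
    ultimately show ?thesis
      unfolding D0 by (rule has_derivative_transform_within_open[OF has_derivative_const])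
  next
    case 3
    \<comment> \<open>At time zero away from the origin, \<open>ek m\<close> is t^2 times
      \<open>ek (m - 2)\<close> for t > 0. The latter is bounded near p, so the increment is
      quadratic and the derivative is zero.\<close>
    have D0: "ekD m p = (\<lambda>_. 0)" using 3 p by (auto simp: ekD_def ek_def)
    obtain C where C: "0 \<le> C" "\<And>(v::'a) t. t \<le> 1 \<Longrightarrow> norm w / 2 \<le> norm v + \<bar>t\<bar> \<Longrightarrow> \<bar>ek (m - 2) (v, t)\<bar> \<le> C * exp (- (1 / 8 * (norm v)\<^sup>2 / 1))"
      using ek_bound[of 1 "norm w / 2" "1 / 8" "m - 2"] 3 by auto
    let ?e = "min 1 (norm w / 2)"
    show ?thesis
    proof (rule has_derivativeI_sandwich[of ?e _ _ _ _ "\<lambda>q. C * norm (q - p)"])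
      show "0 < ?e" using 3 by simp
      show "bounded_linear (ekD m p)" by (rule lin)
      have "((\<lambda>q. C * norm (q - p)) \<longlongrightarrow> C * norm (p - p)) (at p)"
        by (intro tendsto_intros)
      then show "((\<lambda>q. C * norm (q - p)) \<longlongrightarrow> 0) (at p)" by simp
      fix q assume q: "q \<noteq> p" "dist q p < ?e"
      obtain v t where vt: "q = (v, t)" by (cases q)
      have t: "\<bar>t\<bar> \<le> norm (q - p)" and v: "norm (v - w) \<le> norm (q - p)"
        using norm_fst_le[of "v - w" t] norm_snd_le[of t "v - w"] 3 by (auto simp: vt p)
      have "norm w \<le> norm v + norm (v - w)" by (metis norm_triangle_sub norm_minus_commute)
      then have nv: "norm w / 2 \<le> norm v + \<bar>t\<bar>" "t \<le> 1"
        using q t v by (auto simp: dist_norm)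
      have "\<bar>ek m q\<bar> \<le> C * norm (q - p) * norm (q - p)"
      proof (cases "0 < t")
        case True
        have "\<bar>ek (m - 2) (v, t)\<bar> \<le> C * exp (- (1 / 8 * (norm v)\<^sup>2 / 1))" by (rule C(2)[OF nv(2,1)])
        also have "\<dots> \<le> C * 1" using C(1) by (intro mult_left_mono) auto
        finally have b: "\<bar>ek (m - 2) (v, t)\<bar> \<le> C" by simp
        have "ek m q = ek (m - 2) (v, t) * t ^ 2" using ek_powr_diff[OF True, of m 2 v] vt by simp
        also have "\<bar>\<dots>\<bar> \<le> C * (norm (q - p) * norm (q - p))"
          unfolding abs_mult power2_eq_square using b t C(1) by (intro mult_mono) auto
        finally show ?thesis by (simp add: mult.assoc)
      next
        case False
        then show ?thesis using C by (simp add: ek_def vt)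
      qed
      moreover have "ek m p = 0" using 3 p by (simp add: ek_def)
      ultimately show "norm (ek m q - ek m p - ekD m p (q - p)) / norm (q - p) \<le> C * norm (q - p)"
        using q by (simp add: D0 pos_divide_le_eq)
    qed
  qed
qed

text \<open>The pole is excluded from the first condition; the second allows the derivative to be
  differentiated again.\<close>

definition kder :: "('a::euclidean_space \<times> real \<Rightarrow> real) \<Rightarrow> ('a \<times> real \<Rightarrow> 'a \<times> real \<Rightarrow> real) \<Rightarrow> bool" where
  "kder f D \<longleftrightarrow> (\<forall>p. p \<noteq> 0 \<longrightarrow> (f has_derivative D p) (at p)) \<and> (\<forall>v. kclass (\<lambda>p. D p v))"

lemma kder_ek: "kder (ek m) (ekD m)"
proof -
  have "kclass (\<lambda>p. ekD m p v)" for v :: "'a \<times> real"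
  proof -
    have "kclass (\<lambda>p::'a \<times> real. snd v * (m * ek (m - 1) p + 1 / 4 * ((norm (fst p))\<^sup>2 * ek (m - 2) p))
        + (- 1 / 2) * ((fst p \<bullet> fst v) * ek (m - 1) p))"
      by (intro kclass.add kclass.scale kclass.mul kclass_norm2 kclass.base)
    then show ?thesis by (simp add: ekD_def)
  qed
  then show ?thesis by (auto simp: kder_def ek_has_derivative)
qed

lemma kder_mul:
  assumes "kclass f" "kder f D"
  shows "kder (\<lambda>p. (fst p \<bullet> b) * f p) (\<lambda>p v. (fst p \<bullet> b) * D p v + (fst v \<bullet> b) * f p)"
  unfolding kder_def
proof (intro conjI allI impI)
  fix p :: "'a \<times> real" assume "p \<noteq> 0"
  then have "(f has_derivative D p) (at p)" using assms(2) unfolding kder_def by blast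
  moreover have "((\<lambda>p::'a \<times> real. fst p \<bullet> b) has_derivative (\<lambda>v. fst v \<bullet> b)) (at p)"
    by (auto intro!: derivative_eq_intros)
  ultimately show "((\<lambda>p. (fst p \<bullet> b) * f p) has_derivative (\<lambda>v. (fst p \<bullet> b) * D p v + (fst v \<bullet> b) * f p)) (at p)"
    by (rule has_derivative_mult[rotated])
next
  fix v show "kclass (\<lambda>p. (fst p \<bullet> b) * D p v + (fst v \<bullet> b) * f p)"
    using assms(1) by (intro kclass.add kclass.scale kclass.mul) (use assms(2) in \<open>unfold kder_def, blast\<close>)
qed

lemma kclass_kder: "kclass f \<Longrightarrow> \<exists>D. kder f D"
proof (induction rule: kclass.induct)
  case (base m)
  then show ?case using kder_ek by blast
next
  case (add f g)
  then obtain D E where "kder f D" "kder g E" by auto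
  then have "kder (\<lambda>p. f p + g p) (\<lambda>p v. D p v + E p v)"
    by (auto simp: kder_def intro!: has_derivative_add kclass.add)
  then show ?case by blast
next
  case (scale f c)
  then obtain D where "kder f D" by auto
  then have "kder (\<lambda>p. c * f p) (\<lambda>p v. c * D p v)"
    by (auto simp: kder_def intro!: has_derivative_mult_right kclass.scale)
  then show ?case by blast
next
  case (mul f b)
  then show ?case using kder_mul by blast
qed

section \<open>Superpositions of translated kernels\<close>

text \<open>The integrals are over translates with poles (a y, \<tau> y) and weights \<psi> y. The
  poles stay away from U locally uniformly. Integrability is asked only for poles with \<tau> y <=
  T, since a kernel is zero before the time of its pole.\<close>

locale superposition =
  fixes M :: "'y measure" and a :: "'y \<Rightarrow> 'a::euclidean_space" and \<tau> :: "'y \<Rightarrow> real"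
    and \<psi> :: "'y \<Rightarrow> real" and U :: "('a \<times> real) set"
  assumes a [measurable]: "a \<in> borel_measurable M"
    and \<tau> [measurable]: "\<tau> \<in> borel_measurable M"
    and \<psi> [measurable]: "\<psi> \<in> borel_measurable M"
    and \<tau>_nonneg: "\<And>y. y \<in> space M \<Longrightarrow> 0 \<le> \<tau> y"
    and open_U: "open U"
    and separated: "\<And>p. p \<in> U \<Longrightarrow> \<exists>r>0. \<exists>\<delta>>0. \<forall>x t y. (x, t) \<in> ball p r \<longrightarrow> y \<in> space M \<longrightarrow>
        \<delta> \<le> norm (x - a y) + \<bar>t - \<tau> y\<bar>"
    and gauss_integrable: "\<And>c x T. 0 < c \<Longrightarrow>
        integrable M (\<lambda>y. exp (- (c * (norm (x - a y))\<^sup>2)) * indicator {..T} (\<tau> y) * \<psi> y)"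
begin

definition L :: "('a \<times> real \<Rightarrow> real) \<Rightarrow> 'a \<times> real \<Rightarrow> real" where
  "L f p = (\<integral>y. f (fst p - a y, snd p - \<tau> y) * \<psi> y \<partial>M)"

lemma measurable_translate:
  assumes "kclass f"
  shows "(\<lambda>y. f (fst p - a y, snd p - \<tau> y) * \<psi> y) \<in> borel_measurable M"
proof -
  have "(\<lambda>y. (fst p - a y, snd p - \<tau> y)) \<in> M \<rightarrow>\<^sub>M borel" by measurable
  from measurable_compose[OF this borel_measurable_kclass[OF assms]] show ?thesis by simp
qed

text \<open>The radius is the same for all kernels of the class. \<open>L_has_derivative\<close>
  needs this, as it adds up the majorants of all partial derivatives on one ball.\<close>

lemma dominated:
  assumes "p \<in> U"
  shows "\<exists>r>0. (\<forall>q\<in>ball p r. \<forall>y\<in>space M. (fst q - a y, snd q - \<tau> y) \<noteq> 0) \<and>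
    (\<forall>f. kclass f \<longrightarrow> (\<exists>g. integrable M g \<and> (\<forall>q\<in>ball p r. \<forall>y\<in>space M. \<bar>f (fst q - a y, snd q - \<tau> y) * \<psi> y\<bar> \<le> g y)))"
proof -
  obtain x0 t0 where p: "p = (x0, t0)" by (cases p)
  obtain r0 \<delta> where r0: "0 < r0" "0 < \<delta>" and sep: "\<And>x t y. (x, t) \<in> ball p r0 \<Longrightarrow> y \<in> space M \<Longrightarrow> \<delta> \<le> norm (x - a y) + \<bar>t - \<tau> y\<bar>"
    using separated[OF assms] by metis
  define r where "r = min r0 1"
  have r: "0 < r" "r \<le> 1" "ball p r \<subseteq> ball p r0" using r0 by (auto simp: r_def)
  define S where "S = \<bar>t0\<bar> + 1"
  have S: "0 < S" by (simp add: S_def add_nonneg_pos)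
  have 1: "(fst q - a y, snd q - \<tau> y) \<noteq> 0" if "q \<in> ball p r" "y \<in> space M" for q y
  proof
    assume 0: "(fst q - a y, snd q - \<tau> y) = 0"
    have "(fst q, snd q) \<in> ball p r0" using that r by auto
    from sep[OF this that(2)] show False using 0 r0 by (simp add: zero_prod_def)
  qed
  have 2: "\<exists>g. integrable M g \<and> (\<forall>q\<in>ball p r. \<forall>y\<in>space M. \<bar>f (fst q - a y, snd q - \<tau> y) * \<psi> y\<bar> \<le> g y)"
    if f: "kclass f" for f
  proof -
    obtain C where C: "0 \<le> C" and bd: "\<And>w s. s \<le> S \<Longrightarrow> \<delta> \<le> norm w + \<bar>s\<bar> \<Longrightarrow> \<bar>f (w, s)\<bar> \<le> C * exp (- (1 / 8 * (norm w)\<^sup>2 / S))"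
      using kclass_bound[OF f S r0(2), of "1 / 8"] by auto
    \<comment> \<open>The kernel bound decays at rate 1 / (8 S). Moving from x to the centre x0, at
      distance at most 1, uses |x0 - a|^2 <= 2 |x - a|^2 + 2, which halves the rate and costs the
      factor exp (1 / (8 S)).\<close>
    define k where "k = 1 / (16 * S)"
    have k: "0 < k" using S by (simp add: k_def)
    define g where "g y = \<bar>C * exp (1 / (8 * S)) * (exp (- (k * (norm (x0 - a y))\<^sup>2)) * indicator {..t0 + 1} (\<tau> y) * \<psi> y)\<bar>" for y
    have "integrable M g"
      unfolding g_def using gauss_integrable[OF k, of x0 "t0 + 1"] by (intro integrable_abs integrable_mult_right) auto
    moreover have "\<bar>f (fst q - a y, snd q - \<tau> y) * \<psi> y\<bar> \<le> g y" if q: "q \<in> ball p r" and y: "y \<in> space M" for q y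
    proof (cases "\<tau> y < snd q")
      case True
      obtain x t where xt: "q = (x, t)" by (cases q)
      have d: "norm (x - x0) \<le> 1" "\<bar>t - t0\<bar> \<le> 1"
        using q r norm_fst_le[of "x0 - x" "t0 - t"] norm_snd_le[of "t0 - t" "x0 - x"]
        by (auto simp: xt p dist_norm norm_minus_commute)
      have t: "t - \<tau> y \<le> S" using d \<tau>_nonneg[OF y] by (auto simp: S_def)
      have "\<delta> \<le> norm (x - a y) + \<bar>t - \<tau> y\<bar>" using sep[of x t y] q r xt y by auto
      from bd[OF t this] have f1: "\<bar>f (x - a y, t - \<tau> y)\<bar> \<le> C * exp (- (1 / 8 * (norm (x - a y))\<^sup>2 / S))" .
      have "(norm (x0 - a y))\<^sup>2 \<le> 2 * (norm (x - a y))\<^sup>2 + 2"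
      proof -
        have "norm (x0 - a y) \<le> norm (x - a y) + 1"
          using norm_triangle_ineq[of "x0 - x" "x - a y"] d by (simp add: norm_minus_commute)
        then have "(norm (x0 - a y))\<^sup>2 \<le> (norm (x - a y) + 1)\<^sup>2" by (intro power_mono) auto
        also have "\<dots> \<le> 2 * (norm (x - a y))\<^sup>2 + 2"
          using zero_le_power2[of "norm (x - a y) - 1"] by (simp add: power2_eq_square algebra_simps)
        finally show ?thesis .
      qed
      then have "k * (norm (x0 - a y))\<^sup>2 \<le> k * (2 * (norm (x - a y))\<^sup>2 + 2)" using k by (intro mult_left_mono) auto
      also have "\<dots> = 1 / 8 * (norm (x - a y))\<^sup>2 / S + 1 / (8 * S)" using S by (simp add: k_def field_simps)
      finally have "exp (- (1 / 8 * (norm (x - a y))\<^sup>2 / S)) \<le> exp (1 / (8 * S)) * exp (- (k * (norm (x0 - a y))\<^sup>2))"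
        by (simp add: exp_add[symmetric])
      then have "\<bar>f (x - a y, t - \<tau> y)\<bar> \<le> C * (exp (1 / (8 * S)) * exp (- (k * (norm (x0 - a y))\<^sup>2)))"
        using f1 C by (meson mult_left_mono order_trans)
      then have "\<bar>f (x - a y, t - \<tau> y)\<bar> * \<bar>\<psi> y\<bar> \<le> C * (exp (1 / (8 * S)) * exp (- (k * (norm (x0 - a y))\<^sup>2))) * \<bar>\<psi> y\<bar>"
        by (intro mult_right_mono) auto
      moreover have "indicator {..t0 + 1} (\<tau> y) = (1::real)" using True d by (auto simp: xt)
      ultimately show ?thesis using C by (simp add: g_def xt abs_mult mult_ac)
    next
      case False
      then show ?thesis using kclass_nonpos[OF f, of "snd q - \<tau> y"] by (simp add: g_def)
    qed
    ultimately show ?thesis by blast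
  qed
  show ?thesis using r(1) 1 2 by blast
qed

lemma L_integrable:
  assumes "kclass f" "p \<in> U"
  shows "integrable M (\<lambda>y. f (fst p - a y, snd p - \<tau> y) * \<psi> y)"
proof -
  obtain r g where "0 < r" "integrable M g"
    and gb: "\<forall>q\<in>ball p r. \<forall>y\<in>space M. \<bar>f (fst q - a y, snd q - \<tau> y) * \<psi> y\<bar> \<le> g y"
    using dominated[OF assms(2)] assms(1) by blast
  have "\<bar>f (fst p - a y, snd p - \<tau> y) * \<psi> y\<bar> \<le> \<bar>g y\<bar>" if "y \<in> space M" for y
  proof -
    have "p \<in> ball p r" using \<open>0 < r\<close> by simp
    with gb that have "\<bar>f (fst p - a y, snd p - \<tau> y) * \<psi> y\<bar> \<le> g y" by blast
    then show ?thesis by linarith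
  qed
  then have "AE y in M. norm (f (fst p - a y, snd p - \<tau> y) * \<psi> y) \<le> norm (g y)"
    unfolding real_norm_def by (rule AE_I2)
  with \<open>integrable M g\<close> measurable_translate[OF assms(1)] show ?thesis
    by (rule Bochner_Integration.integrable_bound)
qed

lemma L_has_derivative:
  assumes f: "kclass f" and D: "kder f D" and p: "p \<in> U"
  shows "(L f has_derivative (\<lambda>v. L (\<lambda>q. D q v) p)) (at p)"
proof -
  obtain r1 where r1: "0 < r1" "\<And>q y. q \<in> ball p r1 \<Longrightarrow> y \<in> space M \<Longrightarrow> (fst q - a y, snd q - \<tau> y) \<noteq> 0"
    and dom: "\<And>f. kclass f \<Longrightarrow> \<exists>g. integrable M g \<and> (\<forall>q\<in>ball p r1. \<forall>y\<in>space M. \<bar>f (fst q - a y, snd q - \<tau> y) * \<psi> y\<bar> \<le> g y)"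
    using dominated[OF p] by blast
  obtain r2 where r2: "0 < r2" "ball p r2 \<subseteq> U" using open_U p open_contains_ball by blast
  define r where "r = min r1 r2"
  have r: "0 < r" "ball p r \<subseteq> ball p r1" "ball p r \<subseteq> U" using r1 r2 by (auto simp: r_def)
  have Dk: "kclass (\<lambda>q. D q v)" for v using D unfolding kder_def by blast
  have "\<forall>b. \<exists>g. integrable M g \<and> (\<forall>q\<in>ball p r1. \<forall>y\<in>space M. \<bar>D (fst q - a y, snd q - \<tau> y) b * \<psi> y\<bar> \<le> g y)"
    using dom[OF Dk] by simp
  then obtain G where G: "\<And>b. integrable M (G b)" "\<And>b q y. q \<in> ball p r1 \<Longrightarrow> y \<in> space M \<Longrightarrow> \<bar>D (fst q - a y, snd q - \<tau> y) b * \<psi> y\<bar> \<le> G b y"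
    by metis
  have Gnn: "0 \<le> G b y" if "y \<in> space M" for b y
    using G(2)[of p y b] that r1 by (meson abs_ge_zero centre_in_ball order_trans)
  show ?thesis
    unfolding L_def[abs_def]
  proof (rule has_derivative_integral_param[OF r(1), where g = "\<lambda>y. \<Sum>b\<in>Basis. G b y"])
    fix x y assume xy: "x \<in> ball p r" "y \<in> space M"
    have eq: "(fst x - a y, snd x - \<tau> y) = x - (a y, \<tau> y)" for x
      by (simp add: prod_eq_iff)
    have "x \<in> ball p r1" using xy r by blast
    then have "(f has_derivative D (x - (a y, \<tau> y))) (at (x - (a y, \<tau> y)))"
      using D r1(2)[of x y] xy(2) unfolding kder_def eq by blast
    moreover have "((\<lambda>x. x - (a y, \<tau> y)) has_derivative (\<lambda>v. v)) (at x)"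
      using has_derivative_diff[OF has_derivative_ident has_derivative_const] by simp
    ultimately have "((\<lambda>x. f (fst x - a y, snd x - \<tau> y)) has_derivative D (fst x - a y, snd x - \<tau> y)) (at x)"
      unfolding eq by (rule has_derivative_compose[rotated])
    then show "((\<lambda>x. f (fst x - a y, snd x - \<tau> y) * \<psi> y) has_derivative (\<lambda>v. D (fst x - a y, snd x - \<tau> y) v * \<psi> y)) (at x)"
      by (rule has_derivative_mult_left)
    fix b :: "'a \<times> real" assume "b \<in> Basis"
    then have "G b y \<le> (\<Sum>b\<in>Basis. G b y)"
      using Gnn xy by (intro member_le_sum) auto
    then show "\<bar>D (fst x - a y, snd x - \<tau> y) b * \<psi> y\<bar> \<le> (\<Sum>b\<in>Basis. G b y)"
      using G(2)[of x y b] xy r by force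
  next
    show "integrable M (\<lambda>y. f (fst x - a y, snd x - \<tau> y) * \<psi> y)" if "x \<in> ball p r" for x
      using that r by (intro L_integrable f) auto
    show "integrable M (\<lambda>y. \<Sum>b\<in>Basis. G b y)" using G by auto
    show "(\<lambda>y. D (fst p - a y, snd p - \<tau> y) v * \<psi> y) \<in> borel_measurable M" for v
      using measurable_translate[OF Dk] .
  qed
qed

text \<open>Every directional derivative of a superposition is the superposition of another kernel
  of the class, so the induction runs over all kernels at once.\<close>

lemma Ck_on_L: "kclass f \<Longrightarrow> Ck_on k U (L f)"
proof (induction k arbitrary: f)
  case 0
  obtain D where D: "kder f D" using kclass_kder[OF 0] by blast
  have "continuous_on U (L f)"
    using L_has_derivative[OF 0 D]
    by (intro continuous_at_imp_continuous_on) (auto intro: has_derivative_continuous)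
  then show ?case by simp
next
  case (Suc k)
  obtain D where D: "kder f D" using kclass_kder[OF Suc.prems] by blast
  have "\<forall>x\<in>U. (L f has_derivative (\<lambda>v. L (\<lambda>q. D q v) x)) (at x within U)"
    using L_has_derivative[OF Suc.prems D] by (auto intro: has_derivative_at_withinI)
  moreover have "\<forall>b\<in>Basis. Ck_on k U (\<lambda>x. L (\<lambda>q. D q b) x)"
    using D Suc.IH by (auto simp: kder_def)
  ultimately show ?case by auto
qed

end

section \<open>The heat equation for superpositions\<close>

text \<open>The heat equation with space-time Frechet derivatives, where \<open>E i\<close>
  differentiates the i-th spatial component of \<open>D\<close>. In this form sums and
  superpositions inherit it directly.\<close>

definition caloric :: "((real ^ 'n::finite) \<times> real) set \<Rightarrow> ((real ^ 'n::finite) \<times> real \<Rightarrow> real) \<Rightarrow> bool" where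
  "caloric U v \<longleftrightarrow> (\<exists>D E. (\<forall>p\<in>U. (v has_derivative D p) (at p)) \<and>
     (\<forall>i. \<forall>p\<in>U. ((\<lambda>q. D q (axis i 1, 0)) has_derivative E i p) (at p)) \<and>
     (\<forall>p\<in>U. D p (0, 1) = (\<Sum>i\<in>UNIV. E i p (axis i 1, 0))))"

lemma caloric_add:
  assumes "caloric U v" "caloric U w"
  shows "caloric U (\<lambda>p. v p + w p)"
proof -
  obtain D E where 1: "\<And>p. p \<in> U \<Longrightarrow> (v has_derivative D p) (at p)"
     "\<And>i p. p \<in> U \<Longrightarrow> ((\<lambda>q. D q (axis i 1, 0)) has_derivative E i p) (at p)"
     "\<And>p. p \<in> U \<Longrightarrow> D p (0, 1) = (\<Sum>i\<in>UNIV. E i p (axis i 1, 0))"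
    using assms(1) unfolding caloric_def by blast
  obtain D' E' where 2: "\<And>p. p \<in> U \<Longrightarrow> (w has_derivative D' p) (at p)"
     "\<And>i p. p \<in> U \<Longrightarrow> ((\<lambda>q. D' q (axis i 1, 0)) has_derivative E' i p) (at p)"
     "\<And>p. p \<in> U \<Longrightarrow> D' p (0, 1) = (\<Sum>i\<in>UNIV. E' i p (axis i 1, 0))"
    using assms(2) unfolding caloric_def by blast
  show ?thesis
    unfolding caloric_def
    using 1 2 by (intro exI[of _ "\<lambda>p v. D p v + D' p v"] exI[of _ "\<lambda>i p v. E i p v + E' i p v"])
      (simp add: has_derivative_add sum.distrib)
qed

lemma caloric_scale:
  assumes "caloric U v"
  shows "caloric U (\<lambda>p. c * v p)"
proof -
  obtain D E where 1: "\<And>p. p \<in> U \<Longrightarrow> (v has_derivative D p) (at p)"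
     "\<And>i p. p \<in> U \<Longrightarrow> ((\<lambda>q. D q (axis i 1, 0)) has_derivative E i p) (at p)"
     "\<And>p. p \<in> U \<Longrightarrow> D p (0, 1) = (\<Sum>i\<in>UNIV. E i p (axis i 1, 0))"
    using assms(1) unfolding caloric_def by blast
  show ?thesis
    unfolding caloric_def
    using 1 by (intro exI[of _ "\<lambda>p v. c * D p v"] exI[of _ "\<lambda>i p v. c * E i p v"])
      (simp add: has_derivative_mult_right sum_distrib_left)
qed

lemma caloric_cong:
  assumes "caloric U v" "open U" "\<And>p. p \<in> U \<Longrightarrow> v p = w p"
  shows "caloric U w"
proof -
  obtain D E where D: "\<And>p. p \<in> U \<Longrightarrow> (v has_derivative D p) (at p)"
     and E: "\<forall>i. \<forall>p\<in>U. ((\<lambda>q. D q (axis i 1, 0)) has_derivative E i p) (at p)"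
     "\<forall>p\<in>U. D p (0, 1) = (\<Sum>i\<in>UNIV. E i p (axis i 1, 0))"
    using assms(1) unfolding caloric_def by blast
  have "\<forall>p\<in>U. (w has_derivative D p) (at p)"
    using has_derivative_transform_within_open[OF D assms(2) _ assms(3)] by blast
  with E show ?thesis unfolding caloric_def by blast
qed

lemma pd_eq_of_has_derivative:
  assumes "(v has_derivative D) (at (x, t))"
  shows "pd i (\<lambda>z. v (z, t)) x = D (axis i 1, 0)"
proof -
  have "((\<lambda>h. (x + h *\<^sub>R axis i 1, t)) has_derivative (\<lambda>h. (h *\<^sub>R axis i 1, 0))) (at 0)"
    by (auto intro!: derivative_eq_intros)
  moreover have "(v has_derivative D) (at (x + 0 *\<^sub>R axis i 1, t))" using assms by simp
  ultimately have "((\<lambda>h. v (x + h *\<^sub>R axis i 1, t)) has_derivative (\<lambda>h. D (h *\<^sub>R axis i 1, 0))) (at 0)"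
    using has_derivative_compose[of "\<lambda>h. (x + h *\<^sub>R axis i 1, t)" _ 0 UNIV v D] by simp
  moreover have "(\<lambda>h. D (h *\<^sub>R axis i 1, 0)) = (*) (D (axis i 1, 0))"
  proof
    fix h :: real
    have "D (h *\<^sub>R (axis i 1, 0)) = h *\<^sub>R D (axis i 1, 0)"
      using has_derivative_bounded_linear[OF assms] by (rule linear_simps)
    then show "D (h *\<^sub>R axis i 1, 0) = D (axis i 1, 0) * h" by (simp add: mult.commute)
  qed
  ultimately have "((\<lambda>h. v (x + h *\<^sub>R axis i 1, t)) has_real_derivative D (axis i 1, 0)) (at 0)"
    by (simp add: has_field_derivative_def)
  then show ?thesis
    unfolding pd_def by (rule DERIV_imp_deriv)
qed

lemma deriv_time_eq_of_has_derivative: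
  fixes v :: "'a::real_normed_vector \<times> real \<Rightarrow> real"
  assumes "(v has_derivative D) (at (x, t))"
  shows "deriv (\<lambda>s. v (x, s)) t = D (0, 1)"
proof -
  have "((\<lambda>s. (x, s)) has_derivative (\<lambda>h. (0, h))) (at t)"
    by (auto intro!: derivative_eq_intros)
  then have "((\<lambda>s. v (x, s)) has_derivative (\<lambda>h. D (0, h))) (at t)"
    using has_derivative_compose[of "\<lambda>s. (x, s)" _ t UNIV v D] assms by simp
  moreover have "(\<lambda>h. D (0, h)) = (*) (D (0, 1))"
  proof
    fix h :: real
    have "D (h *\<^sub>R (0, 1)) = h *\<^sub>R D (0, 1)"
      using has_derivative_bounded_linear[OF assms] by (rule linear_simps)
    then show "D (0, h) = D (0, 1) * h" by (simp add: mult.commute)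
  qed
  ultimately have "((\<lambda>s. v (x, s)) has_real_derivative D (0, 1)) (at t)"
    by (simp add: has_field_derivative_def)
  then show ?thesis by (rule DERIV_imp_deriv)
qed

lemma normal_deriv_eq_of_has_derivative:
  assumes "(v has_derivative D) (at (x, t))"
  shows "normal_deriv (\<lambda>z. v (z, t)) x = - D (eN, 0)"
proof -
  have "((\<lambda>h. (x + h *\<^sub>R eN, t)) has_derivative (\<lambda>h. (h *\<^sub>R eN, 0))) (at 0)"
    by (auto intro!: derivative_eq_intros)
  moreover have "(v has_derivative D) (at (x + 0 *\<^sub>R eN, t))" using assms by simp
  ultimately have "((\<lambda>h. v (x + h *\<^sub>R eN, t)) has_derivative (\<lambda>h. D (h *\<^sub>R eN, 0))) (at 0)"
    using has_derivative_compose[of "\<lambda>h. (x + h *\<^sub>R eN, t)" _ 0 UNIV v D] by simp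
  moreover have "(\<lambda>h. D (h *\<^sub>R eN, 0)) = (\<lambda>h. h *\<^sub>R D (eN, 0))"
  proof
    fix h :: real
    have "D (h *\<^sub>R (eN, 0)) = h *\<^sub>R D (eN, 0)"
      using has_derivative_bounded_linear[OF assms] by (rule linear_simps)
    then show "D (h *\<^sub>R eN, 0) = h *\<^sub>R D (eN, 0)" by simp
  qed
  ultimately have "((\<lambda>h. v (x + h *\<^sub>R eN, t)) has_vector_derivative D (eN, 0)) (at 0 within {0..})"
    by (auto simp: has_vector_derivative_def intro: has_derivative_at_withinI)
  then show ?thesis
    unfolding normal_deriv_def
    by (subst vector_derivative_within) (auto simp: at_within_Ici_at_right)
qed

text \<open>The first partial derivative agrees with a component of \<open>D\<close> near the point,
  because U is open, and \<open>deriv\<close> sees only this germ. So the iterated one-dimensional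
  derivatives are the components of \<open>E\<close>.\<close>

lemma heat_equation_of_caloric:
  assumes "caloric U v" "open U" "(x, t) \<in> U"
  shows "deriv (\<lambda>s. v (x, s)) t - laplacian (\<lambda>z. v (z, t)) x = 0"
proof -
  obtain D E where D: "\<And>p. p \<in> U \<Longrightarrow> (v has_derivative D p) (at p)"
     and E: "\<And>i p. p \<in> U \<Longrightarrow> ((\<lambda>q. D q (axis i 1, 0)) has_derivative E i p) (at p)"
     and eq: "\<And>p. p \<in> U \<Longrightarrow> D p (0, 1) = (\<Sum>i\<in>UNIV. E i p (axis i 1, 0))"
    using assms(1) unfolding caloric_def by blast
  have "pd i (pd i (\<lambda>z. v (z, t))) x = E i (x, t) (axis i 1, 0)" for i
  proof -
    have "continuous_on UNIV (\<lambda>h. (x + h *\<^sub>R axis i (1::real), t))" by (intro continuous_intros)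
    then have "open ((\<lambda>h. (x + h *\<^sub>R axis i (1::real), t)) -` U)"
      using assms(2) by (intro open_vimage)
    then have "eventually (\<lambda>h. h \<in> (\<lambda>h. (x + h *\<^sub>R axis i (1::real), t)) -` U) (nhds 0)"
      using assms(3) by (intro eventually_nhds_in_open) auto
    then have "eventually (\<lambda>h. pd i (\<lambda>z. v (z, t)) (x + h *\<^sub>R axis i 1) = D (x + h *\<^sub>R axis i 1, t) (axis i 1, 0)) (nhds 0)"
      by eventually_elim (simp add: pd_eq_of_has_derivative D)
    then have "pd i (pd i (\<lambda>z. v (z, t))) x = pd i (\<lambda>z. D (z, t) (axis i 1, 0)) x"
      unfolding pd_def[of i "pd i (\<lambda>z. v (z, t))"] pd_def[of i "\<lambda>z. D (z, t) (axis i 1, 0)"] by (rule deriv_cong_ev) simp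
    also have "\<dots> = E i (x, t) (axis i 1, 0)"
      by (rule pd_eq_of_has_derivative[OF E[OF assms(3)]])
    finally show ?thesis .
  qed
  then show ?thesis
    using eq[OF assms(3)] by (simp add: laplacian_def deriv_time_eq_of_has_derivative[OF D[OF assms(3)]])
qed

section \<open>Kernels that solve the heat equation away from their pole\<close>

text \<open>The counterpart of \<open>caloric\<close> for a kernel; the identity is pointwise, so it
  can be integrated against the weights of any superposition.\<close>

definition heatk :: "((real ^ 'n::finite) \<times> real \<Rightarrow> real) \<Rightarrow> bool" where
  "heatk f \<longleftrightarrow> kclass f \<and> (\<exists>D E. kder f D \<and> (\<forall>i. kder (\<lambda>p. D p (axis i 1, 0)) (E i)) \<and>
     (\<forall>p. D p (0, 1) = (\<Sum>i\<in>UNIV. E i p (axis i 1, 0))))"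

lemma (in superposition) finite_sum_L:
  assumes "finite I" "\<And>i. i \<in> I \<Longrightarrow> kclass (f i)" "p \<in> U"
  shows "L (\<lambda>q. \<Sum>i\<in>I. f i q) p = (\<Sum>i\<in>I. L (f i) p)"
  unfolding L_def using L_integrable[OF assms(2,3)]
  by (simp add: sum_distrib_right)


lemma kder_scale: "kder f D \<Longrightarrow> kder (\<lambda>p. c * f p) (\<lambda>p v. c * D p v)"
  unfolding kder_def using has_derivative_mult_right[of f _ _ c] kclass.scale[of "\<lambda>p. D p _" c] by simp

lemma kder_add: "kder f D \<Longrightarrow> kder g E \<Longrightarrow> kder (\<lambda>p. f p + g p) (\<lambda>p v. D p v + E p v)"
  unfolding kder_def using has_derivative_add[of f _ _ g] kclass.add[of "\<lambda>p. D p _" "\<lambda>p. E p _"] by simp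

lemma sum_nth_sq: "(\<Sum>i\<in>UNIV. (x $ i)\<^sup>2) = (norm x)\<^sup>2" for x :: "real ^ 'n::finite"
  by (simp add: norm_vec_def L2_set_def sum_nonneg)

lemma axis_nth: "axis i c $ j = (if i = j then c else 0)"
  by (simp add: axis_def)

lemma sum_nth_axis: "(\<Sum>i\<in>UNIV. x $ i * (axis i 1 $ j)) = x $ j" for x :: "real ^ 'n::finite"
  by (simp add: axis_def if_distrib cong: if_cong)

text \<open>The time derivative contains m times \<open>ek (m - 1)\<close>, while the N second space
  derivatives contribute -N / 2 times it; this forces m = -N / 2. The terms with |w|^2 agree for
  every m.\<close>

lemma heatk_ek: "heatk (ek (- real CARD('n) / 2) :: (real ^ 'n::finite) \<times> real \<Rightarrow> real)"
proof -
  define m where "m = - real CARD('n) / 2"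
  define E where "E i p v = (- 1 / 2) * ((fst p \<bullet> axis i 1) * ekD (m - 1) p v + (fst v \<bullet> axis i 1) * ek (m - 1) p)"
    for i :: 'n and p v :: "((real, 'n) vec) \<times> real"
  have eq: "(\<lambda>p. ekD m p (axis i 1, 0)) = (\<lambda>p. (- 1 / 2) * ((fst p \<bullet> axis i 1) * ek (m - 1) p))" for i :: 'n
    by (auto simp: ekD_def)
  have "kder (\<lambda>p. ekD m p (axis i 1, 0)) (E i)" for i
    unfolding eq E_def[abs_def] by (intro kder_scale kder_mul kder_ek kclass.base)
  moreover have "ekD m p (0, 1) = (\<Sum>i\<in>UNIV. E i p (axis i 1, 0))" for p :: "((real, 'n) vec) \<times> real"
  proof -
    have "E i p (axis i 1, 0) = 1 / 4 * ek (m - 2) p * (fst p $ i)\<^sup>2 - 1 / 2 * ek (m - 1) p" for i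
      by (simp add: E_def ekD_def inner_axis power2_eq_square algebra_simps)
    then have "(\<Sum>i\<in>UNIV. E i p (axis i 1, 0)) = 1 / 4 * ek (m - 2) p * (norm (fst p))\<^sup>2 - real CARD('n) * (1 / 2 * ek (m - 1) p)"
      by (simp only: sum_subtractf sum_distrib_left[symmetric] sum_nth_sq sum_constant)
    then show ?thesis by (simp add: ekD_def m_def)
  qed
  ultimately show ?thesis
    unfolding heatk_def m_def[symmetric] using kder_ek kclass.base by blast
qed

text \<open>Up to the factor -2 this is the l-th space derivative of the kernel of
  \<open>heatk_ek\<close>, and derivatives of solutions are solutions. It is the kernel of the
  flux.\<close>

lemma heatk_moment:
  fixes l :: "'n::finite"
  shows "heatk (\<lambda>p :: (real ^ 'n::finite) \<times> real. (fst p \<bullet> axis l 1) * ek (- real CARD('n) / 2 - 1) p)"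
proof -
  define m where "m = - real CARD('n) / 2 - 1"
  let ?b = "axis l 1 :: (real, 'n) vec"
  let ?D = "\<lambda>p v. (fst p \<bullet> ?b) * ekD m p v + (fst v \<bullet> ?b) * ek m p"
  define E where "E i p v =
      (?b $ i) * ekD m p v + (- 1 / 2) * ((fst p \<bullet> ?b) * ((fst p \<bullet> axis i 1) * ekD (m - 1) p v + (fst v \<bullet> axis i 1) * ek (m - 1) p)
        + (fst v \<bullet> ?b) * ((fst p \<bullet> axis i 1) * ek (m - 1) p))"
    for i :: 'n and p v :: "((real, 'n) vec) \<times> real"
  have eq: "(\<lambda>p. ?D p (axis i 1, 0)) = (\<lambda>p. (?b $ i) * ek m p + (- 1 / 2) * ((fst p \<bullet> ?b) * ((fst p \<bullet> axis i 1) * ek (m - 1) p)))" for i :: 'n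
  proof -
    have "axis i (1::real) $ l = axis l 1 $ i" by (simp add: axis_def)
    then show ?thesis by (simp add: fun_eq_iff ekD_def inner_axis)
  qed
  have "kder (\<lambda>p. ?D p (axis i 1, 0)) (E i)" for i
    unfolding eq E_def[abs_def] by (intro kder_add kder_scale kder_mul kder_ek kclass.base kclass.mul)
  moreover have "?D p (0, 1) = (\<Sum>i\<in>UNIV. E i p (axis i 1, 0))" for p :: "((real, 'n) vec) \<times> real"
  proof -
    have "E i p (axis i 1, 0) = - ek (m - 1) p * (fst p $ i * (axis i 1 $ l))
       + (1 / 4 * (fst p $ l) * ek (m - 2) p) * (fst p $ i)\<^sup>2 - 1 / 2 * (fst p $ l) * ek (m - 1) p" for i
      by (cases "i = l") (simp_all add: E_def ekD_def inner_axis axis_nth power2_eq_square algebra_simps)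
    then have "(\<Sum>i\<in>UNIV. E i p (axis i 1, 0)) = - ek (m - 1) p * fst p $ l
       + (1 / 4 * (fst p $ l) * ek (m - 2) p) * (norm (fst p))\<^sup>2 - real CARD('n) * (1 / 2 * (fst p $ l) * ek (m - 1) p)"
      by (simp only: sum_subtractf sum.distrib sum_distrib_left[symmetric] sum_nth_sq sum_nth_axis sum_constant mult.assoc) (simp add: mult_ac)
    then show ?thesis by (simp add: ekD_def m_def inner_axis algebra_simps)
  qed
  ultimately show ?thesis
    unfolding heatk_def m_def[symmetric] using kder_mul[OF kclass.base kder_ek] kclass.mul[OF kclass.base] by blast
qed

lemma (in superposition) kder_integrable:
  assumes "kder f D" "p \<in> U"
  shows "integrable M (\<lambda>y. D (fst p - a y, snd p - \<tau> y) v * \<psi> y)"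
  using assms L_integrable[of "\<lambda>q. D q v"] unfolding kder_def by blast

lemma caloric_superposition:
  fixes a :: "'y \<Rightarrow> real ^ 'n::finite"
  assumes S: "superposition M a \<tau> \<psi> U" and "heatk f"
  shows "caloric U (superposition.L M a \<tau> \<psi> f)"
proof -
  interpret superposition M a \<tau> \<psi> U by (rule S)
  obtain D E where f: "kclass f" and D: "kder f D" and E: "\<And>i. kder (\<lambda>p. D p (axis i 1, 0)) (E i)"
    and eq: "\<And>p. D p (0, 1) = (\<Sum>i\<in>UNIV. E i p (axis i 1, 0))"
    using assms(2) unfolding heatk_def by blast
  have Ek: "kclass (\<lambda>q. E i q v)" for i v using E unfolding kder_def by blast
  have Dk: "kclass (\<lambda>q. D q v)" for v using D unfolding kder_def by blast
  show ?thesis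
    unfolding caloric_def
  proof (intro exI conjI ballI allI)
    fix p assume p: "p \<in> U"
    show "(L f has_derivative (\<lambda>v. L (\<lambda>q. D q v) p)) (at p)" by (rule L_has_derivative[OF f D p])
    show "((\<lambda>p. L (\<lambda>q. D q (axis i 1, 0)) p) has_derivative (\<lambda>v. L (\<lambda>q. E i q v) p)) (at p)" for i
      by (rule L_has_derivative[OF Dk E p])
    show "L (\<lambda>q. D q (0, 1)) p = (\<Sum>i\<in>UNIV. L (\<lambda>q. E i q (axis i 1, 0)) p)"
      unfolding eq using Ek p by (intro finite_sum_L) auto
  qed
qed

section \<open>Mass, symmetry and bounds of the kernel\<close>

text \<open>For y on the boundary, reflecting y + h eN and then shifting by \<tau> eN merely adds h
  + \<tau> to the height of x.\<close>

lemma ennreal_Gauss_slice: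
  fixes x :: "real ^ 'n::{finite,linorder}"
  assumes "0 < s"
  shows "(\<integral>\<^sup>+y. ennreal (Gauss (x - refl_pt (y + h *\<^sub>R eN) + \<tau> *\<^sub>R eN) s) \<partial>bdry)
     = ennreal (gss (x $ lastc + h + \<tau>) s)"
proof -
  have "(\<integral>\<^sup>+y. ennreal (Gauss (x - refl_pt (y + h *\<^sub>R eN) + \<tau> *\<^sub>R eN) s) \<partial>bdry)
     = (\<integral>\<^sup>+y. ennreal (Gauss ((x + (h + \<tau>) *\<^sub>R eN) - y) s) \<partial>bdry)"
  proof (rule nn_integral_cong_AE)
    show "AE y in bdry. ennreal (Gauss (x - refl_pt (y + h *\<^sub>R eN) + \<tau> *\<^sub>R eN) s)
       = ennreal (Gauss ((x + (h + \<tau>) *\<^sub>R eN) - y) s)"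
      using AE_bdry
    proof eventually_elim
      case (elim y)
      then have "x - refl_pt (y + h *\<^sub>R eN) + \<tau> *\<^sub>R eN = (x + (h + \<tau>) *\<^sub>R eN) - y"
        by (simp add: refl_pt_eq algebra_simps scaleR_2[symmetric] flip: scaleR_add_left)
      then show ?case by (simp only:)
    qed
  qed
  also have "\<dots> = ennreal (gss ((x + (h + \<tau>) *\<^sub>R eN) $ lastc) s)"
    by (rule nn_integral_Gauss_bdry[OF assms])
  finally show ?thesis by (simp add: add.assoc)
qed

lemma nn_integral_flux_slice:
  fixes x :: "real ^ 'n::{finite,linorder}"
  assumes "0 \<le> x $ lastc" "0 \<le> h" "0 < \<tau>" "\<tau> < t"
  shows "(\<integral>\<^sup>+y. ennreal (flux (x - refl_pt (y + h *\<^sub>R eN)) t \<tau>) \<partial>bdry)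
     = ennreal ((x $ lastc + h + \<tau>) / (t - \<tau>) * gss (x $ lastc + h + \<tau>) (t - \<tau>))"
proof -
  have "(\<integral>\<^sup>+y. ennreal (flux (x - refl_pt (y + h *\<^sub>R eN)) t \<tau>) \<partial>bdry)
    = (\<integral>\<^sup>+y. ennreal ((x $ lastc + h + \<tau>) / (t - \<tau>)) * ennreal (Gauss (x - refl_pt (y + h *\<^sub>R eN) + \<tau> *\<^sub>R eN) (t - \<tau>)) \<partial>bdry)"
    using AE_bdry assms
    by (intro nn_integral_cong_AE) (auto elim!: eventually_mono simp: flux_def ennreal_mult[symmetric])
  also have "\<dots> = ennreal ((x $ lastc + h + \<tau>) / (t - \<tau>)) * ennreal (gss (x $ lastc + h + \<tau>) (t - \<tau>))"
    using assms by (subst nn_integral_cmult) (auto simp: ennreal_Gauss_slice)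
  also have "\<dots> = ennreal ((x $ lastc + h + \<tau>) / (t - \<tau>) * gss (x $ lastc + h + \<tau>) (t - \<tau>))"
    using assms by (subst ennreal_mult) auto
  finally show ?thesis .
qed

interpretation mu_lborel: pair_sigma_finite "mu :: (real ^ 'n::{finite,linorder}) measure" "lborel :: real measure"
  by (intro pair_sigma_finite.intro sigma_finite_mu sigma_finite_lborel)

text \<open>The weight g is 1 for the mass and the distance to the reflected point for the first
  moment.\<close>

lemma nn_integral_Kn_swap:
  assumes [measurable]: "g \<in> borel_measurable borel"
  shows "(\<integral>\<^sup>+y. Kn (x - refl_pt y) t * g y \<partial>mu)
    = (\<integral>\<^sup>+\<tau>\<in>{0<..<t}. (\<integral>\<^sup>+y. ennreal (flux (x - refl_pt y) t \<tau>) * g y \<partial>mu) \<partial>lborel)"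
proof -
  have "(\<integral>\<^sup>+y. Kn (x - refl_pt y) t * g y \<partial>mu)
    = (\<integral>\<^sup>+y. \<integral>\<^sup>+\<tau>. ennreal (flux (x - refl_pt y) t \<tau>) * g y * indicator {0<..<t} \<tau> \<partial>lborel \<partial>mu)"
    unfolding Kn_def by (intro nn_integral_cong, subst nn_integral_multc[symmetric]) (auto simp: mult_ac)
  also have "\<dots> = (\<integral>\<^sup>+\<tau>. \<integral>\<^sup>+y. ennreal (flux (x - refl_pt y) t \<tau>) * g y * indicator {0<..<t} \<tau> \<partial>mu \<partial>lborel)"
    by (rule mu_lborel.Fubini'[symmetric]) measurable
  also have "\<dots> = (\<integral>\<^sup>+\<tau>\<in>{0<..<t}. (\<integral>\<^sup>+y. ennreal (flux (x - refl_pt y) t \<tau>) * g y \<partial>mu) \<partial>lborel)"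
    by (intro nn_integral_cong, subst nn_integral_multc) auto
  finally show ?thesis .
qed

lemma nn_integral_Kn_mu:
  fixes x :: "real ^ 'n::{finite,linorder}"
  assumes x: "0 \<le> x $ lastc" and t: "0 < t"
  shows "(\<integral>\<^sup>+y. Kn (x - refl_pt y) t \<partial>mu) = ennreal (2 * Psi (x $ lastc / sqrt t))"
proof -
  let ?z = "x $ lastc"
  have "(\<integral>\<^sup>+y. Kn (x - refl_pt y) t \<partial>mu)
     = (\<integral>\<^sup>+\<tau>\<in>{0<..<t}. (\<integral>\<^sup>+y. ennreal (flux (x - refl_pt y) t \<tau>) \<partial>mu) \<partial>lborel)"
    using nn_integral_Kn_swap[of "\<lambda>_. 1" x t] by simp
  also have "\<dots> = (\<integral>\<^sup>+\<tau>. 2 * (ennreal (1 * (1 + (?z + \<tau>) / (2 * (t - \<tau>))) * gss (1 * (?z + \<tau>)) (t - \<tau>)) * indicator {0<..<t} \<tau>) \<partial>lborel)"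
  proof (rule nn_integral_cong)
    fix \<tau> :: real
    show "(\<integral>\<^sup>+y. ennreal (flux (x - refl_pt y) t \<tau>) \<partial>mu) * indicator {0<..<t} \<tau>
       = 2 * (ennreal (1 * (1 + (?z + \<tau>) / (2 * (t - \<tau>))) * gss (1 * (?z + \<tau>)) (t - \<tau>)) * indicator {0<..<t} \<tau>)"
    proof (cases "\<tau> \<in> {0<..<t}")
      case True
      define s where "s = t - \<tau>"
      define a where "a = ?z + \<tau>"
      have sa: "0 < s" "0 \<le> a" using True x by (auto simp: s_def a_def)
      have "(\<integral>\<^sup>+y. ennreal (flux (x - refl_pt y) t \<tau>) \<partial>mu)
        = (\<integral>\<^sup>+h\<in>{0..}. (\<integral>\<^sup>+y. ennreal (flux (x - refl_pt (y + h *\<^sub>R eN)) t \<tau>) \<partial>bdry) \<partial>lborel)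
          + (\<integral>\<^sup>+y. ennreal (flux (x - refl_pt (y + 0 *\<^sub>R eN)) t \<tau>) \<partial>bdry)"
        by (subst nn_integral_mu_slices) auto
      also have "(\<integral>\<^sup>+h\<in>{0..}. (\<integral>\<^sup>+y. ennreal (flux (x - refl_pt (y + h *\<^sub>R eN)) t \<tau>) \<partial>bdry) \<partial>lborel)
        = (\<integral>\<^sup>+h\<in>{0..}. ennreal ((a + h) / s * gss (a + h) s) \<partial>lborel)"
        using True x by (intro nn_integral_cong) (auto simp: indicator_def nn_integral_flux_slice s_def a_def add_ac)
      also have "\<dots> = ennreal (2 * gss a s)" by (rule nn_integral_moment_tail[OF sa])
      also have "(\<integral>\<^sup>+y. ennreal (flux (x - refl_pt (y + 0 *\<^sub>R eN)) t \<tau>) \<partial>bdry) = ennreal (a / s * gss a s)"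
        using True x by (subst nn_integral_flux_slice) (auto simp: s_def a_def)
      also have "ennreal (2 * gss a s) + ennreal (a / s * gss a s) = ennreal (2 * gss a s + a / s * gss a s)"
        using sa by (subst ennreal_plus) auto
      \<comment> \<open>The volume and boundary contributions add up to twice the integrand of
        \<open>nn_integral_flux\<close> with k = 1.\<close>
      also have "2 * gss a s + a / s * gss a s = 2 * (1 * (1 + a / (2 * s)) * gss (1 * a) s)"
        using sa by (simp add: field_simps)
      also have "ennreal (2 * (1 * (1 + a / (2 * s)) * gss (1 * a) s)) = 2 * ennreal (1 * (1 + a / (2 * s)) * gss (1 * a) s)"
        using sa by (subst ennreal_mult) auto
      finally show ?thesis using True by (simp add: s_def a_def)
    qed simp
  qed
  also have "\<dots> = 2 * ennreal (Psi (1 * ?z / sqrt t))"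
    using x t by (subst nn_integral_cmult) (auto simp only: nn_integral_flux zero_less_one, measurable)
  also have "\<dots> = ennreal (2 * Psi (?z / sqrt t))"
    using Psi_bounds by (subst ennreal_mult) auto
  finally show ?thesis .
qed


lemma borel_measurable_Kker [measurable (raw)]:
  fixes f :: "'a \<Rightarrow> real ^ 'n::{finite,linorder}"
  assumes [measurable]: "f \<in> borel_measurable M" "g \<in> borel_measurable M"
  shows "(\<lambda>x. Kker (f x) (g x)) \<in> borel_measurable M"
proof -
  have "Kker w t = (\<integral>\<tau>. (if 0 < \<tau> \<and> \<tau> < t then flux w t \<tau> else 0) \<partial>lborel)" for w :: "(real, 'n) vec" and t
    unfolding Kker_def set_lebesgue_integral_def
    by (intro Bochner_Integration.integral_cong) (auto simp: indicator_def)
  then show ?thesis by simp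
qed

lemma borel_measurable_Gker [measurable (raw)]:
  fixes f :: "'a \<Rightarrow> real ^ 'n::{finite,linorder}"
  assumes [measurable]: "f \<in> borel_measurable M" "g \<in> borel_measurable M" "h \<in> borel_measurable M"
  shows "(\<lambda>x. Gker (f x) (g x) (h x)) \<in> borel_measurable M"
  unfolding Gker_eq by measurable

lemma norm_add_eN_sq: "(norm (v + c *\<^sub>R eN))\<^sup>2 = (norm v)\<^sup>2 + 2 * c * v $ lastc + c\<^sup>2"
  using dot_norm[of v "c *\<^sub>R eN"] by simp

section \<open>Symmetry, nonnegativity and total mass of the kernel\<close>

lemma norm_shift_commute:
  "norm (x - refl_pt y + c *\<^sub>R eN) = norm (y - refl_pt x + c *\<^sub>R eN)"
proof -
  have "(norm (x - refl_pt y + c *\<^sub>R eN))\<^sup>2 = (norm (x - y))\<^sup>2 + 4 * x $ lastc * y $ lastc + 2 * c * (x $ lastc + y $ lastc) + c\<^sup>2"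
    for x y :: "(real, 'a) vec"
    by (simp add: norm_add_eN_sq norm_diff_refl_pt_sq)
  from this[of x y] this[of y x]
  have "(norm (x - refl_pt y + c *\<^sub>R eN))\<^sup>2 = (norm (y - refl_pt x + c *\<^sub>R eN))\<^sup>2"
    by (simp add: norm_minus_commute[of x y])
  then show ?thesis by simp
qed

lemma Gker_commute: "Gker x y t = Gker y x t"
proof -
  have "flux (x - refl_pt y) t \<tau> = flux (y - refl_pt x) t \<tau>" for \<tau>
    by (simp add: flux_def Gauss_def norm_shift_commute[of x y] add.commute[of "x $ lastc"])
  then show ?thesis
    using norm_shift_commute[of x y 0]
    by (simp add: Gker_eq Kker_def Gauss_def norm_minus_commute[of x y])
qed

lemma Gauss_refl_le:
  assumes "x \<in> closure Omega" "y \<in> closure Omega" "0 < t"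
  shows "Gauss (x - refl_pt y) t \<le> Gauss (x - y) t"
proof -
  have "(norm (x - y))\<^sup>2 \<le> (norm (x - refl_pt y))\<^sup>2"
    using assms by (simp add: norm_diff_refl_pt_sq closure_Omega)
  then show ?thesis using assms(3)
    by (auto simp: Gauss_def intro!: mult_left_mono divide_right_mono)
qed

lemma Gker_ge_Kker:
  assumes "x \<in> closure Omega" "y \<in> closure Omega" "0 < t"
  shows "Kker (x - refl_pt y) t \<le> Gker x y t"
  using Gauss_refl_le[OF assms] by (simp add: Gker_eq)

lemma Gker_nonneg:
  assumes "x \<in> closure Omega" "y \<in> closure Omega" "0 < t"
  shows "0 \<le> Gker x y t"
  using Gker_ge_Kker[OF assms] Kker_eq_Kn(2)[of "x - refl_pt y" t] assms by (auto simp: closure_Omega)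

lemma Gauss_le: "0 < t \<Longrightarrow> Gauss x t \<le> t powr (- (real CARD('n) / 2))" for x :: "real ^ 'n::finite"
proof -
  assume t: "0 < t"
  have "t \<le> 4 * pi * t" using pi_ge_two t by simp
  then have "(4 * pi * t) powr (- (real CARD('n) / 2)) \<le> t powr (- (real CARD('n) / 2))"
    using t by (intro powr_mono2') auto
  then have "(4 * pi * t) powr (- (real CARD('n) / 2)) * exp (- ((norm x)\<^sup>2 / (4 * t))) \<le> t powr (- (real CARD('n) / 2)) * 1"
    using t by (intro mult_mono) auto
  then show ?thesis by (simp add: Gauss_def)
qed

text \<open>The 5 is the 4 of \<open>Kn_le\<close> plus 1 for the direct Gaussian.\<close>

definition Gsup :: "nat \<Rightarrow> real \<Rightarrow> real" where
  "Gsup N t = 5 * t powr (- (real N / 2)) + flux_const N * t powr (- (real N - 1))"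

lemma Gker_le_Gsup:
  fixes x y :: "real ^ 'n::{finite,linorder}"
  assumes "x \<in> closure Omega" "y \<in> closure Omega" "0 < t"
  shows "Gker x y t \<le> Gsup CARD('n) t"
proof -
  have w: "0 \<le> (x - refl_pt y) $ lastc" using assms by (simp add: closure_Omega)
  have "ennreal (Kker (x - refl_pt y) t) \<le> ennreal (4 * t powr (- (real CARD('n) / 2)) + flux_const CARD('n) * t powr (- (real CARD('n) - 1)))"
    using Kn_le[OF w assms(3)] by (simp add: Kker_eq_Kn(1)[OF w assms(3)])
  then have "Kker (x - refl_pt y) t \<le> 4 * t powr (- (real CARD('n) / 2)) + flux_const CARD('n) * t powr (- (real CARD('n) - 1))"
    by (subst (asm) ennreal_le_iff) (auto intro!: add_nonneg_nonneg mult_nonneg_nonneg flux_const_nonneg)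
  moreover have "Gker x y t \<le> Gauss (x - y) t + Kker (x - refl_pt y) t"
    by (simp add: Gker_eq)
  ultimately show ?thesis
    using Gauss_le[OF assms(3), of "x - y"] by (simp add: Gsup_def)
qed

lemma nn_integral_Gauss_mu:
  fixes x :: "real ^ 'n::{finite,linorder}"
  assumes t: "0 < t"
  shows "(\<integral>\<^sup>+y. ennreal (Gauss (x - y) t) \<partial>mu) = ennreal (Psi (- (x $ lastc) / sqrt t) + gss (x $ lastc) t)"
    and "(\<integral>\<^sup>+y. ennreal (Gauss (x - refl_pt y + \<tau> *\<^sub>R eN) t) \<partial>mu) = ennreal (Psi ((x $ lastc + \<tau>) / sqrt t) + gss (x $ lastc + \<tau>) t)"
proof -
  have b: "(\<integral>\<^sup>+y. ennreal (Gauss (x - (y + h *\<^sub>R eN)) t) \<partial>bdry) = ennreal (gss (- (x $ lastc) + h) t)" for h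
    using nn_integral_Gauss_bdry[OF t, of "x - h *\<^sub>R eN"] gss_diff_commute[of "x $ lastc" h t] by (simp add: algebra_simps)
  show "(\<integral>\<^sup>+y. ennreal (Gauss (x - y) t) \<partial>mu) = ennreal (Psi (- (x $ lastc) / sqrt t) + gss (x $ lastc) t)"
  proof -
    have "(\<integral>\<^sup>+y. ennreal (Gauss (x - y) t) \<partial>mu)
       = (\<integral>\<^sup>+h\<in>{0..}. ennreal (gss (- (x $ lastc) + h) t) \<partial>lborel) + ennreal (gss (x $ lastc) t)"
      by (subst nn_integral_mu_slices, measurable) (simp only: b nn_integral_Gauss_bdry[OF t])
    also have "\<dots> = ennreal (Psi (- (x $ lastc) / sqrt t) + gss (x $ lastc) t)"
      using t Psi_bounds by (simp only: nn_integral_gss_tail ennreal_plus gss_nonneg)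
    finally show ?thesis .
  qed
  have c: "(\<integral>\<^sup>+y. ennreal (Gauss (x - refl_pt (y + h *\<^sub>R eN) + \<tau> *\<^sub>R eN) t) \<partial>bdry) = ennreal (gss (x $ lastc + \<tau> + h) t)" for h
    using ennreal_Gauss_slice[OF t, of x h \<tau>] by (simp add: algebra_simps)
  show "(\<integral>\<^sup>+y. ennreal (Gauss (x - refl_pt y + \<tau> *\<^sub>R eN) t) \<partial>mu) = ennreal (Psi ((x $ lastc + \<tau>) / sqrt t) + gss (x $ lastc + \<tau>) t)"
  proof -
    have "(\<integral>\<^sup>+y. ennreal (Gauss (x - refl_pt y + \<tau> *\<^sub>R eN) t) \<partial>mu)
       = (\<integral>\<^sup>+h\<in>{0..}. ennreal (gss (x $ lastc + \<tau> + h) t) \<partial>lborel) + ennreal (gss (x $ lastc + \<tau>) t)"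
      using c[of 0] by (subst nn_integral_mu_slices, measurable) (simp add: c)
    also have "\<dots> = ennreal (Psi ((x $ lastc + \<tau>) / sqrt t) + gss (x $ lastc + \<tau>) t)"
      using t Psi_bounds by (simp only: nn_integral_gss_tail ennreal_plus gss_nonneg)
    finally show ?thesis .
  qed
qed

text \<open>Subtraction in \<open>ennreal\<close> is avoided by adding the mass of the reflected
  Gaussian to both sides. With z the scaled height, Psi(-z) + 2 Psi(z) = 1 + Psi(z) leaves exactly 1
  after cancellation.\<close>

lemma nn_integral_Gker:
  fixes x :: "real ^ 'n::{finite,linorder}"
  assumes x: "x \<in> closure Omega" and t: "0 < t"
  shows "(\<integral>\<^sup>+y. ennreal (Gker x y t) \<partial>mu) = 1"
proof -
  let ?z = "x $ lastc"
  have z: "0 \<le> ?z" using x by (simp add: closure_Omega)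
  have "(\<integral>\<^sup>+y. ennreal (Gker x y t) \<partial>mu) + (\<integral>\<^sup>+y. ennreal (Gauss (x - refl_pt y) t) \<partial>mu)
      = (\<integral>\<^sup>+y. ennreal (Gker x y t) + ennreal (Gauss (x - refl_pt y) t) \<partial>mu)"
    by (rule nn_integral_add[symmetric]) measurable
  also have "\<dots> = (\<integral>\<^sup>+y. ennreal (Gauss (x - y) t) + Kn (x - refl_pt y) t \<partial>mu)"
  proof (rule nn_integral_cong_AE)
    show "AE y in mu. ennreal (Gker x y t) + ennreal (Gauss (x - refl_pt y) t) = ennreal (Gauss (x - y) t) + Kn (x - refl_pt y) t"
      using AE_mu_closure
    proof eventually_elim
      case (elim y)
      have w: "0 \<le> (x - refl_pt y) $ lastc" using elim z by (simp add: closure_Omega)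
      have "ennreal (Gker x y t) + ennreal (Gauss (x - refl_pt y) t) = ennreal (Gauss (x - y) t + Kker (x - refl_pt y) t)"
        using Gker_nonneg[OF x elim t] by (simp add: Gker_eq flip: ennreal_plus)
      then show ?case
        using Kker_eq_Kn[OF w t] by simp
    qed
  qed
  also have "\<dots> = (\<integral>\<^sup>+y. ennreal (Gauss (x - y) t) \<partial>mu) + (\<integral>\<^sup>+y. Kn (x - refl_pt y) t \<partial>mu)"
    by (rule nn_integral_add) measurable
  also have "\<dots> = ennreal (Psi (- ?z / sqrt t) + gss ?z t) + ennreal (2 * Psi (?z / sqrt t))"
    by (simp only: nn_integral_Gauss_mu[OF t] nn_integral_Kn_mu[OF z t])
  also have "\<dots> = ennreal (1 + (Psi (?z / sqrt t) + gss ?z t))"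
    using Psi_minus[of "?z / sqrt t"] Psi_bounds t by (simp flip: ennreal_plus)
  also have "\<dots> = 1 + ennreal (Psi (?z / sqrt t) + gss ?z t)"
    using Psi_bounds t by (simp add: add_nonneg_nonneg)
  also have "(\<integral>\<^sup>+y. ennreal (Gauss (x - refl_pt y) t) \<partial>mu) = ennreal (Psi (?z / sqrt t) + gss ?z t)"
    using nn_integral_Gauss_mu(2)[OF t, of x 0] by simp
  finally show ?thesis
    by (simp add: ennreal_add_left_cancel add.commute[of _ "ennreal (Psi (?z / sqrt t) + gss ?z t)"])
qed

section \<open>First moment of the kernel\<close>

lemma Gauss_double:
  fixes v :: "real ^ 'n::finite"
  assumes "0 < s"
  shows "Gauss v s = 2 powr (real CARD('n) / 2) * exp (- ((norm v)\<^sup>2 / (8 * s))) * Gauss v (2 * s)"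
proof -
  have "(4 * pi * (2 * s)) powr (- (real CARD('n) / 2)) = 2 powr (- (real CARD('n) / 2)) * (4 * pi * s) powr (- (real CARD('n) / 2))"
    by (subst powr_mult[symmetric]) (simp add: mult_ac)
  moreover have "exp (- ((norm v)\<^sup>2 / (4 * s))) = exp (- ((norm v)\<^sup>2 / (8 * s))) * exp (- ((norm v)\<^sup>2 / (4 * (2 * s))))"
    by (simp add: exp_add[symmetric])
  ultimately show ?thesis
    by (simp add: Gauss_def powr_minus_divide)
qed

text \<open>Doubling the time frees a factor exp (-u) with u = |v|^2 / (8 s), and 1 + u <= exp u
  lets it absorb the polynomial weight.\<close>

lemma norm_mult_Gauss_le:
  fixes v :: "real ^ 'n::finite"
  assumes "0 < s"
  shows "norm v * Gauss v s \<le> 2 * sqrt s * 2 powr (real CARD('n) / 2) * Gauss v (2 * s)"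
    and "(norm v)\<^sup>2 / s * Gauss v s \<le> 8 * 2 powr (real CARD('n) / 2) * Gauss v (2 * s)"
proof -
  define u where "u = (norm v)\<^sup>2 / (8 * s)"
  have u: "1 + u \<le> exp u" by (rule exp_ge_add_one_self)
  have 0: "0 \<le> u" using assms by (simp add: u_def)
  have "norm v \<le> 2 * sqrt s * (1 + u)"
  proof -
    define r where "r = sqrt s"
    have r: "0 < r" "s = r\<^sup>2" using assms by (auto simp: r_def)
    have "0 \<le> (norm v - 2 * r)\<^sup>2" by simp
    then have "4 * r * norm v \<le> (norm v)\<^sup>2 + 4 * r\<^sup>2" by (simp add: power2_eq_square algebra_simps)
    also have "\<dots> \<le> (norm v)\<^sup>2 + 8 * r\<^sup>2" by simp
    also have "\<dots> = 4 * r * (2 * r * (1 + u))" using r by (simp add: u_def power2_eq_square field_simps)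
    finally have "norm v \<le> 2 * r * (1 + u)" using r(1) by (subst (asm) mult_le_cancel_left_pos) auto
    then show ?thesis unfolding r_def .
  qed
  also have "\<dots> \<le> 2 * sqrt s * exp u" using u assms by (intro mult_left_mono) auto
  finally have n: "norm v * exp (- u) \<le> 2 * sqrt s" by (simp add: exp_minus field_simps)
  have "(norm v)\<^sup>2 / s = 8 * u" using assms by (simp add: u_def)
  also have "\<dots> \<le> 8 * exp u" using u by linarith
  finally have "(norm v)\<^sup>2 / s * exp (- u) \<le> 8 * exp u * exp (- u)" by (rule mult_right_mono) simp
  also have "\<dots> = 8" by (simp add: exp_minus)
  finally have n2: "(norm v)\<^sup>2 / s * exp (- u) \<le> 8" .
  have G: "Gauss v s = exp (- u) * (2 powr (real CARD('n) / 2) * Gauss v (2 * s))"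
    using Gauss_double[OF assms, of v] by (simp add: u_def)
  show "norm v * Gauss v s \<le> 2 * sqrt s * 2 powr (real CARD('n) / 2) * Gauss v (2 * s)"
    using mult_right_mono[OF n, of "2 powr (real CARD('n) / 2) * Gauss v (2 * s)"] by (simp add: G mult_ac)
  show "(norm v)\<^sup>2 / s * Gauss v s \<le> 8 * 2 powr (real CARD('n) / 2) * Gauss v (2 * s)"
    using mult_right_mono[OF n2, of "2 powr (real CARD('n) / 2) * Gauss v (2 * s)"] by (simp add: G mult_ac)
qed

text \<open>Both the height w_N + \<tau> and |w| are at most the length of v = w + \<tau> eN, so the
  weighted flux is at most |v|^2 / s times a Gaussian.\<close>

lemma flux_mult_norm_le:
  fixes w :: "real ^ 'n::{finite,linorder}"
  assumes "0 \<le> w $ lastc" "0 < \<tau>" "\<tau> < t"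
  shows "flux w t \<tau> * norm w \<le> 8 * 2 powr (real CARD('n) / 2) * Gauss (w + \<tau> *\<^sub>R eN) (2 * (t - \<tau>))"
proof -
  let ?v = "w + \<tau> *\<^sub>R eN"
  have a: "w $ lastc + \<tau> \<le> norm ?v" using norm_shift_ge[of w \<tau>] by linarith
  have "(norm ?v)\<^sup>2 = (norm w)\<^sup>2 + 2 * \<tau> * w $ lastc + \<tau>\<^sup>2"
    by (simp add: norm_add_eN_sq)
  then have "(norm w)\<^sup>2 \<le> (norm ?v)\<^sup>2" using assms by simp
  then have w: "norm w \<le> norm ?v" by simp
  have "flux w t \<tau> * norm w = ((w $ lastc + \<tau>) * norm w) * (Gauss ?v (t - \<tau>) / (t - \<tau>))"
    by (simp add: flux_def)
  also have "\<dots> \<le> (norm ?v * norm ?v) * (Gauss ?v (t - \<tau>) / (t - \<tau>))"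
    using a w assms by (intro mult_right_mono mult_mono) auto
  also have "\<dots> = (norm ?v)\<^sup>2 / (t - \<tau>) * Gauss ?v (t - \<tau>)" by (simp add: power2_eq_square)
  also have "\<dots> \<le> 8 * 2 powr (real CARD('n) / 2) * Gauss ?v (2 * (t - \<tau>))"
    using assms by (intro norm_mult_Gauss_le) auto
  finally show ?thesis .
qed

text \<open>The direct Gaussian contributes 2 sqrt t. In the flux part the moment is at most 8 (1 +
  1 / sqrt (t - \<tau>)) for each \<tau>, which integrates to 8 t + 16 sqrt t; all of this up to the
  factor 2^(N/2).\<close>

lemma nn_integral_Gker_norm_le:
  fixes x :: "real ^ 'n::{finite,linorder}"
  assumes x: "x \<in> closure Omega" and t: "0 < t"
  shows "(\<integral>\<^sup>+y. ennreal (Gker x y t) * ennreal (norm (x - y)) \<partial>mu)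
    \<le> ennreal (2 powr (real CARD('n) / 2) * (18 * sqrt t + 8 * t))"
proof -
  let ?K = "2 powr (real CARD('n) / 2)"
  have z: "0 \<le> x $ lastc" using x by (simp add: closure_Omega)
  have "(\<integral>\<^sup>+y. ennreal (Gker x y t) * ennreal (norm (x - y)) \<partial>mu)
    \<le> (\<integral>\<^sup>+y. indicator Omega y * ennreal (norm (x - y) * Gauss (x - y) t) + Kn (x - refl_pt y) t * ennreal (norm (x - refl_pt y)) \<partial>mu)"
  proof (rule nn_integral_mono_AE)
    show "AE y in mu. ennreal (Gker x y t) * ennreal (norm (x - y))
      \<le> indicator Omega y * ennreal (norm (x - y) * Gauss (x - y) t) + Kn (x - refl_pt y) t * ennreal (norm (x - refl_pt y))"
      using AE_mu_closure
    proof eventually_elim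
      case (elim y)
      have w: "0 \<le> (x - refl_pt y) $ lastc" using elim z by (simp add: closure_Omega)
      note K = Kker_eq_Kn[OF w t]
      have n: "norm (x - y) \<le> norm (x - refl_pt y)"
      proof -
        have "(norm (x - y))\<^sup>2 \<le> (norm (x - refl_pt y))\<^sup>2"
          using elim x by (simp add: norm_diff_refl_pt_sq closure_Omega)
        then show ?thesis by simp
      qed
      \<comment> \<open>For y on the boundary the two Gaussians cancel. This is essential: the
        boundary moment of the direct Gaussian alone can be of order one, since its boundary mass
        can be of order 1 / sqrt t, and would not vanish as t tends to 0.\<close>
      have "Gker x y t \<le> indicator Omega y * Gauss (x - y) t + Kker (x - refl_pt y) t"
      proof (cases "y \<in> Omega")
        case True
        then show ?thesis by (simp add: Gker_eq)
      next
        case False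
        then have "y $ lastc = 0" using elim by (auto simp: closure_Omega Omega_def)
        then have "refl_pt y = y" by (simp add: refl_pt_eq)
        then show ?thesis using False by (simp add: Gker_eq)
      qed
      then have "Gker x y t * norm (x - y) \<le> (indicator Omega y * Gauss (x - y) t + Kker (x - refl_pt y) t) * norm (x - y)"
        by (intro mult_right_mono) auto
      also have "\<dots> \<le> indicator Omega y * (norm (x - y) * Gauss (x - y) t) + Kker (x - refl_pt y) t * norm (x - refl_pt y)"
        using mult_left_mono[OF n K(2)] by (simp add: algebra_simps)
      finally have "ennreal (Gker x y t * norm (x - y)) \<le> ennreal (indicator Omega y * (norm (x - y) * Gauss (x - y) t) + Kker (x - refl_pt y) t * norm (x - refl_pt y))"
        by (rule ennreal_leI)
      also have "ennreal (indicator Omega y * (norm (x - y) * Gauss (x - y) t) + Kker (x - refl_pt y) t * norm (x - refl_pt y))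
         = indicator Omega y * ennreal (norm (x - y) * Gauss (x - y) t) + Kn (x - refl_pt y) t * ennreal (norm (x - refl_pt y))"
        by (cases "y \<in> Omega") (simp_all add: K(1)[symmetric] K(2) ennreal_plus ennreal_mult'')
      finally show ?case by (simp add: ennreal_mult'')
    qed
  qed
  also have "\<dots> = (\<integral>\<^sup>+y. indicator Omega y * ennreal (norm (x - y) * Gauss (x - y) t) \<partial>mu) + (\<integral>\<^sup>+y. Kn (x - refl_pt y) t * ennreal (norm (x - refl_pt y)) \<partial>mu)"
    by (rule nn_integral_add) measurable
  also have "(\<integral>\<^sup>+y. indicator Omega y * ennreal (norm (x - y) * Gauss (x - y) t) \<partial>mu) \<le> ennreal (?K * (2 * sqrt t))"
  proof -
    have "(\<integral>\<^sup>+y. indicator Omega y * ennreal (norm (x - y) * Gauss (x - y) t) \<partial>bdry) = (\<integral>\<^sup>+y. 0 \<partial>(bdry :: ((real, 'n) vec) measure))"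
      using AE_bdry by (intro nn_integral_cong_AE) (auto elim!: eventually_mono simp: Omega_def)
    then have "(\<integral>\<^sup>+y. indicator Omega y * ennreal (norm (x - y) * Gauss (x - y) t) \<partial>mu)
      = (\<integral>\<^sup>+y. indicator Omega y * (indicator Omega y * ennreal (norm (x - y) * Gauss (x - y) t)) \<partial>lborel)"
      by (simp add: nn_integral_mu)
    also have "\<dots> \<le> (\<integral>\<^sup>+y. ennreal (?K * (2 * sqrt t)) * ennreal (Gauss (x - y) (2 * t)) \<partial>lborel)"
    proof (rule nn_integral_mono)
      fix y
      have "ennreal (norm (x - y) * Gauss (x - y) t) \<le> ennreal (?K * (2 * sqrt t) * Gauss (x - y) (2 * t))"
        using norm_mult_Gauss_le(1)[OF t, of "x - y"] by (intro ennreal_leI) (simp add: mult_ac)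
      then show "indicator Omega y * (indicator Omega y * ennreal (norm (x - y) * Gauss (x - y) t)) \<le> ennreal (?K * (2 * sqrt t)) * ennreal (Gauss (x - y) (2 * t))"
        using t by (auto simp: indicator_def ennreal_mult)
    qed
    also have "\<dots> = ennreal (?K * (2 * sqrt t))"
      using t by (simp add: nn_integral_cmult nn_integral_Gauss_lborel)
    finally show ?thesis .
  qed
  also have "(\<integral>\<^sup>+y. Kn (x - refl_pt y) t * ennreal (norm (x - refl_pt y)) \<partial>mu) \<le> ennreal (?K * 8 * (t + 2 * sqrt t))"
  proof -
    have "(\<integral>\<^sup>+y. Kn (x - refl_pt y) t * ennreal (norm (x - refl_pt y)) \<partial>mu)
      = (\<integral>\<^sup>+\<tau>\<in>{0<..<t}. (\<integral>\<^sup>+y. ennreal (flux (x - refl_pt y) t \<tau>) * ennreal (norm (x - refl_pt y)) \<partial>mu) \<partial>lborel)"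
      by (rule nn_integral_Kn_swap) measurable
    also have "\<dots> \<le> (\<integral>\<^sup>+\<tau>. ennreal (?K * 8) * (indicator {0<..<t} \<tau> + ennreal (1 / sqrt (t - \<tau>)) * indicator {0<..<t} \<tau>) \<partial>lborel)"
    proof (rule nn_integral_mono)
      fix \<tau> :: real
      show "(\<integral>\<^sup>+y. ennreal (flux (x - refl_pt y) t \<tau>) * ennreal (norm (x - refl_pt y)) \<partial>mu) * indicator {0<..<t} \<tau>
        \<le> ennreal (?K * 8) * (indicator {0<..<t} \<tau> + ennreal (1 / sqrt (t - \<tau>)) * indicator {0<..<t} \<tau>)"
      proof (cases "\<tau> \<in> {0<..<t}")
        case True
        define s where "s = t - \<tau>"
        have s: "0 < s" using True by (simp add: s_def)
        have "(\<integral>\<^sup>+y. ennreal (flux (x - refl_pt y) t \<tau>) * ennreal (norm (x - refl_pt y)) \<partial>mu)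
          \<le> (\<integral>\<^sup>+y. ennreal (?K * 8) * ennreal (Gauss (x - refl_pt y + \<tau> *\<^sub>R eN) (2 * s)) \<partial>mu)"
        proof (rule nn_integral_mono_AE)
          show "AE y in mu. ennreal (flux (x - refl_pt y) t \<tau>) * ennreal (norm (x - refl_pt y))
            \<le> ennreal (?K * 8) * ennreal (Gauss (x - refl_pt y + \<tau> *\<^sub>R eN) (2 * s))"
            using AE_mu_closure
          proof eventually_elim
            case (elim y)
            have w: "0 \<le> (x - refl_pt y) $ lastc" using elim z by (simp add: closure_Omega)
            have "ennreal (flux (x - refl_pt y) t \<tau> * norm (x - refl_pt y)) \<le> ennreal (?K * 8 * Gauss (x - refl_pt y + \<tau> *\<^sub>R eN) (2 * s))"
              using flux_mult_norm_le[OF w, of \<tau> t] True by (intro ennreal_leI) (simp add: s_def mult_ac)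
            then show ?case by (simp add: ennreal_mult'')
          qed
        qed
        also have "\<dots> = ennreal (?K * 8) * ennreal (Psi ((x $ lastc + \<tau>) / sqrt (2 * s)) + gss (x $ lastc + \<tau>) (2 * s))"
          using s by (simp add: nn_integral_cmult nn_integral_Gauss_mu)
        also have "\<dots> \<le> ennreal (?K * 8) * ennreal (1 + 1 / sqrt s)"
        proof (intro mult_left_mono ennreal_leI add_mono Psi_bounds)
          have "gss (x $ lastc + \<tau>) (2 * s) \<le> 1 / sqrt (4 * pi * (2 * s))" using s by (intro gss_upper) auto
          also have "\<dots> \<le> 1 / sqrt s"
          proof -
            have "s \<le> 4 * pi * (2 * s)" using pi_ge_two s by simp
            then show ?thesis using s by (intro divide_left_mono) auto
          qed
          finally show "gss (x $ lastc + \<tau>) (2 * s) \<le> 1 / sqrt s" .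
        qed simp
        finally show ?thesis using True s by (simp add: s_def ennreal_plus)
      qed simp
    qed
    also have "\<dots> = ennreal (?K * 8) * (ennreal t + ennreal (2 * sqrt t))"
      using t by (simp add: nn_integral_cmult nn_integral_add nn_integral_inverse_sqrt)
    also have "\<dots> = ennreal (?K * 8 * (t + 2 * sqrt t))"
      using t by (simp add: ennreal_mult ennreal_plus)
    finally show ?thesis .
  qed
  finally have "(\<integral>\<^sup>+y. ennreal (Gker x y t) * ennreal (norm (x - y)) \<partial>mu) \<le> ennreal (?K * (2 * sqrt t)) + ennreal (?K * 8 * (t + 2 * sqrt t))"
    by (simp add: add_mono)
  also have "\<dots> = ennreal (?K * (18 * sqrt t + 8 * t))"
    using t by (subst ennreal_plus[symmetric]) (auto simp: algebra_simps)
  finally show ?thesis .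
qed

section \<open>Lower bound for times at least one\<close>

text \<open>The power of 2 compares 4 pi t with 2 pi t, and exp (-1) pays for the shift, as \<tau>^2
  <= t. The 64 combines the bound 1 / (8 sqrt t) on the factor in front of the Gaussian with the
  window length sqrt t / 8.\<close>

definition lower_const :: "nat \<Rightarrow> real" where
  "lower_const N = 2 powr (- (real N / 2)) * exp (- 1) / 64"

lemma flux_lower:
  fixes w :: "real ^ 'n::{finite,linorder}"
  assumes "0 \<le> w $ lastc" "1 \<le> t" "sqrt t / 8 < \<tau>" "\<tau> < sqrt t / 4"
  shows "8 / sqrt t * lower_const CARD('n) * Gauss w (t / 2) \<le> flux w t \<tau>"
proof -
  let ?N = "real CARD('n)"
  define r where "r = sqrt t"
  have r: "1 \<le> r" "t = r\<^sup>2" using assms(2) by (auto simp: r_def)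
  have \<tau>: "r / 8 < \<tau>" "\<tau> < r / 4" using assms by (auto simp: r_def)
  have rt: "r \<le> t" using r by (simp add: power2_eq_square)
  define s where "s = t - \<tau>"
  have tpos: "0 < t" using assms by simp
  have "3 / 4 * t \<le> s" "s \<le> t" using \<tau> rt r(1) unfolding s_def by linarith+
  moreover have "0 < s" using \<tau> rt r(1) unfolding s_def by linarith
  ultimately have s: "3 / 4 * t \<le> s" "s \<le> t" "0 < s" by blast+
  let ?v = "w + \<tau> *\<^sub>R eN"
  have \<tau>2: "\<tau>\<^sup>2 \<le> t"
  proof -
    have "\<tau>\<^sup>2 \<le> r\<^sup>2" using \<tau> r by (intro power_mono) auto
    then show ?thesis by (simp add: r)
  qed
  \<comment> \<open>The weights are chosen for the division by 4 s >= 3 t: 3 / 2 becomes 1 / (2 t),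
    the exponent of the Gaussian at time t / 2, and 3 \<tau>^2 becomes \<tau>^2 / t.\<close>
  have nv: "(norm ?v)\<^sup>2 \<le> 3 / 2 * (norm w)\<^sup>2 + 3 * \<tau>\<^sup>2"
  proof -
    have "norm ?v \<le> norm w + \<tau>" using norm_triangle_ineq[of w "\<tau> *\<^sub>R eN"] \<tau> r by simp
    then have "(norm ?v)\<^sup>2 \<le> (norm w + \<tau>)\<^sup>2" by (intro power_mono) auto
    also have "\<dots> \<le> 3 / 2 * (norm w)\<^sup>2 + 3 * \<tau>\<^sup>2"
      using zero_le_power2[of "norm w - 2 * \<tau>"] by (simp add: power2_eq_square algebra_simps)
    finally show ?thesis .
  qed
  have "(norm ?v)\<^sup>2 / (4 * s) \<le> (3 / 2 * (norm w)\<^sup>2 + 3 * \<tau>\<^sup>2) / (3 * t)"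
    using nv s tpos by (intro frac_le) auto
  also have "\<dots> = (norm w)\<^sup>2 / (2 * t) + \<tau>\<^sup>2 / t" using tpos by (simp add: field_simps)
  also have "\<dots> \<le> (norm w)\<^sup>2 / (2 * t) + 1" using \<tau>2 tpos by simp
  finally have e: "exp (- 1) * exp (- ((norm w)\<^sup>2 / (2 * t))) \<le> exp (- ((norm ?v)\<^sup>2 / (4 * s)))"
    by (simp add: exp_add[symmetric])
  have p: "2 powr (- (?N / 2)) * (2 * pi * t) powr (- (?N / 2)) \<le> (4 * pi * s) powr (- (?N / 2))"
  proof -
    have "2 powr (- (?N / 2)) * (2 * pi * t) powr (- (?N / 2)) = (4 * pi * t) powr (- (?N / 2))"
      by (subst powr_mult[symmetric]) (simp add: mult.assoc)
    also have "\<dots> \<le> (4 * pi * s) powr (- (?N / 2))"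
      using s by (intro powr_mono2') auto
    finally show ?thesis .
  qed
  have "1 / (8 * r) \<le> (w $ lastc + \<tau>) / s"
  proof -
    have "1 / (8 * r) = (r / 8) / t" using r by (simp add: power2_eq_square)
    also have "\<dots> \<le> (w $ lastc + \<tau>) / s" using \<tau> s(2,3) assms(1) r(1) by (intro frac_le) auto
    finally show ?thesis .
  qed
  then have "1 / (8 * r) * ((2 powr (- (?N / 2)) * (2 * pi * t) powr (- (?N / 2))) * (exp (- 1) * exp (- ((norm w)\<^sup>2 / (2 * t)))))
    \<le> (w $ lastc + \<tau>) / s * ((4 * pi * s) powr (- (?N / 2)) * exp (- ((norm ?v)\<^sup>2 / (4 * s))))"
    using r by (intro mult_mono p e) (auto intro: order_trans[rotated])
  then show ?thesis
    by (simp add: flux_def s_def[symmetric] r_def[symmetric] Gauss_def lower_const_def mult_ac)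
qed

lemma Kn_lower:
  fixes w :: "real ^ 'n::{finite,linorder}"
  assumes "0 \<le> w $ lastc" "1 \<le> t"
  shows "ennreal (lower_const CARD('n) * Gauss w (t / 2)) \<le> Kn w t"
proof -
  let ?r = "sqrt t"
  let ?c = "8 / ?r * lower_const CARD('n) * Gauss w (t / 2)"
  have r1: "1 \<le> ?r" using assms by simp
  \<comment> \<open>From t >= 1 follows sqrt t <= t, which places the window of \<tau> inside the
    interval from 0 to t.\<close>
  have "?r * 1 \<le> ?r * ?r" using r1 by (intro mult_left_mono) auto
  then have r: "1 \<le> ?r" "?r \<le> t" using r1 assms by auto
  have "ennreal (lower_const CARD('n) * Gauss w (t / 2)) = ennreal ?c * ennreal (?r / 8)"
    using r by (subst ennreal_mult[symmetric]) (auto simp: lower_const_def)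
  also have "\<dots> = (\<integral>\<^sup>+\<tau>. ennreal ?c * indicator {?r / 8<..<?r / 4} \<tau> \<partial>lborel)"
    using r by (simp add: nn_integral_cmult_indicator)
  also have "\<dots> \<le> Kn w t"
    unfolding Kn_def
  proof (rule nn_integral_mono)
    fix \<tau>
    show "ennreal ?c * indicator {?r / 8<..<?r / 4} \<tau> \<le> ennreal (flux w t \<tau>) * indicator {0<..<t} \<tau>"
      using flux_lower[OF assms, of \<tau>] r by (auto simp: indicator_def intro!: ennreal_leI)
  qed
  finally show ?thesis .
qed

lemma Gker_lower:
  fixes x y :: "real ^ 'n::{finite,linorder}"
  assumes "x \<in> closure Omega" "y \<in> closure Omega" "1 \<le> t"
  shows "lower_const CARD('n) * Gauss (x - refl_pt y) (t / 2) \<le> Gker x y t"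
proof -
  have w: "0 \<le> (x - refl_pt y) $ lastc" using assms by (simp add: closure_Omega)
  have "ennreal (lower_const CARD('n) * Gauss (x - refl_pt y) (t / 2)) \<le> ennreal (Kker (x - refl_pt y) t)"
    using Kn_lower[OF w assms(3)] Kker_eq_Kn[OF w, of t] assms(3) by simp
  then have "lower_const CARD('n) * Gauss (x - refl_pt y) (t / 2) \<le> Kker (x - refl_pt y) t"
    using Kker_eq_Kn(2)[OF w, of t] assms(3) by simp
  then show ?thesis using Gker_ge_Kker[OF assms(1,2), of t] assms(3) by simp
qed

section \<open>Smoothness of the evolution and the dynamical boundary condition\<close>

text \<open>Agrees with the reflection on the closed half space, but maps every point to the closed lower
  half space, so that no pole enters the domain for any \<open>y\<close>, not only for almost every one.\<close>

definition fold_pt :: "real ^ 'n::{finite,linorder} \<Rightarrow> real ^ 'n::{finite,linorder}" where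
  "fold_pt y = y - (y $ lastc + \<bar>y $ lastc\<bar>) *\<^sub>R eN"

lemma fold_pt_closure: "y \<in> closure Omega \<Longrightarrow> fold_pt y = refl_pt y"
  by (simp add: fold_pt_def refl_pt_eq closure_Omega)

lemma fold_pt_lastc [simp]: "fold_pt y $ lastc = - \<bar>y $ lastc\<bar>"
  by (simp add: fold_pt_def)

lemma borel_measurable_fold_pt [measurable (raw)]:
  fixes f :: "'a \<Rightarrow> real ^ 'n::{finite,linorder}"
  assumes [measurable]: "f \<in> borel_measurable M"
  shows "(\<lambda>x. fold_pt (f x)) \<in> borel_measurable M"
  unfolding fold_pt_def by measurable

text \<open>The poles of the third term are the points (fold_pt y - \<tau> eN, \<tau>), where x_N +
  t equals -|y_N| <= 0; the second inequality keeps them outside.\<close>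

definition Ubd :: "((real ^ 'n::{finite,linorder}) \<times> real) set" where
  "Ubd = {p. 0 < snd p \<and> 0 < fst p $ lastc + snd p}"

lemma open_Ubd: "open Ubd"
  unfolding Ubd_def by (intro open_Collect_conj open_Collect_less continuous_intros)

lemma closure_times_subset_Ubd: "closure Omega \<times> {0<..} \<subseteq> Ubd"
  by (auto simp: Ubd_def closure_Omega)

lemma dist_pair_components:
  fixes x :: "real ^ 'n::finite"
  assumes "(x, t) \<in> ball (x0, t0) r"
  shows "\<bar>x $ i - x0 $ i\<bar> < r" "\<bar>t - t0\<bar> < r"
proof -
  have "norm (x0 - x, t0 - t) < r" using assms by (simp add: dist_norm)
  moreover have "\<bar>x $ i - x0 $ i\<bar> \<le> norm (x0 - x)"
    using component_le_norm_cart[of "x0 - x" i] by simp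
  ultimately show "\<bar>x $ i - x0 $ i\<bar> < r" "\<bar>t - t0\<bar> < r"
    using norm_fst_le[of "x0 - x" "t0 - t"] norm_snd_le[of "t0 - t" "x0 - x"] by auto
qed

lemma separated_time_zero:
  fixes a :: "'y \<Rightarrow> real ^ 'n::{finite,linorder}"
  assumes "p \<in> Ubd"
  shows "\<exists>r>0. \<exists>\<delta>>0. \<forall>x t y. (x, t) \<in> ball p r \<longrightarrow> y \<in> Y \<longrightarrow> \<delta> \<le> norm (x - a y) + \<bar>t - 0\<bar>"
proof -
  obtain x0 t0 where p: "p = (x0, t0)" by (cases p)
  have t0: "0 < t0" using assms by (simp add: Ubd_def p)
  have "t0 / 2 \<le> norm (x - a y) + \<bar>t - 0\<bar>" if "(x, t) \<in> ball (x0, t0) (t0 / 2)" for x y t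
  proof -
    have "t0 / 2 < t" using dist_pair_components(2)[OF that] by linarith
    moreover have "t \<le> \<bar>t - 0\<bar>" by simp
    ultimately show ?thesis using norm_ge_zero[of "x - a y"] by linarith
  qed
  then show ?thesis using t0 unfolding p by (intro exI[of _ "t0 / 2"] conjI allI impI) auto
qed

section \<open>The three superpositions that make up the evolution\<close>

text \<open>Integrability against Gaussians is common to all L^q data, q finite or infinite, so
  smoothness and both equations are proved once for all exponents.\<close>

locale datum =
  fixes \<phi> :: "real ^ 'n::{finite,linorder} \<Rightarrow> real"
  assumes borel_phi [measurable]: "\<phi> \<in> borel_measurable borel"
    and gauss_phi: "\<And>c x. 0 < c \<Longrightarrow> integrable mu (\<lambda>y. exp (- (c * (norm (x - y))\<^sup>2)) * \<phi> y)"
begin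

lemma gauss_phi_fold:
  assumes "0 < c"
  shows "integrable mu (\<lambda>y. exp (- (c * (norm (x - fold_pt y))\<^sup>2)) * \<phi> y)"
proof -
  have "integrable mu (\<lambda>y. exp (- (c * (norm (refl_pt x - y))\<^sup>2)) * \<phi> y)" by (rule gauss_phi[OF assms])
  moreover have "AE y in mu. exp (- (c * (norm (refl_pt x - y))\<^sup>2)) * \<phi> y = exp (- (c * (norm (x - fold_pt y))\<^sup>2)) * \<phi> y"
    using AE_mu_closure
  proof eventually_elim
    case (elim y)
    have "norm (refl_pt x - y) = norm (x - refl_pt y)"
      using norm_shift_commute[of x y 0] by (simp add: norm_minus_commute)
    then show ?case using fold_pt_closure[OF elim] by simp
  qed
  ultimately show ?thesis
    by (subst (asm) integrable_cong_AE) auto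
qed

sublocale S1: superposition mu "\<lambda>y. y" "\<lambda>_. 0" \<phi> Ubd
proof
  show "\<exists>r>0. \<exists>\<delta>>0. \<forall>x t y. (x, t) \<in> ball p r \<longrightarrow> y \<in> space mu \<longrightarrow> \<delta> \<le> norm (x - y) + \<bar>t - 0\<bar>"
    if "p \<in> Ubd" for p :: "((real, 'n) vec) \<times> real"
    using that by (rule separated_time_zero)
  show "integrable mu (\<lambda>y. exp (- (c * (norm (x - y))\<^sup>2)) * indicator {..T} (0::real) * \<phi> y)"
    if "0 < c" for c T :: real and x
    using integrable_mult_right[OF gauss_phi[OF that, of x], of "indicator {..T} (0::real)"] by (simp add: mult_ac)
qed (auto simp: open_Ubd)

sublocale S2: superposition mu fold_pt "\<lambda>_. 0" \<phi> Ubd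
proof
  show "\<exists>r>0. \<exists>\<delta>>0. \<forall>x t y. (x, t) \<in> ball p r \<longrightarrow> y \<in> space mu \<longrightarrow> \<delta> \<le> norm (x - fold_pt y) + \<bar>t - 0\<bar>"
    if "p \<in> Ubd" for p :: "((real, 'n) vec) \<times> real"
    using that by (rule separated_time_zero)
  show "integrable mu (\<lambda>y. exp (- (c * (norm (x - fold_pt y))\<^sup>2)) * indicator {..T} (0::real) * \<phi> y)"
    if "0 < c" for c T :: real and x
    using integrable_mult_right[OF gauss_phi_fold[OF that, of x], of "indicator {..T} (0::real)"] by (simp add: mult_ac)
qed (auto simp: open_Ubd)

text \<open>Poles of the third term, indexed by the pair of y and \<tau>. The absolute value makes
  their times nonnegative on the whole product space, as \<open>superposition\<close> demands, and
  \<open>psi3\<close> discards negative \<tau>.\<close>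

definition a3 :: "(real ^ 'n::{finite,linorder}) \<times> real \<Rightarrow> real ^ 'n::{finite,linorder}" where
  "a3 z = fold_pt (fst z) - \<bar>snd z\<bar> *\<^sub>R eN"

definition psi3 :: "(real ^ 'n::{finite,linorder}) \<times> real \<Rightarrow> real" where
  "psi3 z = indicator {0..} (snd z) * \<phi> (fst z)"

lemma meas3 [measurable]: "a3 \<in> borel_measurable (mu \<Otimes>\<^sub>M lborel)" "psi3 \<in> borel_measurable (mu \<Otimes>\<^sub>M lborel)"
  unfolding a3_def[abs_def] psi3_def[abs_def] by measurable

lemma abs_snd: "(\<lambda>z. \<bar>snd z\<bar>) \<in> borel_measurable ((mu :: (real ^ 'n::{finite,linorder}) measure) \<Otimes>\<^sub>M (lborel :: real measure))"
  by (rule measurable_compose[OF measurable_snd, where g = "\<lambda>x. \<bar>x\<bar>"]) measurable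

sublocale S3: superposition "mu \<Otimes>\<^sub>M lborel" a3 "\<lambda>z. \<bar>snd z\<bar>" psi3 Ubd
proof
  show "\<exists>r>0. \<exists>\<delta>>0. \<forall>x t z. (x, t) \<in> ball p r \<longrightarrow> z \<in> space (mu \<Otimes>\<^sub>M lborel) \<longrightarrow> \<delta> \<le> norm (x - a3 z) + \<bar>t - \<bar>snd z\<bar>\<bar>"
    if p: "p \<in> Ubd" for p :: "((real, 'n) vec) \<times> real"
  proof -
    obtain x0 t0 where pe: "p = (x0, t0)" by (cases p)
    define d where "d = (x0 $ lastc + t0) / 2"
    have d: "0 < d" using p by (simp add: Ubd_def pe d_def)
    have "d \<le> norm (x - a3 z) + \<bar>t - \<bar>snd z\<bar>\<bar>" if "(x, t) \<in> ball (x0, t0) (d / 2)" for x z t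
    proof -
      \<comment> \<open>The last coordinate of x minus the pole is at least x_N + \<tau>, and the
        time difference is at least t - \<tau>. In the sum \<tau> cancels and leaves x_N + t, which
        is bounded below near p.\<close>
      have "x $ lastc + \<bar>fst z $ lastc\<bar> + \<bar>snd z\<bar> = (x - a3 z) $ lastc" by (simp add: a3_def)
      also have "\<dots> \<le> norm (x - a3 z)" using component_le_norm_cart[of "x - a3 z" lastc] by linarith
      finally have "x $ lastc + \<bar>snd z\<bar> \<le> norm (x - a3 z)" by linarith
      moreover have "x0 $ lastc + t0 - d \<le> x $ lastc + t"
        using dist_pair_components(1)[OF that, of lastc] dist_pair_components(2)[OF that] by linarith
      moreover have "2 * d = x0 $ lastc + t0" by (simp add: d_def)
      ultimately show ?thesis by linarith
    qed
    then show ?thesis using d unfolding pe by (intro exI[of _ "d / 2"] conjI exI[of _ d]) auto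
  qed
  fix c T :: real and x :: "(real, 'n) vec" assume c: "0 < c"
  \<comment> \<open>Halving the rate pays for the shift: |v|^2 <= 2 |v + \<tau> eN|^2 + 2 \<tau>^2,
    and \<tau> <= T wherever the integrand is not zero, at the price of exp (c T^2).\<close>
  let ?g = "\<lambda>y. exp (- (c / 2 * (norm (x - fold_pt y))\<^sup>2)) * \<phi> y"
  have g: "integrable mu ?g" using c by (intro gauss_phi_fold) auto
  have gi: "integrable (mu \<Otimes>\<^sub>M lborel) (\<lambda>z. exp (c * T\<^sup>2) * (?g (fst z) * indicator {0..T} (snd z)))"
  proof (intro integrable_mult_right mu_lborel.Fubini_integrable)
    show "(\<lambda>z. ?g (fst z) * indicator {0..T} (snd z)) \<in> borel_measurable (mu \<Otimes>\<^sub>M lborel)" by measurable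
    show "integrable mu (\<lambda>y. \<integral>\<tau>. norm (?g (fst (y, \<tau>)) * indicator {0..T} (snd (y, \<tau>))) \<partial>lborel)"
      using integrable_norm[OF g] by (simp add: abs_mult)
    show "AE y in mu. integrable lborel (\<lambda>\<tau>. ?g (fst (y, \<tau>)) * indicator {0..T} (snd (y, \<tau>)))"
      by (auto intro!: AE_I2 integrable_mult_right simp: integrable_indicator_iff emeasure_lborel_Icc_eq)
  qed
  show "integrable (mu \<Otimes>\<^sub>M lborel) (\<lambda>z. exp (- (c * (norm (x - a3 z))\<^sup>2)) * indicator {..T} \<bar>snd z\<bar> * psi3 z)"
  proof (rule Bochner_Integration.integrable_bound[OF gi])
    show "AE z in mu \<Otimes>\<^sub>M lborel. norm (exp (- (c * (norm (x - a3 z))\<^sup>2)) * indicator {..T} \<bar>snd z\<bar> * psi3 z)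
      \<le> norm (exp (c * T\<^sup>2) * (?g (fst z) * indicator {0..T} (snd z)))"
    proof (rule AE_I2)
      fix z :: "((real, 'n) vec) \<times> real"
      obtain y \<tau> where z: "z = (y, \<tau>)" by (cases z)
      show "norm (exp (- (c * (norm (x - a3 z))\<^sup>2)) * indicator {..T} \<bar>snd z\<bar> * psi3 z)
        \<le> norm (exp (c * T\<^sup>2) * (?g (fst z) * indicator {0..T} (snd z)))"
      proof (cases "0 \<le> \<tau> \<and> \<tau> \<le> T")
        case True
        let ?v = "x - fold_pt y"
        have e: "x - a3 z = ?v + \<tau> *\<^sub>R eN" using True by (simp add: a3_def z)
        have "norm ?v \<le> norm (?v + \<tau> *\<^sub>R eN) + \<tau>"
          using norm_triangle_sub[of ?v "?v + \<tau> *\<^sub>R eN"] True by simp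
        then have "(norm ?v)\<^sup>2 \<le> (norm (?v + \<tau> *\<^sub>R eN) + \<tau>)\<^sup>2" by (intro power_mono) auto
        also have "\<dots> \<le> 2 * (norm (?v + \<tau> *\<^sub>R eN))\<^sup>2 + 2 * \<tau>\<^sup>2"
          using zero_le_power2[of "norm (?v + \<tau> *\<^sub>R eN) - \<tau>"] by (simp add: power2_eq_square algebra_simps)
        also have "\<dots> \<le> 2 * (norm (?v + \<tau> *\<^sub>R eN))\<^sup>2 + 2 * T\<^sup>2"
          using True by (intro add_left_mono mult_left_mono power_mono) auto
        finally have "c / 2 * (norm ?v)\<^sup>2 \<le> c / 2 * (2 * (norm (?v + \<tau> *\<^sub>R eN))\<^sup>2 + 2 * T\<^sup>2)"
          using c by (intro mult_left_mono) auto
        then have "exp (- (c * (norm (x - a3 z))\<^sup>2)) \<le> exp (c * T\<^sup>2) * exp (- (c / 2 * (norm ?v)\<^sup>2))"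
          unfolding e by (simp add: exp_add[symmetric] algebra_simps)
        then have "exp (- (c * (norm (x - a3 z))\<^sup>2)) * \<bar>\<phi> y\<bar> \<le> exp (c * T\<^sup>2) * exp (- (c / 2 * (norm ?v)\<^sup>2)) * \<bar>\<phi> y\<bar>"
          by (rule mult_right_mono) simp
        then show ?thesis using True by (simp add: z psi3_def abs_mult)
      next
        case False
        then show ?thesis by (auto simp: z psi3_def indicator_def)
      qed
    qed
  next
    have "(\<lambda>z :: (real, 'n) vec \<times> real. indicator {..T} \<bar>snd z\<bar> :: real) \<in> borel_measurable (mu \<Otimes>\<^sub>M lborel)"
    proof (rule measurable_compose[OF abs_snd])
      show "(indicator {..T} :: real \<Rightarrow> real) \<in> borel_measurable borel" by measurable
    qed
    moreover have "(\<lambda>z :: (real, 'n) vec \<times> real. exp (- (c * (norm (x - a3 z))\<^sup>2))) \<in> borel_measurable (mu \<Otimes>\<^sub>M lborel)"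
      using meas3(1) by (intro borel_measurable_continuous_on[OF _ meas3(1), of "\<lambda>v. exp (- (c * (norm (x - v))\<^sup>2))"] continuous_intros)
    ultimately show "(\<lambda>z. exp (- (c * (norm (x - a3 z))\<^sup>2)) * indicator {..T} \<bar>snd z\<bar> * psi3 z) \<in> borel_measurable (mu \<Otimes>\<^sub>M lborel)"
      by (intro borel_measurable_times meas3(2))
  qed
next
  show "(a3 :: (real, 'n) vec \<times> real \<Rightarrow> _) \<in> borel_measurable (mu \<Otimes>\<^sub>M lborel)" "psi3 \<in> borel_measurable (mu \<Otimes>\<^sub>M lborel)" by (rule meas3)+
  show "(\<lambda>z :: (real, 'n) vec \<times> real. \<bar>snd z\<bar>) \<in> borel_measurable (mu \<Otimes>\<^sub>M lborel)" by (rule abs_snd)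
qed (simp_all add: open_Ubd)

definition m0 :: real where "m0 = - real CARD('n) / 2"

text \<open>Times \<open>c0\<close> this is -2 times the x_N-derivative of the heat kernel, extended
  by zero.\<close>

definition f3 :: "(real ^ 'n::{finite,linorder}) \<times> real \<Rightarrow> real" where
  "f3 p = (fst p \<bullet> eN) * ek (m0 - 1) p"

definition D3 :: "(real ^ 'n::{finite,linorder}) \<times> real \<Rightarrow> (real ^ 'n::{finite,linorder}) \<times> real \<Rightarrow> real" where
  "D3 p v = (fst p \<bullet> eN) * ekD (m0 - 1) p v + (fst v \<bullet> eN) * ek (m0 - 1) p"

definition c0 :: real where "c0 = (4 * pi) powr m0"

lemma heatk_f3: "heatk f3"
  using heatk_moment[of "lastc :: 'n"] unfolding f3_def[abs_def] eN_def m0_def .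

lemma kclass_f3: "kclass f3"
  unfolding f3_def[abs_def] by (intro kclass.mul kclass.base)

lemma kder_f3: "kder f3 D3"
  unfolding f3_def[abs_def] D3_def[abs_def] by (intro kder_mul kclass.base kder_ek)

lemma Gauss_ek: "0 < t \<Longrightarrow> Gauss w t = c0 * ek m0 (w, t)" for w :: "real ^ 'n::{finite,linorder}"
  by (simp add: Gauss_def ek_def c0_def m0_def powr_mult[symmetric])

lemma flux_ek: "\<tau> < t \<Longrightarrow> flux w t \<tau> = c0 * f3 (w + \<tau> *\<^sub>R eN, t - \<tau>)" for w :: "real ^ 'n::{finite,linorder}"
  unfolding flux_def f3_def by (subst Gauss_ek) (auto simp: ek_def powr_diff)

text \<open>Fubini with the \<tau>-integral inside, where it can be evaluated for fixed y: to
  \<open>Kker\<close> for the kernel itself, and in closed form for its derivative in the direction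
  (-eN, 1).\<close>

lemma L3_eq:
  assumes f: "kclass f" and p: "p \<in> Ubd"
  shows "S3.L f p = (\<integral>y. (\<integral>\<tau>. f (fst p - fold_pt y + \<bar>\<tau>\<bar> *\<^sub>R eN, snd p - \<bar>\<tau>\<bar>) * indicator {0..} \<tau> \<partial>lborel) * \<phi> y \<partial>mu)"
    and "integrable mu (\<lambda>y. (\<integral>\<tau>. f (fst p - fold_pt y + \<bar>\<tau>\<bar> *\<^sub>R eN, snd p - \<bar>\<tau>\<bar>) * indicator {0..} \<tau> \<partial>lborel) * \<phi> y)"
proof -
  let ?F = "\<lambda>y \<tau>. f (fst p - a3 (y, \<tau>), snd p - \<bar>\<tau>\<bar>) * psi3 (y, \<tau>)"
  have eq: "f (fst p - a3 (y, \<tau>), snd p - \<bar>\<tau>\<bar>) * psi3 (y, \<tau>)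
     = f (fst p - fold_pt y + \<bar>\<tau>\<bar> *\<^sub>R eN, snd p - \<bar>\<tau>\<bar>) * indicator {0..} \<tau> * \<phi> y" for y \<tau>
    by (simp add: a3_def psi3_def algebra_simps)
  have i: "integrable (mu \<Otimes>\<^sub>M lborel) (case_prod ?F)"
    using S3.L_integrable[OF f p] by (simp add: case_prod_beta')
  have "S3.L f p = integral\<^sup>L (mu \<Otimes>\<^sub>M lborel) (case_prod ?F)"
    unfolding S3.L_def by (simp add: case_prod_beta')
  also have "\<dots> = (\<integral>y. (\<integral>\<tau>. ?F y \<tau> \<partial>lborel) \<partial>mu)"
    by (rule mu_lborel.integral_fst'[OF i, symmetric, simplified])
  finally show "S3.L f p = (\<integral>y. (\<integral>\<tau>. f (fst p - fold_pt y + \<bar>\<tau>\<bar> *\<^sub>R eN, snd p - \<bar>\<tau>\<bar>) * indicator {0..} \<tau> \<partial>lborel) * \<phi> y \<partial>mu)"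
    unfolding eq by simp
  have "integrable mu (\<lambda>y. \<integral>\<tau>. ?F y \<tau> \<partial>lborel)"
    using mu_lborel.integrable_fst'[OF i] by simp
  then show "integrable mu (\<lambda>y. (\<integral>\<tau>. f (fst p - fold_pt y + \<bar>\<tau>\<bar> *\<^sub>R eN, snd p - \<bar>\<tau>\<bar>) * indicator {0..} \<tau> \<partial>lborel) * \<phi> y)"
    unfolding eq by simp
qed

text \<open>The extension by zero removes the upper limit t. The range of \<tau> no longer depends
  on time, so differentiating in t under the integral produces no boundary term.\<close>

lemma Kker_eq_f3: "0 < t \<Longrightarrow> Kker w t = c0 * (\<integral>\<tau>. f3 (w + \<bar>\<tau>\<bar> *\<^sub>R eN, t - \<bar>\<tau>\<bar>) * indicator {0..} \<tau> \<partial>lborel)"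
    for w :: "real ^ 'n::{finite,linorder}"
proof -
  have [measurable]: "f3 \<in> borel_measurable borel" by (rule borel_measurable_kclass[OF kclass_f3])
  have m: "(\<lambda>\<tau>. f3 (w + \<bar>\<tau>\<bar> *\<^sub>R eN, t - \<bar>\<tau>\<bar>)) \<in> borel_measurable borel"
    by (rule measurable_compose[of _ _ borel]) measurable
  have "Kker w t = (\<integral>\<tau>. c0 * (f3 (w + \<bar>\<tau>\<bar> *\<^sub>R eN, t - \<bar>\<tau>\<bar>) * indicator {0..} \<tau>) \<partial>lborel)"
    unfolding Kker_def set_lebesgue_integral_def
  proof (rule integral_cong_AE)
    show "AE \<tau> in lborel. indicator {0<..<t} \<tau> *\<^sub>R flux w t \<tau> = c0 * (f3 (w + \<bar>\<tau>\<bar> *\<^sub>R eN, t - \<bar>\<tau>\<bar>) * indicator {0..} \<tau>)"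
      using AE_lborel_singleton[of 0]
    proof eventually_elim
      case (elim \<tau>)
      then consider "\<tau> < 0" | "0 < \<tau>" "\<tau> < t" | "0 < \<tau>" "t \<le> \<tau>" by linarith
      then show ?case
        by cases (auto simp: flux_ek kclass_nonpos[OF kclass_f3])
    qed
  qed (use m in measurable)
  then show ?thesis by simp
qed

definition GG :: "(real ^ 'n::{finite,linorder}) \<times> real \<Rightarrow> real" where
  "GG p = (\<integral>y. Gker (fst p) y (snd p) * \<phi> y \<partial>mu)"

lemma GG_eq:
  assumes p: "p \<in> Ubd"
  shows "GG p = c0 * (S1.L (ek m0) p + ((- 1) * S2.L (ek m0) p + S3.L f3 p))"
    and "integrable mu (\<lambda>y. Gker (fst p) y (snd p) * \<phi> y)"
proof -
  obtain x t where xt: "p = (x, t)" by (cases p)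
  have t: "0 < t" using p by (simp add: Ubd_def xt)
  let ?k = "\<lambda>y. \<integral>\<tau>. f3 (x - fold_pt y + \<bar>\<tau>\<bar> *\<^sub>R eN, t - \<bar>\<tau>\<bar>) * indicator {0..} \<tau> \<partial>lborel"
  let ?h = "\<lambda>y. c0 * (ek m0 (x - y, t) * \<phi> y + ((- 1) * (ek m0 (x - fold_pt y, t) * \<phi> y) + ?k y * \<phi> y))"
  have i1: "integrable mu (\<lambda>y. ek m0 (x - y, t) * \<phi> y)"
    using S1.L_integrable[OF kclass.base p] by (simp add: xt)
  have i2: "integrable mu (\<lambda>y. ek m0 (x - fold_pt y, t) * \<phi> y)"
    using S2.L_integrable[OF kclass.base p] by (simp add: xt)
  have i3: "integrable mu (\<lambda>y. ?k y * \<phi> y)"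
    using L3_eq(2)[OF kclass_f3 p] by (simp add: xt)
  have ih: "integrable mu ?h"
    by (intro integrable_mult_right Bochner_Integration.integrable_add i1 i2 i3)
  have ae: "AE y in mu. Gker x y t * \<phi> y = ?h y"
    using AE_mu_closure
  proof eventually_elim
    case (elim y)
    have "Gker x y t = c0 * (ek m0 (x - y, t) + ((- 1) * ek m0 (x - fold_pt y, t) + ?k y))"
      unfolding Gker_eq Kker_eq_f3[OF t] Gauss_ek[OF t] fold_pt_closure[OF elim] by (simp add: algebra_simps)
    then show ?case by (simp only:) (simp add: algebra_simps)
  qed
  have mG: "(\<lambda>y. Gker x y t * \<phi> y) \<in> borel_measurable mu" by measurable
  show "integrable mu (\<lambda>y. Gker (fst p) y (snd p) * \<phi> y)"
    using ih integrable_cong_AE[OF mG borel_measurable_integrable[OF ih] ae] by (simp add: xt)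
  have "GG p = (\<integral>y. ?h y \<partial>mu)"
    unfolding GG_def using integral_cong_AE[OF mG borel_measurable_integrable[OF ih] ae] by (simp add: xt)
  also have "\<dots> = c0 * ((\<integral>y. ek m0 (x - y, t) * \<phi> y \<partial>mu) + ((- 1) * (\<integral>y. ek m0 (x - fold_pt y, t) * \<phi> y \<partial>mu) + (\<integral>y. ?k y * \<phi> y \<partial>mu)))"
    using i1 i2 i3 by simp
  also have "\<dots> = c0 * (S1.L (ek m0) p + ((- 1) * S2.L (ek m0) p + S3.L f3 p))"
    unfolding S1.L_def S2.L_def L3_eq(1)[OF kclass_f3 p] by (simp add: xt)
  finally show "GG p = c0 * (S1.L (ek m0) p + ((- 1) * S2.L (ek m0) p + S3.L f3 p))" .
qed

lemma Ck_on_GG: "Ck_on k Ubd GG"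
  using Ck_on_scale[OF Ck_on_add[OF S1.Ck_on_L[OF kclass.base]
        Ck_on_add[OF Ck_on_scale[OF S2.Ck_on_L[OF kclass.base]] S3.Ck_on_L[OF kclass_f3]]]]
  by (rule Ck_on_cong) (rule GG_eq(1)[symmetric])

lemma caloric_GG: "caloric Ubd GG"
proof (rule caloric_cong[OF _ open_Ubd GG_eq(1)[symmetric]])
  have e: "heatk (ek m0 :: (real, 'n) vec \<times> real \<Rightarrow> real)" unfolding m0_def by (rule heatk_ek)
  show "caloric Ubd (\<lambda>p. c0 * (S1.L (ek m0) p + ((- 1) * S2.L (ek m0) p + S3.L f3 p)))"
    by (intro caloric_scale caloric_add caloric_superposition[OF _ e] caloric_superposition[OF _ heatk_f3]
        S1.superposition_axioms S2.superposition_axioms S3.superposition_axioms)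
qed

section \<open>The dynamical boundary condition\<close>

text \<open>Along the ray (w + \<tau> eN, t - \<tau>) the direction (-eN, 1) is minus the velocity,
  so the integrand is the \<tau>-derivative of -\<open>f3\<close>. The ray misses the pole because
  w_N >= 0 and t > 0, and its far end lies at negative time, where \<open>f3\<close> is
  zero.\<close>

lemma D3_integral:
  fixes w :: "real ^ 'n::{finite,linorder}"
  assumes w: "0 \<le> w $ lastc" and t: "0 < t"
  shows "(\<integral>\<tau>. D3 (w + \<bar>\<tau>\<bar> *\<^sub>R eN, t - \<bar>\<tau>\<bar>) (- eN, 1) * indicator {0..} \<tau> \<partial>lborel) = f3 (w, t)"
proof -
  let ?g = "\<lambda>\<tau>. (w + \<tau> *\<^sub>R eN, t - \<tau>)"
  let ?D = "\<lambda>\<tau>. D3 (?g \<tau>) (- eN, 1)"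
  have kD: "kclass (\<lambda>p. D3 p v)" for v using kder_f3 unfolding kder_def by blast
  have ne: "?g \<tau> \<noteq> 0" if "0 \<le> \<tau>" for \<tau>
  proof
    assume "?g \<tau> = 0"
    then have "w + \<tau> *\<^sub>R eN = 0" "t = \<tau>" by (auto simp: zero_prod_def)
    then have "(w + \<tau> *\<^sub>R eN) $ lastc = 0" "t = \<tau>" by simp_all
    then show False using w t by simp
  qed
  have dg: "(?g has_derivative (\<lambda>h. (h *\<^sub>R eN, - h))) (at \<tau>)" for \<tau>
    by (auto intro!: derivative_eq_intros)
  have F: "((\<lambda>\<tau>. - f3 (?g \<tau>)) has_real_derivative ?D \<tau>) (at \<tau>)" if "0 \<le> \<tau>" for \<tau>
  proof -
    have d: "(f3 has_derivative D3 (?g \<tau>)) (at (?g \<tau>))"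
      using kder_f3 ne[OF that] unfolding kder_def by blast
    have "((\<lambda>\<tau>. f3 (?g \<tau>)) has_derivative (\<lambda>h. D3 (?g \<tau>) (h *\<^sub>R eN, - h))) (at \<tau>)"
      by (rule has_derivative_compose[OF dg d])
    from has_derivative_minus[OF this]
    have "((\<lambda>\<tau>. - f3 (?g \<tau>)) has_derivative (\<lambda>h. - D3 (?g \<tau>) (h *\<^sub>R eN, - h))) (at \<tau>)" .
    moreover have "(\<lambda>h. - D3 (?g \<tau>) (h *\<^sub>R eN, - h)) = (*) (?D \<tau>)"
    proof
      fix h :: real
      have "(h *\<^sub>R eN, - h) = (- h) *\<^sub>R (- eN :: (real, 'n) vec, 1::real)" by simp
      then have "D3 (?g \<tau>) (h *\<^sub>R eN, - h) = (- h) *\<^sub>R ?D \<tau>"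
        using linear_simps(5)[OF has_derivative_bounded_linear[OF d]] by metis
      then show "- D3 (?g \<tau>) (h *\<^sub>R eN, - h) = ?D \<tau> * h" by simp
    qed
    ultimately show ?thesis by (simp add: has_field_derivative_def)
  qed
  have C: "isCont ?D \<tau>" if "0 \<le> \<tau>" for \<tau>
  proof -
    obtain E where "kder (\<lambda>p. D3 p (- eN, 1)) E" using kclass_kder[OF kD] by blast
    then have "((\<lambda>p. D3 p (- eN, 1)) has_derivative E (?g \<tau>)) (at (?g \<tau>))"
      using ne[OF that] unfolding kder_def by blast
    from has_derivative_continuous[OF has_derivative_compose[OF dg this]] show ?thesis .
  qed
  have "(\<integral>\<tau>. D3 (w + \<bar>\<tau>\<bar> *\<^sub>R eN, t - \<bar>\<tau>\<bar>) (- eN, 1) * indicator {0..} \<tau> \<partial>lborel)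
    = (\<integral>\<tau>. ?D \<tau> * indicator {0..t + 1} \<tau> \<partial>lborel)"
  proof (rule Bochner_Integration.integral_cong[OF refl])
    fix \<tau> :: real
    consider "\<tau> < 0" | "0 \<le> \<tau>" "\<tau> \<le> t + 1" | "t + 1 < \<tau>" by linarith
    then show "D3 (w + \<bar>\<tau>\<bar> *\<^sub>R eN, t - \<bar>\<tau>\<bar>) (- eN, 1) * indicator {0..} \<tau> = ?D \<tau> * indicator {0..t + 1} \<tau>"
      using t by cases (auto simp: kclass_nonpos[OF kD])
  qed
  also have "\<dots> = - f3 (?g (t + 1)) - - f3 (?g 0)"
    using t F C by (intro integral_FTC_Icc_real) auto
  also have "\<dots> = f3 (w, t)" by (simp add: kclass_nonpos[OF kclass_f3])
  finally show ?thesis .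
qed

lemma GG_boundary:
  assumes x: "x \<in> frontier Omega" and t: "0 < t"
  shows "deriv (\<lambda>s. GG (x, s)) t + normal_deriv (\<lambda>z. GG (z, t)) x = 0"
proof -
  have xN: "x $ lastc = 0" using x by (simp add: frontier_Omega)
  define p where "p = (x, t)"
  have p: "p \<in> Ubd" using xN t by (simp add: Ubd_def p_def)
  let ?E = "\<lambda>v. c0 * (S1.L (\<lambda>q. ekD m0 q v) p + ((- 1) * S2.L (\<lambda>q. ekD m0 q v) p + S3.L (\<lambda>q. D3 q v) p))"
  have "((\<lambda>p. c0 * (S1.L (ek m0) p + ((- 1) * S2.L (ek m0) p + S3.L f3 p))) has_derivative ?E) (at p)"
    by (intro has_derivative_mult_right has_derivative_add S1.L_has_derivative S2.L_has_derivative S3.L_has_derivative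
        kclass.base kder_ek kclass_f3 kder_f3 p)
  then have E: "(GG has_derivative ?E) (at p)"
    by (rule has_derivative_transform_within_open[OF _ open_Ubd p]) (rule GG_eq(1)[symmetric])
  have kD: "kclass (\<lambda>p. D3 p v)" for v using kder_f3 unfolding kder_def by blast
  let ?v = "(- eN, 1) :: (real, 'n) vec \<times> real"
  have i1: "integrable mu (\<lambda>y. ekD m0 (x - y, t) ?v * \<phi> y)"
    using S1.kder_integrable[OF kder_ek p] by (simp add: p_def)
  have i2: "integrable mu (\<lambda>y. ekD m0 (x - fold_pt y, t) ?v * \<phi> y)"
    using S2.kder_integrable[OF kder_ek p] by (simp add: p_def)
  have L3: "S3.L (\<lambda>q. D3 q ?v) p = (\<integral>y. (\<integral>\<tau>. D3 (x - fold_pt y + \<bar>\<tau>\<bar> *\<^sub>R eN, t - \<bar>\<tau>\<bar>) ?v * indicator {0..} \<tau> \<partial>lborel) * \<phi> y \<partial>mu)"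
    using L3_eq(1)[OF kD p] by (simp add: p_def)
  have i3: "integrable mu (\<lambda>y. (\<integral>\<tau>. D3 (x - fold_pt y + \<bar>\<tau>\<bar> *\<^sub>R eN, t - \<bar>\<tau>\<bar>) ?v * indicator {0..} \<tau> \<partial>lborel) * \<phi> y)"
    using L3_eq(2)[OF kD p] by (simp add: p_def)
  have "?E ?v = c0 * (\<integral>y. ekD m0 (x - y, t) ?v * \<phi> y + ((- 1) * (ekD m0 (x - fold_pt y, t) ?v * \<phi> y)
     + (\<integral>\<tau>. D3 (x - fold_pt y + \<bar>\<tau>\<bar> *\<^sub>R eN, t - \<bar>\<tau>\<bar>) ?v * indicator {0..} \<tau> \<partial>lborel) * \<phi> y) \<partial>mu)"
    unfolding L3 using i1 i2 i3 by (simp add: S1.L_def S2.L_def p_def)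
  also have "(\<integral>y. ekD m0 (x - y, t) ?v * \<phi> y + ((- 1) * (ekD m0 (x - fold_pt y, t) ?v * \<phi> y)
     + (\<integral>\<tau>. D3 (x - fold_pt y + \<bar>\<tau>\<bar> *\<^sub>R eN, t - \<bar>\<tau>\<bar>) ?v * indicator {0..} \<tau> \<partial>lborel) * \<phi> y) \<partial>mu) = 0"
  proof (rule integral_eq_zero_AE)
    show "AE y in mu. ekD m0 (x - y, t) ?v * \<phi> y + ((- 1) * (ekD m0 (x - fold_pt y, t) ?v * \<phi> y)
     + (\<integral>\<tau>. D3 (x - fold_pt y + \<bar>\<tau>\<bar> *\<^sub>R eN, t - \<bar>\<tau>\<bar>) ?v * indicator {0..} \<tau> \<partial>lborel) * \<phi> y) = 0"
      using AE_mu_closure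
    proof eventually_elim
      case (elim y)
      have yN: "0 \<le> y $ lastc" using elim by (simp add: closure_Omega)
      have w: "0 \<le> (x - fold_pt y) $ lastc" using xN by simp
      have n: "norm (x - fold_pt y) = norm (x - y)"
        using norm_diff_refl_pt_sq[of x y] xN by (simp add: fold_pt_closure[OF elim])
      have ek_n: "ek m (x - fold_pt y, t) = ek m (x - y, t)" for m
        by (simp add: ek_def n)
      \<comment> \<open>For x_N = 0 the two Gaussians are equal, so their time derivatives cancel.
        Their normal derivatives are opposite; the difference doubles them, and the value of
        \<open>f3\<close> at \<tau> = 0 is the balancing term.\<close>
      have "ekD m0 (x - y, t) ?v - ekD m0 (x - fold_pt y, t) ?v + f3 (x - fold_pt y, t) = 0"
        using xN yN by (simp add: ekD_def f3_def ek_n n field_simps)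
      then have "(ekD m0 (x - y, t) ?v - ekD m0 (x - fold_pt y, t) ?v + f3 (x - fold_pt y, t)) * \<phi> y = 0" by simp
      then show ?case
        unfolding D3_integral[OF w t] by (simp add: algebra_simps)
    qed
  qed
  finally have v0: "?E ?v = 0" by simp
  have "?E ((0, 1)) = ?E ((eN, 0) + ?v)" by simp
  also have "\<dots> = ?E (eN, 0) + ?E ?v"
    using linear_simps(1)[OF has_derivative_bounded_linear[OF E]] .
  finally have "?E (0, 1) = ?E (eN, 0)" using v0 by simp
  then show ?thesis
    using deriv_time_eq_of_has_derivative[OF E[unfolded p_def]] normal_deriv_eq_of_has_derivative[OF E[unfolded p_def]]
    by (simp add: p_def)
qed

end

section \<open>Estimates and strong continuity in the joint Lebesgue space\<close>

interpretation mu_mu: pair_sigma_finite "mu :: (real ^ 'n::{finite,linorder}) measure" "mu :: (real ^ 'n::{finite,linorder}) measure"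
  by (intro pair_sigma_finite.intro sigma_finite_mu)

text \<open>The supporting line of the convex function a^q at b, which is what the proof of Jensen's
  inequality below integrates.\<close>

lemma powr_tangent:
  fixes a b q :: real
  assumes "0 \<le> a" "0 \<le> b" "1 \<le> q"
  shows "b powr q + q * b powr (q - 1) * (a - b) \<le> a powr q"
proof (cases "a = 0 \<or> b = 0")
  case True
  show ?thesis
  proof (cases "b = 0")
    case False
    then have "a = 0" using True by simp
    have "b powr (q - 1) * b = b powr q" using False assms by (simp add: powr_mult_base mult.commute[of _ b])
    then have "q * b powr (q - 1) * (a - b) = - q * b powr q" using \<open>a = 0\<close> by (simp add: mult.assoc)
    moreover have "b powr q \<le> q * b powr q" using assms mult_right_mono[of 1 q "b powr q"] by simp
    ultimately show ?thesis using powr_ge_zero[of a q] by linarith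
  qed simp
next
  case False
  then have ab: "0 < a" "0 < b" using assms by auto
  \<comment> \<open>Then exp (u / q) = a / b and exp u is its q-th power; convexity of exp between u
    and 0 is the inequality divided by b^q, up to rearrangement.\<close>
  define u where "u = q * ln (a / b)"
  have "exp ((1 / q) * u + (1 - 1 / q) * 0) \<le> (1 / q) * exp u + (1 - 1 / q) * exp 0"
    using convex_onD[OF exp_convex, of "1 - 1 / q" u 0] assms by (simp add: divide_le_eq)
  then have "exp (ln (a / b)) \<le> (1 / q) * exp u + (1 - 1 / q)"
    using assms by (simp add: u_def)
  moreover have "exp (ln (a / b)) = a / b" using ab by simp
  moreover have "exp u = a powr q / b powr q"
    using ab by (simp add: u_def powr_def[symmetric] powr_divide[symmetric]) (simp add: powr_def)
  ultimately have "q * (a / b) \<le> a powr q / b powr q + (q - 1)"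
    using assms by (simp add: field_simps)
  then have "q * (a / b) * b powr q \<le> (a powr q / b powr q + (q - 1)) * b powr q"
    by (rule mult_right_mono) simp
  moreover have "(a powr q / b powr q + (q - 1)) * b powr q = a powr q + (q - 1) * b powr q"
    using ab by (simp add: distrib_right)
  moreover have "q * (a / b) * b powr q = q * b powr (q - 1) * a"
    using ab by (simp add: powr_diff field_simps)
  ultimately have "q * b powr (q - 1) * a \<le> a powr q + (q - 1) * b powr q" by simp
  moreover have "q * b powr (q - 1) * b = q * b powr q"
    using ab by (simp add: powr_diff)
  ultimately show ?thesis unfolding right_diff_distrib left_diff_distrib by linarith
qed

lemma powr_add_le:
  fixes a b q :: real
  assumes "0 \<le> q"
  shows "\<bar>a + b\<bar> powr q \<le> 2 powr q * (\<bar>a\<bar> powr q + \<bar>b\<bar> powr q)"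
proof -
  have "\<bar>a + b\<bar> powr q \<le> (2 * max \<bar>a\<bar> \<bar>b\<bar>) powr q"
    using assms by (intro powr_mono2) auto
  also have "\<dots> = 2 powr q * max \<bar>a\<bar> \<bar>b\<bar> powr q" by (simp add: powr_mult)
  also have "max \<bar>a\<bar> \<bar>b\<bar> powr q \<le> \<bar>a\<bar> powr q + \<bar>b\<bar> powr q" by (auto simp: max_def)
  finally show ?thesis by simp
qed

text \<open>A Gaussian, whose mass is finite, is bounded below on the ball.\<close>

lemma emeasure_mu_ball: "emeasure mu (ball (0 :: real ^ 'n::{finite,linorder}) r) < \<infinity>"
proof -
  let ?B = "ball (0 :: (real, 'n) vec) r"
  define c where "c = (4 * pi) powr (- (real CARD('n) / 2)) * exp (- (r\<^sup>2 / 4))"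
  have c: "0 < c" by (simp add: c_def)
  have "ennreal c * emeasure mu ?B = (\<integral>\<^sup>+y. ennreal c * indicator ?B y \<partial>mu)"
    by (simp add: nn_integral_cmult_indicator)
  also have "\<dots> \<le> (\<integral>\<^sup>+y. ennreal (Gauss (0 - (y :: (real, 'n) vec)) 1) \<partial>mu)"
  proof (rule nn_integral_mono)
    fix y :: "(real, 'n) vec"
    have "c \<le> Gauss (0 - y) 1" if "y \<in> ?B"
    proof -
      have "(norm y)\<^sup>2 \<le> r\<^sup>2" using that by (intro power_mono) auto
      then show ?thesis by (simp add: c_def Gauss_def)
    qed
    then show "ennreal c * indicator ?B y \<le> ennreal (Gauss (0 - y) 1)"
      by (auto simp: indicator_def intro: ennreal_leI)
  qed
  also have "\<dots> < \<infinity>" using nn_integral_Gauss_mu(1)[of 1 "0 :: (real, 'n) vec"] by simp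
  finally show ?thesis using c by (auto simp: ennreal_mult_less_top)
qed

lemma integrable_gauss_mu:
  fixes x :: "real ^ 'n::{finite,linorder}"
  assumes "0 < c"
  shows "integrable mu (\<lambda>y. exp (- (c * (norm (x - y))\<^sup>2)))"
proof (rule integrableI_nonneg)
  define s where "s = 1 / (4 * c)"
  have s: "0 < s" using assms by (simp add: s_def)
  define k where "k = (4 * pi * s) powr (- (real CARD('n) / 2))"
  have k: "0 < k" using s by (simp add: k_def)
  have "exp (- (c * (norm (x - y))\<^sup>2)) = 1 / k * Gauss (x - y) s" for y
    using k assms by (simp add: Gauss_def k_def[symmetric]) (simp add: s_def)
  then have "(\<integral>\<^sup>+y. ennreal (exp (- (c * (norm (x - y))\<^sup>2))) \<partial>mu) = (\<integral>\<^sup>+y. ennreal (1 / k) * ennreal (Gauss (x - y) s) \<partial>mu)"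
    using k by (simp add: ennreal_mult[symmetric])
  also have "\<dots> < \<infinity>"
    using s by (simp add: nn_integral_cmult nn_integral_Gauss_mu ennreal_mult_less_top)
  finally show "(\<integral>\<^sup>+y. ennreal (exp (- (c * (norm (x - y))\<^sup>2))) \<partial>mu) < \<infinity>" .
qed auto

definition Np :: "real \<Rightarrow> (real ^ 'n::{finite,linorder} \<Rightarrow> real) \<Rightarrow> ennreal" where
  "Np q \<phi> = (\<integral>\<^sup>+y. ennreal (\<bar>\<phi> y\<bar> powr q) \<partial>mu)"

text \<open>With e the Gaussian weight, e |\<phi>| is at most e where |\<phi>| <= 1 and at most
  |\<phi>|^q elsewhere, because q >= 1; both are integrable.\<close>

lemma datum_of_Np:
  assumes [measurable]: "\<phi> \<in> borel_measurable borel" and q: "1 \<le> q" and fin: "Np q \<phi> < \<infinity>"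
  shows "datum \<phi>"
proof
  fix c :: real and x assume c: "0 < c"
  have i: "integrable mu (\<lambda>y. \<bar>\<phi> y\<bar> powr q)"
    using fin by (intro integrableI_nonneg) (auto simp: Np_def)
  show "integrable mu (\<lambda>y. exp (- (c * (norm (x - y))\<^sup>2)) * \<phi> y)"
  proof (rule Bochner_Integration.integrable_bound)
    show "integrable mu (\<lambda>y. exp (- (c * (norm (x - y))\<^sup>2)) + \<bar>\<phi> y\<bar> powr q)"
      by (intro Bochner_Integration.integrable_add integrable_gauss_mu c i)
    show "AE y in mu. norm (exp (- (c * (norm (x - y))\<^sup>2)) * \<phi> y) \<le> norm (exp (- (c * (norm (x - y))\<^sup>2)) + \<bar>\<phi> y\<bar> powr q)"
    proof (rule AE_I2)
      fix y
      let ?e = "exp (- (c * (norm (x - y))\<^sup>2))"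
      have e1: "?e \<le> 1" using c by simp
      have "?e * \<bar>\<phi> y\<bar> \<le> ?e + \<bar>\<phi> y\<bar> powr q"
      proof (cases "\<bar>\<phi> y\<bar> \<le> 1")
        case True
        then have "?e * \<bar>\<phi> y\<bar> \<le> ?e * 1" by (intro mult_left_mono) auto
        then show ?thesis by (simp add: add_increasing2)
      next
        case False
        then have "\<bar>\<phi> y\<bar> powr 1 \<le> \<bar>\<phi> y\<bar> powr q" using q by (intro powr_mono) auto
        moreover have "?e * \<bar>\<phi> y\<bar> \<le> 1 * \<bar>\<phi> y\<bar>" using e1 by (intro mult_right_mono) auto
        ultimately have "?e * \<bar>\<phi> y\<bar> \<le> \<bar>\<phi> y\<bar> powr q" by simp
        then show ?thesis by (simp add: add_increasing)
      qed
      then show "norm (?e * \<phi> y) \<le> norm (?e + \<bar>\<phi> y\<bar> powr q)" by (simp add: abs_mult add_nonneg_nonneg)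
    qed
  qed measurable
qed fact

lemma datum_of_bounded:
  assumes [measurable]: "\<phi> \<in> borel_measurable borel" and b: "AE y in mu. \<bar>\<phi> y\<bar> \<le> C"
  shows "datum \<phi>"
proof
  fix c :: real and x assume c: "0 < c"
  show "integrable mu (\<lambda>y. exp (- (c * (norm (x - y))\<^sup>2)) * \<phi> y)"
  proof (rule Bochner_Integration.integrable_bound)
    show "integrable mu (\<lambda>y. exp (- (c * (norm (x - y))\<^sup>2)) * C)"
      by (intro integrable_mult_left integrable_gauss_mu c)
    show "AE y in mu. norm (exp (- (c * (norm (x - y))\<^sup>2)) * \<phi> y) \<le> norm (exp (- (c * (norm (x - y))\<^sup>2)) * C)"
      using b by eventually_elim (auto simp: abs_mult intro: order_trans)
  qed measurable
qed fact

section \<open>Jensen's inequality and contraction\<close>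

lemma AE_Gker_nonneg: "x \<in> closure Omega \<Longrightarrow> 0 < t \<Longrightarrow> AE y in mu. 0 \<le> Gker x y t"
  using AE_mu_closure by (auto elim!: eventually_mono intro: Gker_nonneg)

lemma integrable_Gker: "x \<in> closure Omega \<Longrightarrow> 0 < t \<Longrightarrow> integrable mu (\<lambda>y. Gker x y t)"
  and integral_Gker: "x \<in> closure Omega \<Longrightarrow> 0 < t \<Longrightarrow> (\<integral>y. Gker x y t \<partial>mu) = 1"
proof -
  assume a: "x \<in> closure Omega" "0 < t"
  then have "has_bochner_integral mu (\<lambda>y. Gker x y t) 1"
    by (intro has_bochner_integral_nn_integral AE_Gker_nonneg) (auto simp: nn_integral_Gker)
  then show "integrable mu (\<lambda>y. Gker x y t)" "(\<integral>y. Gker x y t \<partial>mu) = 1"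
    by (auto simp: has_bochner_integral_iff)
qed

text \<open>With b the mean of |h| under the kernel, whose mass is one, the supporting line of the
  q-th power at b integrates to b^q.\<close>

lemma Gker_jensen:
  fixes x :: "real ^ 'n::{finite,linorder}"
  assumes x: "x \<in> closure Omega" and t: "0 < t" and q: "1 \<le> q"
    and [measurable]: "h \<in> borel_measurable borel"
    and i: "integrable mu (\<lambda>y. Gker x y t * h y)"
  shows "ennreal (\<bar>\<integral>y. Gker x y t * h y \<partial>mu\<bar> powr q) \<le> (\<integral>\<^sup>+y. ennreal (Gker x y t) * ennreal (\<bar>h y\<bar> powr q) \<partial>mu)"
proof (cases "(\<integral>\<^sup>+y. ennreal (Gker x y t) * ennreal (\<bar>h y\<bar> powr q) \<partial>mu) = \<infinity>")
  case False
  have nn: "AE y in mu. 0 \<le> Gker x y t" by (rule AE_Gker_nonneg[OF x t])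
  have eq: "(\<integral>\<^sup>+y. ennreal (Gker x y t) * ennreal (\<bar>h y\<bar> powr q) \<partial>mu) = (\<integral>\<^sup>+y. ennreal (Gker x y t * \<bar>h y\<bar> powr q) \<partial>mu)"
    by (intro nn_integral_cong) (simp add: ennreal_mult'')
  have nn2: "AE y in mu. 0 \<le> Gker x y t * \<bar>h y\<bar> powr q" using nn by eventually_elim simp
  have iq: "integrable mu (\<lambda>y. Gker x y t * \<bar>h y\<bar> powr q)"
    using False unfolding eq by (intro integrableI_nonneg nn2) (auto simp: less_top)
  have ia: "integrable mu (\<lambda>y. Gker x y t * \<bar>h y\<bar>)"
  proof -
    have "AE y in mu. norm (Gker x y t * h y) = Gker x y t * \<bar>h y\<bar>"
      using nn by eventually_elim (simp add: abs_mult)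
    then show ?thesis
      using integrable_norm[OF i] by (subst (asm) integrable_cong_AE) auto
  qed
  define b where "b = (\<integral>y. Gker x y t * \<bar>h y\<bar> \<partial>mu)"
  have b0: "0 \<le> b" unfolding b_def using nn by (intro integral_nonneg_AE) (auto elim: eventually_mono)
  have "\<bar>\<integral>y. Gker x y t * h y \<partial>mu\<bar> \<le> b"
  proof -
    have "\<bar>\<integral>y. Gker x y t * h y \<partial>mu\<bar> \<le> (\<integral>y. norm (Gker x y t * h y) \<partial>mu)"
      using integral_norm_bound[of mu "\<lambda>y. Gker x y t * h y"] by simp
    also have "\<dots> = b"
      unfolding b_def using nn by (intro integral_cong_AE) (auto elim!: eventually_mono simp: abs_mult)
    finally show ?thesis .
  qed
  then have "\<bar>\<integral>y. Gker x y t * h y \<partial>mu\<bar> powr q \<le> b powr q"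
    using q by (intro powr_mono2) auto
  also have "\<dots> = (\<integral>y. (b powr q - q * b powr (q - 1) * b) * Gker x y t + q * b powr (q - 1) * (Gker x y t * \<bar>h y\<bar>) \<partial>mu)"
    using ia integrable_Gker[OF x t] integral_Gker[OF x t] by (simp add: b_def[symmetric])
  also have "\<dots> \<le> (\<integral>y. Gker x y t * \<bar>h y\<bar> powr q \<partial>mu)"
  proof (rule integral_mono_AE)
    show "AE y in mu. (b powr q - q * b powr (q - 1) * b) * Gker x y t + q * b powr (q - 1) * (Gker x y t * \<bar>h y\<bar>)
      \<le> Gker x y t * \<bar>h y\<bar> powr q"
      using nn
    proof eventually_elim
      case (elim y)
      from mult_left_mono[OF powr_tangent[of "\<bar>h y\<bar>" b q] elim] b0 q
      show ?case by (simp add: algebra_simps)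
    qed
  qed (use ia iq integrable_Gker[OF x t] in \<open>auto intro!: Bochner_Integration.integrable_add\<close>)
  finally have "ennreal (\<bar>\<integral>y. Gker x y t * h y \<partial>mu\<bar> powr q) \<le> ennreal (\<integral>y. Gker x y t * \<bar>h y\<bar> powr q \<partial>mu)"
    by (rule ennreal_leI)
  also have "\<dots> = (\<integral>\<^sup>+y. ennreal (Gker x y t * \<bar>h y\<bar> powr q) \<partial>mu)"
    by (rule nn_integral_eq_integral[symmetric, OF iq nn2])
  finally show ?thesis by (simp add: eq)
qed simp

text \<open>The mass is one in y; by symmetry and Tonelli it is also one in x.\<close>

lemma nn_integral_Gker_schur:
  fixes f :: "real ^ 'n::{finite,linorder} \<Rightarrow> ennreal"
  assumes t: "0 < t" and [measurable]: "f \<in> borel_measurable borel"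
  shows "(\<integral>\<^sup>+x. \<integral>\<^sup>+y. ennreal (Gker x y t) * f x \<partial>mu \<partial>mu) = (\<integral>\<^sup>+x. f x \<partial>mu)"
    and "(\<integral>\<^sup>+x. \<integral>\<^sup>+y. ennreal (Gker x y t) * f y \<partial>mu \<partial>mu) = (\<integral>\<^sup>+x. f x \<partial>mu)"
proof -
  show 1: "(\<integral>\<^sup>+x. \<integral>\<^sup>+y. ennreal (Gker x y t) * f x \<partial>mu \<partial>mu) = (\<integral>\<^sup>+x. f x \<partial>mu)"
  proof (rule nn_integral_cong_AE)
    show "AE x in mu. (\<integral>\<^sup>+y. ennreal (Gker x y t) * f x \<partial>mu) = f x"
      using AE_mu_closure
      by eventually_elim (simp add: nn_integral_multc nn_integral_Gker[OF _ t])
  qed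
  have "(\<integral>\<^sup>+x. \<integral>\<^sup>+y. ennreal (Gker x y t) * f y \<partial>mu \<partial>mu) = (\<integral>\<^sup>+y. \<integral>\<^sup>+x. ennreal (Gker x y t) * f y \<partial>mu \<partial>mu)"
    by (rule mu_mu.Fubini') measurable
  also have "\<dots> = (\<integral>\<^sup>+x. \<integral>\<^sup>+y. ennreal (Gker x y t) * f x \<partial>mu \<partial>mu)"
    by (subst Gker_commute) (rule refl)
  finally show "(\<integral>\<^sup>+x. \<integral>\<^sup>+y. ennreal (Gker x y t) * f y \<partial>mu \<partial>mu) = (\<integral>\<^sup>+x. f x \<partial>mu)"
    using 1 by simp
qed

definition Pt :: "real \<Rightarrow> (real ^ 'n::{finite,linorder} \<Rightarrow> real) \<Rightarrow> real ^ 'n::{finite,linorder} \<Rightarrow> real" where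
  "Pt t \<phi> x = (\<integral>y. Gker x y t * \<phi> y \<partial>mu)"

lemma borel_measurable_Pt [measurable]:
  assumes [measurable]: "\<phi> \<in> borel_measurable borel"
  shows "Pt t \<phi> \<in> borel_measurable borel"
proof -
  have "(\<lambda>x. \<integral>y. Gker x y t * \<phi> y \<partial>mu) \<in> borel_measurable mu"
    by measurable
  then show ?thesis by (simp add: Pt_def[abs_def] cong: measurable_cong_sets)
qed

lemma (in datum) GG_Pt: "GG (x, t) = Pt t \<phi> x"
  by (simp add: GG_def Pt_def)

lemma (in datum) Gker_integrable:
  assumes "x \<in> closure Omega" "0 < t"
  shows "integrable mu (\<lambda>y. Gker x y t * \<phi> y)"
  using GG_eq(2)[of "(x, t)"] assms closure_times_subset_Ubd by auto

lemma (in datum) Pt_powr_le: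
  assumes "x \<in> closure Omega" "0 < t" "1 \<le> q"
  shows "ennreal (\<bar>Pt t \<phi> x\<bar> powr q) \<le> (\<integral>\<^sup>+y. ennreal (Gker x y t) * ennreal (\<bar>\<phi> y\<bar> powr q) \<partial>mu)"
  unfolding Pt_def using assms by (intro Gker_jensen Gker_integrable) auto

lemma (in datum) Np_Pt_le:
  assumes "0 < t" "1 \<le> q"
  shows "Np q (Pt t \<phi>) \<le> Np q \<phi>"
proof -
  have "Np q (Pt t \<phi>) \<le> (\<integral>\<^sup>+x. \<integral>\<^sup>+y. ennreal (Gker x y t) * ennreal (\<bar>\<phi> y\<bar> powr q) \<partial>mu \<partial>mu)"
    unfolding Np_def using AE_mu_closure assms
    by (intro nn_integral_mono_AE) (auto elim!: eventually_mono intro: Pt_powr_le)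
  also have "\<dots> = Np q \<phi>"
    unfolding Np_def using assms by (intro nn_integral_Gker_schur) auto
  finally show ?thesis .
qed

lemma (in datum) Pt_powr_le_sup:
  assumes "x \<in> closure Omega" "0 < t" "1 \<le> q"
  shows "ennreal (\<bar>Pt t \<phi> x\<bar> powr q) \<le> ennreal (Gsup CARD('n) t) * Np q \<phi>"
proof -
  have "ennreal (\<bar>Pt t \<phi> x\<bar> powr q) \<le> (\<integral>\<^sup>+y. ennreal (Gker x y t) * ennreal (\<bar>\<phi> y\<bar> powr q) \<partial>mu)"
    by (rule Pt_powr_le[OF assms])
  also have "\<dots> \<le> (\<integral>\<^sup>+y. ennreal (Gsup CARD('n) t) * ennreal (\<bar>\<phi> y\<bar> powr q) \<partial>mu)"
    using AE_mu_closure assms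
    by (intro nn_integral_mono_AE) (auto elim!: eventually_mono intro!: mult_right_mono ennreal_leI Gker_le_Gsup)
  also have "\<dots> = ennreal (Gsup CARD('n) t) * Np q \<phi>"
    unfolding Np_def by (rule nn_integral_cmult) auto
  finally show ?thesis .
qed

lemma (in datum) Pt_le_of_bounded:
  assumes "x \<in> closure Omega" "0 < t" and b: "AE y in mu. \<bar>\<phi> y\<bar> \<le> C"
  shows "\<bar>Pt t \<phi> x\<bar> \<le> C"
proof -
  have "\<bar>Pt t \<phi> x\<bar> \<le> (\<integral>y. \<bar>Gker x y t * \<phi> y\<bar> \<partial>mu)"
    unfolding Pt_def using integral_norm_bound[of mu "\<lambda>y. Gker x y t * \<phi> y"] by simp
  also have "\<dots> \<le> (\<integral>y. Gker x y t * C \<partial>mu)"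
  proof (rule integral_mono_AE)
    show "AE y in mu. \<bar>Gker x y t * \<phi> y\<bar> \<le> Gker x y t * C"
      using b AE_Gker_nonneg[OF assms(1,2)] by eventually_elim (simp add: abs_mult mult_left_mono)
  qed (use Gker_integrable integrable_Gker assms in auto)
  also have "\<dots> = C" using integral_Gker[OF assms(1,2)] by simp
  finally show ?thesis .
qed

section \<open>Strong continuity at time zero\<close>

text \<open>By Jensen this bounds the q-th power of the L^q distance between P_t \<phi> and \<phi>.
  It makes sense for every Borel function, so the density argument needs no integrability of G
  \<phi> along the way.\<close>

definition Jt :: "real \<Rightarrow> real \<Rightarrow> (real ^ 'n::{finite,linorder} \<Rightarrow> real) \<Rightarrow> ennreal" where
  "Jt q t \<phi> = (\<integral>\<^sup>+x. \<integral>\<^sup>+y. ennreal (Gker x y t) * ennreal (\<bar>\<phi> x - \<phi> y\<bar> powr q) \<partial>mu \<partial>mu)"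

lemma (in datum) Np_Pt_diff_le:
  assumes "0 < t" "1 \<le> q"
  shows "Np q (\<lambda>x. Pt t \<phi> x - \<phi> x) \<le> Jt q t \<phi>"
  unfolding Np_def Jt_def
proof (rule nn_integral_mono_AE)
  show "AE x in mu. ennreal (\<bar>Pt t \<phi> x - \<phi> x\<bar> powr q) \<le> (\<integral>\<^sup>+y. ennreal (Gker x y t) * ennreal (\<bar>\<phi> x - \<phi> y\<bar> powr q) \<partial>mu)"
    using AE_mu_closure
  proof eventually_elim
    case (elim x)
    have i: "integrable mu (\<lambda>y. Gker x y t * (\<phi> y - \<phi> x))"
      using Gker_integrable[OF elim assms(1)] integrable_Gker[OF elim assms(1)] by (simp add: right_diff_distrib)
    have "Pt t \<phi> x - \<phi> x = (\<integral>y. Gker x y t * (\<phi> y - \<phi> x) \<partial>mu)"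
      using Gker_integrable[OF elim assms(1)] integrable_Gker[OF elim assms(1)] integral_Gker[OF elim assms(1)]
      by (simp add: right_diff_distrib Pt_def)
    then have "ennreal (\<bar>Pt t \<phi> x - \<phi> x\<bar> powr q) \<le> (\<integral>\<^sup>+y. ennreal (Gker x y t) * ennreal (\<bar>\<phi> y - \<phi> x\<bar> powr q) \<partial>mu)"
      using Gker_jensen[OF elim assms _ i] by simp
    then show ?case by (simp add: abs_minus_commute)
  qed
qed

lemma Jt_add_le:
  assumes [measurable]: "\<phi> \<in> borel_measurable borel" "\<psi> \<in> borel_measurable borel" and "0 \<le> q"
  shows "Jt q t (\<lambda>x. \<phi> x + \<psi> x) \<le> ennreal (2 powr q) * (Jt q t \<phi> + Jt q t \<psi>)"
proof -
  have "Jt q t (\<lambda>x. \<phi> x + \<psi> x) \<le> (\<integral>\<^sup>+x. \<integral>\<^sup>+y. ennreal (2 powr q) *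
      (ennreal (Gker x y t) * ennreal (\<bar>\<phi> x - \<phi> y\<bar> powr q) + ennreal (Gker x y t) * ennreal (\<bar>\<psi> x - \<psi> y\<bar> powr q)) \<partial>mu \<partial>mu)"
    unfolding Jt_def
  proof (intro nn_integral_mono)
    fix x y
    have "\<bar>\<phi> x + \<psi> x - (\<phi> y + \<psi> y)\<bar> powr q \<le> 2 powr q * (\<bar>\<phi> x - \<phi> y\<bar> powr q + \<bar>\<psi> x - \<psi> y\<bar> powr q)"
      using powr_add_le[OF assms(3), of "\<phi> x - \<phi> y" "\<psi> x - \<psi> y"] by (simp add: algebra_simps)
    then have "ennreal (\<bar>\<phi> x + \<psi> x - (\<phi> y + \<psi> y)\<bar> powr q) \<le> ennreal (2 powr q) * (ennreal (\<bar>\<phi> x - \<phi> y\<bar> powr q) + ennreal (\<bar>\<psi> x - \<psi> y\<bar> powr q))"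
      by (simp add: ennreal_mult[symmetric] ennreal_plus[symmetric] ennreal_leI del: ennreal_plus)
    then have "ennreal (Gker x y t) * ennreal (\<bar>\<phi> x + \<psi> x - (\<phi> y + \<psi> y)\<bar> powr q)
      \<le> ennreal (Gker x y t) * (ennreal (2 powr q) * (ennreal (\<bar>\<phi> x - \<phi> y\<bar> powr q) + ennreal (\<bar>\<psi> x - \<psi> y\<bar> powr q)))"
      by (rule mult_left_mono) simp
    then show "ennreal (Gker x y t) * ennreal (\<bar>\<phi> x + \<psi> x - (\<phi> y + \<psi> y)\<bar> powr q)
      \<le> ennreal (2 powr q) * (ennreal (Gker x y t) * ennreal (\<bar>\<phi> x - \<phi> y\<bar> powr q) + ennreal (Gker x y t) * ennreal (\<bar>\<psi> x - \<psi> y\<bar> powr q))"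
      by (simp add: distrib_left mult_ac)
  qed
  also have "\<dots> = ennreal (2 powr q) * (Jt q t \<phi> + Jt q t \<psi>)"
    unfolding Jt_def by (simp add: nn_integral_cmult nn_integral_add)
  finally show ?thesis .
qed

lemma Jt_le_Np:
  assumes [measurable]: "\<phi> \<in> borel_measurable borel" and "0 \<le> q" "0 < t"
  shows "Jt q t \<phi> \<le> ennreal (2 powr q) * (Np q \<phi> + Np q \<phi>)"
proof -
  have "Jt q t \<phi> \<le> (\<integral>\<^sup>+x. \<integral>\<^sup>+y. ennreal (2 powr q) *
      (ennreal (Gker x y t) * ennreal (\<bar>\<phi> x\<bar> powr q) + ennreal (Gker x y t) * ennreal (\<bar>\<phi> y\<bar> powr q)) \<partial>mu \<partial>mu)"
    unfolding Jt_def
  proof (intro nn_integral_mono)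
    fix x y
    have "\<bar>\<phi> x - \<phi> y\<bar> powr q \<le> 2 powr q * (\<bar>\<phi> x\<bar> powr q + \<bar>\<phi> y\<bar> powr q)"
      using powr_add_le[OF assms(2), of "\<phi> x" "- \<phi> y"] by simp
    then have "ennreal (\<bar>\<phi> x - \<phi> y\<bar> powr q) \<le> ennreal (2 powr q) * (ennreal (\<bar>\<phi> x\<bar> powr q) + ennreal (\<bar>\<phi> y\<bar> powr q))"
      by (simp add: ennreal_mult[symmetric] ennreal_plus[symmetric] ennreal_leI del: ennreal_plus)
    then have "ennreal (Gker x y t) * ennreal (\<bar>\<phi> x - \<phi> y\<bar> powr q)
      \<le> ennreal (Gker x y t) * (ennreal (2 powr q) * (ennreal (\<bar>\<phi> x\<bar> powr q) + ennreal (\<bar>\<phi> y\<bar> powr q)))"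
      by (rule mult_left_mono) simp
    then show "ennreal (Gker x y t) * ennreal (\<bar>\<phi> x - \<phi> y\<bar> powr q)
      \<le> ennreal (2 powr q) * (ennreal (Gker x y t) * ennreal (\<bar>\<phi> x\<bar> powr q) + ennreal (Gker x y t) * ennreal (\<bar>\<phi> y\<bar> powr q))"
      by (simp add: distrib_left mult_ac)
  qed
  also have "\<dots> = ennreal (2 powr q) * (Np q \<phi> + Np q \<phi>)"
    unfolding Np_def using nn_integral_Gker_schur[OF assms(3), of "\<lambda>x. ennreal (\<bar>\<phi> x\<bar> powr q)"]
    by (simp add: nn_integral_cmult nn_integral_add)
  finally show ?thesis .
qed

lemma Jt_scale:
  assumes [measurable]: "\<phi> \<in> borel_measurable borel"
  shows "Jt q t (\<lambda>x. c * \<phi> x) = ennreal (\<bar>c\<bar> powr q) * Jt q t \<phi>"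
proof -
  have "ennreal (\<bar>c * \<phi> x - c * \<phi> y\<bar> powr q) = ennreal (\<bar>c\<bar> powr q) * ennreal (\<bar>\<phi> x - \<phi> y\<bar> powr q)" for x y
    by (simp add: right_diff_distrib[symmetric] abs_mult powr_mult ennreal_mult)
  then have "Jt q t (\<lambda>x. c * \<phi> x) = (\<integral>\<^sup>+x. \<integral>\<^sup>+y. ennreal (\<bar>c\<bar> powr q) * (ennreal (Gker x y t) * ennreal (\<bar>\<phi> x - \<phi> y\<bar> powr q)) \<partial>mu \<partial>mu)"
    unfolding Jt_def by (simp add: mult_ac)
  then show ?thesis unfolding Jt_def by (simp add: nn_integral_cmult)
qed

definition good :: "real \<Rightarrow> (real ^ 'n::{finite,linorder} \<Rightarrow> real) \<Rightarrow> bool" where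
  "good q \<phi> \<longleftrightarrow> ((\<lambda>t. Jt q t \<phi>) \<longlongrightarrow> 0) (at_right 0)"

lemma good_add:
  assumes "\<phi> \<in> borel_measurable borel" "\<psi> \<in> borel_measurable borel" "0 \<le> q" "good q \<phi>" "good q \<psi>"
  shows "good q (\<lambda>x. \<phi> x + \<psi> x)"
proof -
  have "((\<lambda>t. ennreal (2 powr q) * (Jt q t \<phi> + Jt q t \<psi>)) \<longlongrightarrow> ennreal (2 powr q) * (0 + 0)) (at_right 0)"
    using assms(4,5) unfolding good_def by (intro ennreal_tendsto_cmult tendsto_add) auto
  then have "((\<lambda>t. ennreal (2 powr q) * (Jt q t \<phi> + Jt q t \<psi>)) \<longlongrightarrow> 0) (at_right 0)" by simp
  then show ?thesis
    unfolding good_def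
    by (rule tendsto_sandwich[OF _ _ tendsto_const, rotated -1])
       (auto intro!: always_eventually Jt_add_le assms)
qed

lemma good_scale:
  assumes "\<phi> \<in> borel_measurable borel" "good q \<phi>"
  shows "good q (\<lambda>x. c * \<phi> x)"
proof -
  have "((\<lambda>t. ennreal (\<bar>c\<bar> powr q) * Jt q t \<phi>) \<longlongrightarrow> ennreal (\<bar>c\<bar> powr q) * 0) (at_right 0)"
    using assms(2) unfolding good_def by (intro ennreal_tendsto_cmult) auto
  then show ?thesis using assms(1) by (simp add: good_def Jt_scale)
qed

lemma good_limit:
  assumes \<phi>: "\<phi> \<in> borel_measurable borel" and "0 \<le> q"
    and \<psi>: "\<And>k. \<psi> k \<in> borel_measurable borel" "\<And>k. good q (\<psi> k)"
    and lim: "(\<lambda>k. Np q (\<lambda>x. \<phi> x - \<psi> k x)) \<longlonglongrightarrow> 0"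
  shows "good q \<phi>"
  unfolding good_def
proof (rule order_tendstoI)
  fix e :: ennreal assume e: "0 < e"
  \<comment> \<open>One factor 2^q comes from splitting \<phi> in \<open>Jt_add_le\<close>, the rest
    from \<open>Jt_le_Np\<close> for the difference \<phi> - \<psi> k.\<close>
  define K where "K = ennreal (2 powr q) * (ennreal (2 powr q) * 2)"
  have "((\<lambda>k. K * Np q (\<lambda>x. \<phi> x - \<psi> k x)) \<longlonglongrightarrow> K * 0)"
    using lim by (intro ennreal_tendsto_cmult) (auto simp: K_def ennreal_mult_less_top)
  then have "((\<lambda>k. K * Np q (\<lambda>x. \<phi> x - \<psi> k x)) \<longlonglongrightarrow> 0)" by simp
  then have "eventually (\<lambda>k. K * Np q (\<lambda>x. \<phi> x - \<psi> k x) < e) sequentially"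
    using e by (rule order_tendstoD)
  then obtain k where k: "K * Np q (\<lambda>x. \<phi> x - \<psi> k x) < e"
    by (auto simp: eventually_sequentially)
  have m: "(\<lambda>x. \<phi> x - \<psi> k x) \<in> borel_measurable borel" using \<phi> \<psi> by measurable
  have le: "Jt q t \<phi> \<le> ennreal (2 powr q) * Jt q t (\<psi> k) + K * Np q (\<lambda>x. \<phi> x - \<psi> k x)" if t: "0 < t" for t
  proof -
    have "Jt q t \<phi> = Jt q t (\<lambda>x. \<psi> k x + (\<phi> x - \<psi> k x))" by simp
    also have "\<dots> \<le> ennreal (2 powr q) * (Jt q t (\<psi> k) + Jt q t (\<lambda>x. \<phi> x - \<psi> k x))"
      by (rule Jt_add_le[OF \<psi>(1) m assms(2)])
    also have "\<dots> \<le> ennreal (2 powr q) * (Jt q t (\<psi> k) + ennreal (2 powr q) * (Np q (\<lambda>x. \<phi> x - \<psi> k x) + Np q (\<lambda>x. \<phi> x - \<psi> k x)))"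
      by (intro mult_left_mono add_left_mono Jt_le_Np m assms(2) t) auto
    also have "\<dots> = ennreal (2 powr q) * Jt q t (\<psi> k) + K * Np q (\<lambda>x. \<phi> x - \<psi> k x)"
      by (simp add: K_def distrib_left mult.assoc mult_2[symmetric])
    finally show ?thesis .
  qed
  have "((\<lambda>t. ennreal (2 powr q) * Jt q t (\<psi> k) + K * Np q (\<lambda>x. \<phi> x - \<psi> k x)) \<longlongrightarrow> ennreal (2 powr q) * 0 + K * Np q (\<lambda>x. \<phi> x - \<psi> k x)) (at_right 0)"
    using \<psi>(2)[of k] unfolding good_def by (intro ennreal_tendsto_cmult tendsto_add tendsto_const) auto
  then have "eventually (\<lambda>t. ennreal (2 powr q) * Jt q t (\<psi> k) + K * Np q (\<lambda>x. \<phi> x - \<psi> k x) < e) (at_right 0)"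
    by (rule order_tendstoD(2)) (use k in simp)
  moreover have "eventually (\<lambda>t::real. 0 < t) (at_right 0)" by (simp add: eventually_at_filter)
  ultimately show "eventually (\<lambda>t. Jt q t \<phi> < e) (at_right 0)"
    by eventually_elim (use le in \<open>auto intro: le_less_trans\<close>)
qed simp

text \<open>Values between 0 and 1 give |f x - f y|^q <= |f x - f y| <= L |x - y|, so the first
  moment is enough for every q. The integrand is zero unless x or y lies in B, and by symmetry both
  cases give the same bound.\<close>

lemma good_lipschitz:
  fixes f :: "real ^ 'n::{finite,linorder} \<Rightarrow> real"
  assumes q: "1 \<le> q" and f: "\<And>x. 0 \<le> f x" "\<And>x. f x \<le> 1"
    and L: "0 \<le> L" "\<And>x y. \<bar>f x - f y\<bar> \<le> L * norm (x - y)"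
    and B: "B \<in> sets borel" "emeasure mu B < \<infinity>" "\<And>x. x \<notin> B \<Longrightarrow> f x = 0"
    and [measurable]: "f \<in> borel_measurable borel"
  shows "good q f"
proof -
  note [measurable] = B(1)
  define k where "k t = 2 powr (real CARD('n) / 2) * (18 * sqrt t + 8 * t)" for t :: real
  have le: "Jt q t f \<le> ennreal (2 * L) * emeasure mu B * ennreal (k t)" if t: "0 < t" for t
  proof -
    have "Jt q t f \<le> (\<integral>\<^sup>+x. \<integral>\<^sup>+y. ennreal L * (indicator B x * (ennreal (Gker x y t) * ennreal (norm (x - y))))
         + ennreal L * (indicator B y * (ennreal (Gker x y t) * ennreal (norm (x - y)))) \<partial>mu \<partial>mu)"
      unfolding Jt_def
    proof (intro nn_integral_mono)
      fix x y
      have "\<bar>f x - f y\<bar> \<le> 1" using f[of x] f[of y] by linarith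
      then have "\<bar>f x - f y\<bar> powr q \<le> \<bar>f x - f y\<bar>"
        using q powr_mono'[of 1 q "\<bar>f x - f y\<bar>"] by simp
      also have "\<dots> \<le> (indicator B x + indicator B y) * (L * norm (x - y))"
      proof (cases "x \<in> B \<or> y \<in> B")
        case True
        then have "1 * (L * norm (x - y)) \<le> (indicator B x + indicator B y) * (L * norm (x - y))"
          using L(1) by (intro mult_right_mono) (auto simp: indicator_def)
        then show ?thesis using L(2)[of x y] by simp
      next
        case False
        then show ?thesis using B(3) by simp
      qed
      finally have "ennreal (\<bar>f x - f y\<bar> powr q) \<le> ennreal ((indicator B x + indicator B y) * (L * norm (x - y)))"
        by (rule ennreal_leI)
      also have "\<dots> = ennreal L * (indicator B x * ennreal (norm (x - y))) + ennreal L * (indicator B y * ennreal (norm (x - y)))"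
      proof -
        have i: "ennreal (indicator B z * (L * norm (x - y))) = ennreal L * (indicator B z * ennreal (norm (x - y)))" for z
          using L(1) by (cases "z \<in> B") (simp_all add: ennreal_mult)
        have "ennreal ((indicator B x + indicator B y) * (L * norm (x - y)))
          = ennreal (indicator B x * (L * norm (x - y))) + ennreal (indicator B y * (L * norm (x - y)))"
          using L(1) by (subst ennreal_plus[symmetric]) (simp_all add: distrib_right)
        then show ?thesis by (simp only: i)
      qed
      finally have "ennreal (Gker x y t) * ennreal (\<bar>f x - f y\<bar> powr q) \<le> ennreal (Gker x y t) *
         (ennreal L * (indicator B x * ennreal (norm (x - y))) + ennreal L * (indicator B y * ennreal (norm (x - y))))"
        by (rule mult_left_mono) simp
      then show "ennreal (Gker x y t) * ennreal (\<bar>f x - f y\<bar> powr q)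
        \<le> ennreal L * (indicator B x * (ennreal (Gker x y t) * ennreal (norm (x - y))))
         + ennreal L * (indicator B y * (ennreal (Gker x y t) * ennreal (norm (x - y))))"
        by (simp add: distrib_left mult_ac)
    qed
    also have "\<dots> = ennreal L * (\<integral>\<^sup>+x. \<integral>\<^sup>+y. indicator B x * (ennreal (Gker x y t) * ennreal (norm (x - y))) \<partial>mu \<partial>mu)
        + ennreal L * (\<integral>\<^sup>+x. \<integral>\<^sup>+y. indicator B y * (ennreal (Gker x y t) * ennreal (norm (x - y))) \<partial>mu \<partial>mu)"
      by (simp add: nn_integral_add nn_integral_cmult)
    also have "(\<integral>\<^sup>+x. \<integral>\<^sup>+y. indicator B y * (ennreal (Gker x y t) * ennreal (norm (x - y))) \<partial>mu \<partial>mu)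
      = (\<integral>\<^sup>+y. \<integral>\<^sup>+x. indicator B y * (ennreal (Gker x y t) * ennreal (norm (x - y))) \<partial>mu \<partial>mu)"
      by (rule mu_mu.Fubini') measurable
    also have "\<dots> = (\<integral>\<^sup>+x. \<integral>\<^sup>+y. indicator B x * (ennreal (Gker x y t) * ennreal (norm (x - y))) \<partial>mu \<partial>mu)"
      by (subst Gker_commute, subst norm_minus_commute) (rule refl)
    also have "(\<integral>\<^sup>+x. \<integral>\<^sup>+y. indicator B x * (ennreal (Gker x y t) * ennreal (norm (x - y))) \<partial>mu \<partial>mu)
      \<le> (\<integral>\<^sup>+x. ennreal (k t) * indicator B x \<partial>mu)"
    proof (rule nn_integral_mono_AE)
      show "AE x in mu. (\<integral>\<^sup>+y. indicator B x * (ennreal (Gker x y t) * ennreal (norm (x - y))) \<partial>mu) \<le> ennreal (k t) * indicator B x"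
        using AE_mu_closure
      proof eventually_elim
        case (elim x)
        have "(\<integral>\<^sup>+y. indicator B x * (ennreal (Gker x y t) * ennreal (norm (x - y))) \<partial>mu)
          = indicator B x * (\<integral>\<^sup>+y. ennreal (Gker x y t) * ennreal (norm (x - y)) \<partial>mu)"
          by (rule nn_integral_cmult) measurable
        also have "\<dots> \<le> indicator B x * ennreal (k t)"
          unfolding k_def by (intro mult_left_mono nn_integral_Gker_norm_le elim t) auto
        finally show ?case by (simp add: mult.commute)
      qed
    qed
    also have "(\<integral>\<^sup>+x. ennreal (k t) * indicator B x \<partial>mu) = ennreal (k t) * emeasure mu B"
      by (rule nn_integral_cmult_indicator) auto
    finally have "Jt q t f \<le> ennreal L * (ennreal (k t) * emeasure mu B) + ennreal L * (ennreal (k t) * emeasure mu B)"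
      by (simp add: add_mono mult_left_mono)
    also have "\<dots> = 2 * (ennreal L * (ennreal (k t) * emeasure mu B))"
      by (simp only: mult_2)
    also have "\<dots> = ennreal (2 * L) * emeasure mu B * ennreal (k t)"
      using L(1) by (simp add: ennreal_mult mult_ac)
    finally show ?thesis .
  qed
  have "((\<lambda>t. ennreal (k t)) \<longlongrightarrow> ennreal (k 0)) (at_right 0)"
    unfolding k_def by (intro tendsto_ennrealI tendsto_intros)
  then have "((\<lambda>t. ennreal (2 * L) * emeasure mu B * ennreal (k t)) \<longlongrightarrow> ennreal (2 * L) * emeasure mu B * ennreal (k 0)) (at_right 0)"
    using B(2) by (intro ennreal_tendsto_cmult) (auto simp: ennreal_mult_less_top)
  then have "((\<lambda>t. ennreal (2 * L) * emeasure mu B * ennreal (k t)) \<longlongrightarrow> 0) (at_right 0)"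
    by (simp add: k_def)
  then show ?thesis
    unfolding good_def
  proof (rule tendsto_sandwich[OF _ _ tendsto_const, rotated -1])
    show "\<forall>\<^sub>F t in at_right 0. Jt q t f \<le> ennreal (2 * L) * emeasure mu B * ennreal (k t)"
      using le by (auto simp: eventually_at_filter)
  qed simp
qed

text \<open>The truncated multiples min 1 (k dist (x, -U)) are Lipschitz and converge pointwise to
  the indicator of U, dominated by it.\<close>

lemma good_open_bounded:
  fixes U :: "(real ^ 'n::{finite,linorder}) set"
  assumes q: "1 \<le> q" and U: "open U" "U \<subseteq> ball 0 r"
  shows "good q (indicator U)"
proof -
  \<comment> \<open>The distance to the empty set is 0 by convention, so the approximation would
    fail for an empty complement.\<close>
  have ne: "- U \<noteq> {}"
  proof
    assume "- U = {}"
    then have "U = UNIV" by auto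
    then have "bounded (UNIV :: ((real, 'n) vec) set)" using U(2) bounded_ball bounded_subset by metis
    then show False by simp
  qed
  define f where "f k x = min 1 (real k * infdist x (- U))" for k :: nat and x
  have [measurable]: "f k \<in> borel_measurable borel" for k
    unfolding f_def by (intro borel_measurable_continuous_onI continuous_intros)
  have [measurable]: "U \<in> sets borel" using U by simp
  have fU: "f k x = 0" if "x \<notin> U" for k x using that by (simp add: f_def)
  have f01: "0 \<le> f k x" "f k x \<le> 1" for k x by (auto simp: f_def infdist_nonneg)
  have fin: "emeasure mu U < \<infinity>"
    using emeasure_mono[of U "ball 0 r" mu] U(2) emeasure_mu_ball[of r] by (auto intro: le_less_trans)
  have good: "good q (f k)" for k
  proof (rule good_lipschitz[OF q, where L = "real k" and B = U])
    show "\<bar>f k x - f k y\<bar> \<le> real k * norm (x - y)" for x y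
    proof -
      have "\<bar>infdist x (- U) - infdist y (- U)\<bar> \<le> dist x y" by (rule infdist_triangle_abs)
      then have "real k * \<bar>infdist x (- U) - infdist y (- U)\<bar> \<le> real k * dist x y" by (intro mult_left_mono) auto
      then have "\<bar>real k * infdist x (- U) - real k * infdist y (- U)\<bar> \<le> real k * norm (x - y)"
        by (simp add: right_diff_distrib[symmetric] abs_mult dist_norm)
      then show ?thesis unfolding f_def by linarith
    qed
  qed (use f01 fU fin in auto)
  have lim: "(\<lambda>k. Np q (\<lambda>x. indicator U x - f k x)) \<longlonglongrightarrow> (\<integral>\<^sup>+x. 0 \<partial>(mu :: ((real, 'n) vec) measure))"
    unfolding Np_def
  proof (rule nn_integral_dominated_convergence[where w = "indicator U"])
    show "AE x in mu. ennreal (\<bar>indicator U x - f k x\<bar> powr q) \<le> indicator U x" for k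
    proof (rule AE_I2)
      fix x
      show "ennreal (\<bar>indicator U x - f k x\<bar> powr q) \<le> indicator U x"
        using f01[of k x] fU[of x k] q by (cases "x \<in> U") (auto intro!: powr_le1)
    qed
    show "AE x in mu. (\<lambda>k. ennreal (\<bar>indicator U x - f k x\<bar> powr q)) \<longlonglongrightarrow> 0"
    proof (rule AE_I2)
      fix x :: "(real, 'n) vec"
      show "(\<lambda>k. ennreal (\<bar>indicator U x - f k x\<bar> powr q)) \<longlonglongrightarrow> 0"
      proof (cases "x \<in> U")
        case True
        have d: "0 < infdist x (- U)"
          using True U(1) ne by (simp add: infdist_pos_not_in_closed closed_Compl)
        obtain K :: nat where K: "1 / infdist x (- U) \<le> real K" using real_arch_simple by blast
        have "f k x = 1" if "K \<le> k" for k
        proof -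
          have "1 / infdist x (- U) \<le> real k" using K that by linarith
          then show ?thesis using d by (simp add: f_def divide_le_eq)
        qed
        then have "eventually (\<lambda>k. ennreal (\<bar>indicator U x - f k x\<bar> powr q) = 0) sequentially"
          using True by (auto simp: eventually_sequentially intro!: exI[of _ K])
        then show ?thesis by (rule tendsto_eventually)
      next
        case False
        then show ?thesis using fU by simp
      qed
    qed
  qed (use fin in auto)
  show ?thesis
    by (rule good_limit[where \<psi> = f]) (use lim good q in auto)
qed

text \<open>Since \<open>mu\<close> is infinite, outer regularity is applied to its restriction
  \<open>M\<close> to a ball containing A. Intersecting the open sets with that ball makes
  \<open>good_open_bounded\<close> applicable.\<close>

lemma good_bounded_set:
  fixes A :: "(real ^ 'n::{finite,linorder}) set"
  assumes q: "1 \<le> q" and A [measurable]: "A \<in> sets borel" and r: "A \<subseteq> ball 0 r"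
  shows "good q (indicator A)"
proof -
  define M where "M = density mu (indicator (ball (0 :: (real, 'n) vec) r))"
  have sM: "sets M = sets borel" by (simp add: M_def)
  have eM: "emeasure M B = emeasure mu (B \<inter> ball 0 r)" if "B \<in> sets borel" for B
  proof -
    note [measurable] = that
    have [measurable]: "ball (0 :: (real, 'n) vec) r \<in> sets borel" by simp
    have "emeasure M B = (\<integral>\<^sup>+x. indicator (ball 0 r) x * indicator B x \<partial>mu)"
      unfolding M_def by (rule emeasure_density) measurable
    also have "\<dots> = (\<integral>\<^sup>+x. indicator (B \<inter> ball 0 r) x \<partial>mu)"
      by (intro nn_integral_cong) (auto simp: indicator_def)
    finally show ?thesis by simp
  qed
  have finM: "emeasure M (space M) \<noteq> \<infinity>"
    using eM[of UNIV] emeasure_mu_ball[of r] by (simp add: M_def less_top)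
  have finA: "emeasure mu A < \<infinity>"
    using emeasure_mono[of A "ball 0 r" mu] r emeasure_mu_ball[of r] by (auto intro: le_less_trans)
  have "\<exists>U. open U \<and> A \<subseteq> U \<and> U \<subseteq> ball 0 r \<and> emeasure mu (U - A) \<le> ennreal (1 / real (Suc k))" for k
  proof -
    have "emeasure M A = (INF U \<in> {U. A \<subseteq> U \<and> open U}. emeasure M U)"
      by (rule outer_regular[OF sM finM A])
    moreover have "emeasure M A < emeasure M A + ennreal (1 / real (Suc k))"
    proof -
      have "emeasure M A \<noteq> \<infinity>" using eM[OF A] finA r by (simp add: Int_absorb2)
      then have "emeasure M A + 0 < emeasure M A + ennreal (1 / real (Suc k))"
        by (subst ennreal_add_left_cancel_less) auto
      then show ?thesis by simp
    qed
    ultimately have "(INF U \<in> {U. A \<subseteq> U \<and> open U}. emeasure M U) < emeasure M A + ennreal (1 / real (Suc k))"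
      by (simp only:)
    then obtain U where U: "A \<subseteq> U" "open U" "emeasure M U < emeasure M A + ennreal (1 / real (Suc k))"
      unfolding INF_less_iff by blast
    let ?U = "U \<inter> ball 0 r"
    have mU: "?U \<in> sets borel" "U \<in> sets borel" using U(2) by simp_all
    have "A \<union> (?U - A) = ?U" using U(1) r by blast
    then have "emeasure mu ?U = emeasure mu A + emeasure mu (?U - A)"
      using plus_emeasure[of A mu "?U - A"] A mU(1) by (simp add: sets.Diff)
    then have "emeasure mu A + emeasure mu (?U - A) \<le> emeasure mu A + ennreal (1 / real (Suc k))"
      using U(3) eM[OF mU(2)] eM[OF A] r by (simp only: Int_absorb2 less_imp_le)
    then have "emeasure mu (?U - A) \<le> ennreal (1 / real (Suc k))"
      using finA unfolding ennreal_add_left_cancel_le by auto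
    moreover have "open ?U" using U(2) by (rule open_Int) (rule open_ball)
    moreover have "A \<subseteq> ?U" using U(1) r by blast
    ultimately show ?thesis by blast
  qed
  then obtain U where U: "\<And>k. open (U k)" "\<And>k. A \<subseteq> U k" "\<And>k. U k \<subseteq> ball 0 r"
    "\<And>k. emeasure mu (U k - A) \<le> ennreal (1 / real (Suc k))" by metis
  have mU [measurable]: "U k \<in> sets borel" for k using borel_open[OF U(1)] .
  have "Np q (\<lambda>x. indicator A x - indicator (U k) x) = emeasure mu (U k - A)" for k
  proof -
    have "ennreal (\<bar>indicator A x - indicator (U k) x\<bar> powr q) = indicator (U k - A) x" for x
      using U(2)[of k] by (auto simp: indicator_def)
    then have "Np q (\<lambda>x. indicator A x - indicator (U k) x) = (\<integral>\<^sup>+x. indicator (U k - A) x \<partial>mu)"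
      unfolding Np_def by (simp only:)
    also have "\<dots> = emeasure mu (U k - A)" by (rule nn_integral_indicator) (simp add: sets.Diff mU A)
    finally show ?thesis .
  qed
  then have le: "Np q (\<lambda>x. indicator A x - indicator (U k) x) \<le> ennreal (1 / real (Suc k))" for k
    using U(4) by simp
  have "(\<lambda>k. ennreal (1 / real (Suc k))) \<longlonglongrightarrow> ennreal 0"
    using LIMSEQ_inverse_real_of_nat by (intro tendsto_ennrealI) (simp add: inverse_eq_divide)
  then have lim: "(\<lambda>k. ennreal (1 / real (Suc k))) \<longlonglongrightarrow> 0" by simp
  have "(\<lambda>k. Np q (\<lambda>x. indicator A x - indicator (U k) x)) \<longlonglongrightarrow> 0"
  proof (rule tendsto_sandwich[OF _ _ tendsto_const lim])
    show "\<forall>\<^sub>F k in sequentially. Np q (\<lambda>x. indicator A x - indicator (U k) x) \<le> ennreal (1 / real (Suc k))"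
      using le by (rule always_eventually[OF allI])
  qed simp
  moreover have "good q (indicator (U k))" for k by (rule good_open_bounded[OF q U(1,3)])
  moreover have "(indicator A :: (real, 'n) vec \<Rightarrow> real) \<in> borel_measurable borel"
    "(indicator (U k) :: (real, 'n) vec \<Rightarrow> real) \<in> borel_measurable borel" for k by measurable
  moreover have "0 \<le> q" using q by simp
  ultimately show ?thesis by (intro good_limit[where \<phi> = "indicator A" and \<psi> = "\<lambda>k. indicator (U k)"])
qed

lemma good_finite_set:
  fixes A :: "(real ^ 'n::{finite,linorder}) set"
  assumes q: "1 \<le> q" and A [measurable]: "A \<in> sets borel" and fin: "emeasure mu A < \<infinity>"
  shows "good q (indicator A)"
proof -
  let ?A = "\<lambda>k. A \<inter> ball 0 (real k)"
  have [measurable]: "?A k \<in> sets borel" for k by auto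
  have lim: "(\<lambda>k. Np q (\<lambda>x. indicator A x - indicator (?A k) x)) \<longlonglongrightarrow> (\<integral>\<^sup>+x. 0 \<partial>(mu :: ((real, 'n) vec) measure))"
    unfolding Np_def
  proof (rule nn_integral_dominated_convergence[where w = "indicator A"])
    show "AE x in mu. ennreal (\<bar>indicator A x - indicator (?A k) x\<bar> powr q) \<le> indicator A x" for k
      by (auto simp: indicator_def)
    show "AE x in mu. (\<lambda>k. ennreal (\<bar>indicator A x - indicator (?A k) x\<bar> powr q)) \<longlonglongrightarrow> 0"
    proof (rule AE_I2)
      fix x :: "(real, 'n) vec"
      obtain K :: nat where "norm x < real K" using reals_Archimedean2 by blast
      then have "eventually (\<lambda>k. ennreal (\<bar>indicator A x - indicator (?A k) x\<bar> powr q) = 0) sequentially"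
        by (auto simp: eventually_sequentially indicator_def intro!: exI[of _ K])
      then show "(\<lambda>k. ennreal (\<bar>indicator A x - indicator (?A k) x\<bar> powr q)) \<longlonglongrightarrow> 0"
        by (rule tendsto_eventually)
    qed
  qed (use fin in auto)
  then have "(\<lambda>k. Np q (\<lambda>x. indicator A x - indicator (?A k) x)) \<longlonglongrightarrow> 0" by simp
  moreover have "good q (indicator (?A k))" for k by (rule good_bounded_set[OF q, of _ "real k"]) auto
  moreover have "(indicator A :: (real, 'n) vec \<Rightarrow> real) \<in> borel_measurable borel"
    "(indicator (?A k) :: (real, 'n) vec \<Rightarrow> real) \<in> borel_measurable borel" for k by measurable
  moreover have "0 \<le> q" using q by simp
  ultimately show ?thesis by (intro good_limit[where \<phi> = "indicator A" and \<psi> = "\<lambda>k. indicator (?A k)"])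
qed

text \<open>Finiteness of the norm stands inside the conclusion because in the induction each
  approximant inherits it from the limit. Dominated convergence then lets \<open>good_limit\<close>
  close the monotone step.\<close>

lemma good_nonneg:
  fixes u :: "real ^ 'n::{finite,linorder} \<Rightarrow> real"
  assumes q: "1 \<le> q" and u: "u \<in> borel_measurable borel" and nn: "\<And>x. 0 \<le> u x"
  shows "Np q u < \<infinity> \<longrightarrow> good q u"
  using u nn
proof (induction u rule: borel_measurable_induct_real)
  case (set A)
  have "Np q (indicator A) = emeasure mu A"
  proof -
    have "ennreal (\<bar>indicator A x\<bar> powr q) = indicator A x" for x
      using q by (auto simp: indicator_def)
    then show ?thesis unfolding Np_def using set by simp
  qed
  then show ?case using good_finite_set[OF q set] by simp
next
  case (mult u c)
  show ?case
  proof (cases "c = 0")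
    case True
    have "Jt q t (\<lambda>x::(real, 'n) vec. 0) = 0" for t by (simp add: Jt_def)
    then show ?thesis using True by (simp add: good_def)
  next
    case False
    have "Np q (\<lambda>x. c * u x) = ennreal (\<bar>c\<bar> powr q) * Np q u"
      unfolding Np_def using mult(2)
      by (subst nn_integral_cmult[symmetric]) (auto simp: abs_mult powr_mult ennreal_mult)
    then have "Np q (\<lambda>x. c * u x) < \<infinity> \<Longrightarrow> Np q u < \<infinity>"
      using False by (auto simp: ennreal_mult_less_top)
    then show ?thesis using mult good_scale by blast
  qed
next
  case (add u v)
  have "Np q u \<le> Np q (\<lambda>x. v x + u x)" "Np q v \<le> Np q (\<lambda>x. v x + u x)"
    unfolding Np_def using add q by (auto intro!: nn_integral_mono ennreal_leI powr_mono2)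
  then show ?case
    using add q by (auto intro!: good_add intro: le_less_trans)
next
  case (seq U)
  show ?case
  proof
    assume fin: "Np q u < \<infinity>"
    have [measurable]: "U i \<in> borel_measurable borel" "u \<in> borel_measurable borel" for i
      using seq u by auto
    have Ule: "U i x \<le> u x" for i x
      using seq by (intro incseq_le[of "\<lambda>i. U i x"]) (auto simp: incseq_def le_fun_def)
    have Unn: "0 \<le> U i x" for i x using seq by auto
    have "Np q (U i) \<le> Np q u" for i
      unfolding Np_def using Ule Unn q
      by (auto intro!: nn_integral_mono ennreal_leI powr_mono2) (metis abs_ge_self order_trans)
    then have "Np q (U i) < \<infinity>" for i using fin by (rule le_less_trans)
    then have good: "good q (U i)" for i using seq by blast
    have lim: "(\<lambda>i. Np q (\<lambda>x. u x - U i x)) \<longlonglongrightarrow> (\<integral>\<^sup>+x. 0 \<partial>(mu :: ((real, 'n) vec) measure))"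
      unfolding Np_def
    proof (rule nn_integral_dominated_convergence[where w = "\<lambda>x. ennreal (\<bar>u x\<bar> powr q)"])
      show "AE x in mu. ennreal (\<bar>u x - U i x\<bar> powr q) \<le> ennreal (\<bar>u x\<bar> powr q)" for i
      proof (intro AE_I2 ennreal_leI powr_mono2)
        show "\<bar>u x - U i x\<bar> \<le> \<bar>u x\<bar>" for x using Ule[of i x] Unn[of i x] by linarith
      qed (use q in auto)
      show "AE x in mu. (\<lambda>i. ennreal (\<bar>u x - U i x\<bar> powr q)) \<longlonglongrightarrow> 0"
      proof (rule AE_I2)
        fix x
        have "(\<lambda>i. U i x) \<longlonglongrightarrow> u x" using seq by auto
        then have "(\<lambda>i. \<bar>u x - U i x\<bar>) \<longlonglongrightarrow> \<bar>u x - u x\<bar>" by (intro tendsto_intros)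
        then have "(\<lambda>i. \<bar>u x - U i x\<bar> powr q) \<longlonglongrightarrow> 0 powr q"
          using q by (intro tendsto_powr') auto
        then show "(\<lambda>i. ennreal (\<bar>u x - U i x\<bar> powr q)) \<longlonglongrightarrow> 0"
          using tendsto_ennrealI by fastforce
      qed
    qed (use fin in \<open>auto simp: Np_def\<close>)
    show "good q u"
      by (rule good_limit[where \<psi> = U]) (use lim q good in auto)
  qed
qed

lemma good_of_Np:
  fixes \<phi> :: "real ^ 'n::{finite,linorder} \<Rightarrow> real"
  assumes q: "1 \<le> q" and [measurable]: "\<phi> \<in> borel_measurable borel" and fin: "Np q \<phi> < \<infinity>"
  shows "good q \<phi>"
proof -
  let ?p = "\<lambda>x. max 0 (\<phi> x)" and ?m = "\<lambda>x. max 0 (- \<phi> x)"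
  have "Np q ?p \<le> Np q \<phi>" "Np q ?m \<le> Np q \<phi>"
    unfolding Np_def using q by (auto intro!: nn_integral_mono ennreal_leI powr_mono2)
  then have "good q ?p" "good q ?m"
    using good_nonneg[OF q, of ?p] good_nonneg[OF q, of ?m] fin by (auto intro: le_less_trans)
  then have "good q (\<lambda>x. ?p x + (- 1) * ?m x)"
    using q by (intro good_add good_scale) auto
  moreover have "(\<lambda>x. ?p x + (- 1) * ?m x) = \<phi>" by (auto simp: max_def)
  ultimately show ?thesis by simp
qed

lemma Np_Pt_diff_tendsto:
  fixes \<phi> :: "real ^ 'n::{finite,linorder} \<Rightarrow> real"
  assumes q: "1 \<le> q" and [measurable]: "\<phi> \<in> borel_measurable borel" and fin: "Np q \<phi> < \<infinity>"
  shows "((\<lambda>t. Np q (\<lambda>x. Pt t \<phi> x - \<phi> x)) \<longlongrightarrow> 0) (at_right 0)"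
proof -
  interpret datum \<phi> by (rule datum_of_Np) fact+
  have "((\<lambda>t. Jt q t \<phi>) \<longlongrightarrow> 0) (at_right 0)"
    using good_of_Np[OF assms] by (simp add: good_def)
  then show ?thesis
  proof (rule tendsto_sandwich[OF _ _ tendsto_const, rotated -1])
    show "\<forall>\<^sub>F t in at_right 0. Np q (\<lambda>x. Pt t \<phi> x - \<phi> x) \<le> Jt q t \<phi>"
      using Np_Pt_diff_le q by (auto simp: eventually_at_filter)
  qed simp
qed

section \<open>Gluing interior and boundary data\<close>

lemma nn_integral_lebesgue_on_Omega:
  "(\<integral>\<^sup>+x. f x \<partial>lebesgue_on Omega) = (\<integral>\<^sup>+x. indicator Omega x * f x \<partial>lborel)"
  by (subst nn_integral_restrict_space) (auto simp: nn_integral_completion mult.commute)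

lemma AE_bdry_frontier: "AE x in bdry. x \<in> frontier Omega"
  using AE_bdry by (simp add: frontier_Omega)

lemma nn_integral_surface_measure: "(\<integral>\<^sup>+x. f x \<partial>surface_measure) = (\<integral>\<^sup>+x. f x \<partial>bdry)"
proof -
  have "(\<integral>\<^sup>+x. f x \<partial>surface_measure) = (\<integral>\<^sup>+x. f x * indicator (frontier Omega) x \<partial>bdry)"
    unfolding surface_measure_eq nn_integral_completion by (subst nn_integral_restrict_space) auto
  also have "\<dots> = (\<integral>\<^sup>+x. f x \<partial>bdry)"
    using AE_bdry_frontier by (intro nn_integral_cong_AE) (auto elim!: eventually_mono)
  finally show ?thesis .
qed

lemma AE_lebesgue_on_Omega: "(AE x in lebesgue_on Omega. P x) \<longleftrightarrow> (AE x in lborel. x \<in> Omega \<longrightarrow> P x)"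
  by (subst AE_restrict_space_iff) (auto simp: AE_completion_iff)

lemma AE_surface_measure: "(AE x in surface_measure. P x) \<longleftrightarrow> (AE x in bdry. P x)"
proof -
  have "(AE x in surface_measure. P x) \<longleftrightarrow> (AE x in bdry. x \<in> frontier Omega \<longrightarrow> P x)"
    unfolding surface_measure_eq AE_completion_iff by (subst AE_restrict_space_iff) auto
  also have "\<dots> \<longleftrightarrow> (AE x in bdry. P x)"
    using AE_bdry_frontier by (auto elim!: eventually_rev_mp)
  finally show ?thesis .
qed

lemma space_surface_measure: "space surface_measure = frontier Omega"
  by (simp add: surface_measure_eq space_restrict_space)

lemma borel_measurable_lebesgue_on_Omega: "f \<in> borel_measurable borel \<Longrightarrow> f \<in> borel_measurable (lebesgue_on Omega)"
  by (intro measurable_restrict_space1 measurable_completion) simp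

lemma borel_measurable_surface_measure: "f \<in> borel_measurable borel \<Longrightarrow> f \<in> borel_measurable surface_measure"
  unfolding surface_measure_eq
  by (intro measurable_completion measurable_restrict_space1) (simp cong: measurable_cong_sets)

lemma nn_integral_mu_split:
  assumes [measurable]: "f \<in> borel_measurable borel"
  shows "(\<integral>\<^sup>+x. f x \<partial>mu) = (\<integral>\<^sup>+x. f x \<partial>lebesgue_on Omega) + (\<integral>\<^sup>+x. f x \<partial>surface_measure)"
  by (simp add: nn_integral_mu nn_integral_lebesgue_on_Omega nn_integral_surface_measure)

lemma AE_mu_split:
  assumes "Measurable.pred borel P"
  shows "(AE x in mu. P x) \<longleftrightarrow> (AE x in lebesgue_on Omega. P x) \<and> (AE x in surface_measure. P x)"
  using AE_mu_iff[OF assms] by (simp add: AE_lebesgue_on_Omega AE_surface_measure)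

lemma integral_mu_split:
  fixes f :: "real ^ 'n::{finite,linorder} \<Rightarrow> real"
  assumes f: "integrable mu f"
  shows "integrable (lebesgue_on Omega) f" "integrable surface_measure f"
    and "(\<integral>x. f x \<partial>mu) = (\<integral>x. f x \<partial>lebesgue_on Omega) + (\<integral>x. f x \<partial>surface_measure)"
proof -
  have m [measurable]: "f \<in> borel_measurable borel"
    using borel_measurable_integrable[OF f] by (simp cong: measurable_cong_sets)
  have fin: "(\<integral>\<^sup>+x. ennreal (norm (f x)) \<partial>lebesgue_on Omega) < \<infinity>" "(\<integral>\<^sup>+x. ennreal (norm (f x)) \<partial>surface_measure) < \<infinity>"
    using f nn_integral_mu_split[of "\<lambda>x. ennreal (norm (f x))"] by (auto simp: integrable_iff_bounded)
  show i1: "integrable (lebesgue_on Omega) f" and i2: "integrable surface_measure f"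
    using fin m by (auto simp: integrable_iff_bounded intro: borel_measurable_lebesgue_on_Omega borel_measurable_surface_measure)
  have pos: "(\<integral>\<^sup>+x. ennreal (g x) \<partial>lebesgue_on Omega) < \<infinity>" "(\<integral>\<^sup>+x. ennreal (g x) \<partial>surface_measure) < \<infinity>"
    if "\<And>x. g x \<le> norm (f x)" for g
    using that le_less_trans[OF nn_integral_mono fin(1), of "\<lambda>x. ennreal (g x)"]
      le_less_trans[OF nn_integral_mono fin(2), of "\<lambda>x. ennreal (g x)"] by (auto intro: ennreal_leI)
  have p1: "(\<integral>\<^sup>+x. ennreal (f x) \<partial>lebesgue_on Omega) < \<infinity>" "(\<integral>\<^sup>+x. ennreal (f x) \<partial>surface_measure) < \<infinity>"
    by (rule pos; simp)+
  have p2: "(\<integral>\<^sup>+x. ennreal (- f x) \<partial>lebesgue_on Omega) < \<infinity>" "(\<integral>\<^sup>+x. ennreal (- f x) \<partial>surface_measure) < \<infinity>"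
    by (rule pos; simp)+
  show "(\<integral>x. f x \<partial>mu) = (\<integral>x. f x \<partial>lebesgue_on Omega) + (\<integral>x. f x \<partial>surface_measure)"
    unfolding real_lebesgue_integral_def[OF f] real_lebesgue_integral_def[OF i1] real_lebesgue_integral_def[OF i2]
    using p1 p2 by (simp add: nn_integral_mu_split enn2real_plus)
qed

text \<open>Measurable functions for a completion agree almost everywhere with Borel ones. The
  domain and its boundary are disjoint, so the two representatives combine into one Borel function
  on the whole space.\<close>

lemma glue:
  fixes \<phi>i \<phi>b :: "real ^ 'n::{finite,linorder} \<Rightarrow> real"
  assumes "\<phi>i \<in> borel_measurable (lebesgue_on Omega)" "\<phi>b \<in> borel_measurable surface_measure"
  obtains \<phi> where "\<phi> \<in> borel_measurable borel" "AE x in lebesgue_on Omega. \<phi>i x = \<phi> x"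
    "AE x in surface_measure. \<phi>b x = \<phi> x"
proof -
  have "(\<lambda>x. indicator Omega x *\<^sub>R \<phi>i x) \<in> borel_measurable lebesgue"
    using assms(1) by (subst (asm) borel_measurable_restrict_space_iff) auto
  from completion_ex_borel_measurable_real[OF this]
  obtain f where f: "f \<in> borel_measurable lborel" "AE x in lborel. indicator Omega x *\<^sub>R \<phi>i x = f x" by blast
  obtain g where g: "g \<in> borel_measurable (restrict_space bdry (frontier Omega))"
    "AE x in restrict_space bdry (frontier Omega). \<phi>b x = g x"
    using completion_ex_borel_measurable_real[OF assms(2)[unfolded surface_measure_eq]] by blast
  have g': "(\<lambda>x. indicator (frontier Omega) x *\<^sub>R g x) \<in> borel_measurable borel"
    using g(1) by (subst (asm) borel_measurable_restrict_space_iff) (auto cong: measurable_cong_sets)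
  define \<phi> where "\<phi> x = (if x \<in> Omega then f x else indicator (frontier Omega) x *\<^sub>R g x)" for x
  have "\<phi> \<in> borel_measurable borel"
    unfolding \<phi>_def using f(1) g' by (intro measurable_If_set) auto
  moreover have "AE x in lebesgue_on Omega. \<phi>i x = \<phi> x"
    unfolding AE_lebesgue_on_Omega using f(2) by eventually_elim (auto simp: \<phi>_def)
  moreover have "AE x in surface_measure. \<phi>b x = \<phi> x"
  proof -
    have "AE x in bdry. x \<in> frontier Omega \<longrightarrow> \<phi>b x = g x"
      using g(2) by (subst (asm) AE_restrict_space_iff) auto
    moreover have "x \<notin> Omega" if "x \<in> frontier Omega" for x :: "(real, 'n) vec"
      using that unfolding frontier_Omega by (simp add: Omega_def)
    ultimately show ?thesis
      unfolding AE_surface_measure using AE_bdry_frontier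
      by (auto simp: \<phi>_def elim!: eventually_elim2)
  qed
  ultimately show ?thesis by (rule that)
qed

section \<open>Comparison of the joint norm, the pair norm and the norm for
  \<open>mu\<close>\<close>

lemma ennpow_mono: "a \<le> b \<Longrightarrow> 0 \<le> p \<Longrightarrow> ennpow a p \<le> ennpow b p"
  by (auto simp: ennpow_def top_unique less_top intro!: ennreal_leI powr_mono2 enn2real_mono)

lemma ennpow_inverse: "0 < p \<Longrightarrow> ennpow (ennpow a (1 / p)) p = a"
  by (cases a) (auto simp: ennpow_def powr_powr)

lemma ennpow_inverse': "0 < p \<Longrightarrow> ennpow (ennpow a p) (1 / p) = a"
  by (cases a) (auto simp: ennpow_def powr_powr)

lemma enn2real_ge_1: "1 \<le> q \<Longrightarrow> q < \<infinity> \<Longrightarrow> 1 \<le> enn2real q"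
  using enn2real_mono[of 1 q] by simp

lemma esssup_le_iff:
  assumes "f \<in> borel_measurable M"
  shows "esssup M f \<le> (c :: ennreal) \<longleftrightarrow> (AE x in M. f x \<le> c)"
proof
  assume "esssup M f \<le> c"
  with esssup_AE[of f M] show "AE x in M. f x \<le> c" by (auto elim!: eventually_mono)
qed (rule esssup_I[OF assms])

lemma joint_norm_eq_Lnorm_mu:
  fixes F :: "real ^ 'n::{finite,linorder} \<Rightarrow> real"
  assumes F: "F \<in> borel_measurable (lebesgue_on Omega)" "AE x in lebesgue_on Omega. F x = h x"
    and G: "G \<in> borel_measurable surface_measure" "AE x in surface_measure. G x = h x"
    and h [measurable]: "h \<in> borel_measurable borel" and q: "1 \<le> q"
  shows "joint_norm q F G = Lnorm q mu h"
proof (cases "q = \<infinity>")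
  case True
  \<comment> \<open>Two elements with the same upper bounds are equal. An upper bound of an
    essential supremum is an almost everywhere statement, and such statements split over the two
    parts of \<open>mu\<close>.\<close>
  have "max (esssup (lebesgue_on Omega) (\<lambda>x. ennreal \<bar>F x\<bar>)) (esssup surface_measure (\<lambda>x. ennreal \<bar>G x\<bar>)) \<le> c
     \<longleftrightarrow> esssup mu (\<lambda>x. ennreal \<bar>h x\<bar>) \<le> c" for c
  proof -
    have "max (esssup (lebesgue_on Omega) (\<lambda>x. ennreal \<bar>F x\<bar>)) (esssup surface_measure (\<lambda>x. ennreal \<bar>G x\<bar>)) \<le> c
      \<longleftrightarrow> (AE x in lebesgue_on Omega. ennreal \<bar>F x\<bar> \<le> c) \<and> (AE x in surface_measure. ennreal \<bar>G x\<bar> \<le> c)"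
      using F(1) G(1) by (simp add: esssup_le_iff)
    also have "(AE x in lebesgue_on Omega. ennreal \<bar>F x\<bar> \<le> c) \<longleftrightarrow> (AE x in lebesgue_on Omega. ennreal \<bar>h x\<bar> \<le> c)"
      using F(2) by (intro eventually_subst) (auto elim!: eventually_mono)
    also have "(AE x in surface_measure. ennreal \<bar>G x\<bar> \<le> c) \<longleftrightarrow> (AE x in surface_measure. ennreal \<bar>h x\<bar> \<le> c)"
      using G(2) by (intro eventually_subst) (auto elim!: eventually_mono)
    also have "(AE x in lebesgue_on Omega. ennreal \<bar>h x\<bar> \<le> c) \<and> (AE x in surface_measure. ennreal \<bar>h x\<bar> \<le> c) \<longleftrightarrow> (AE x in mu. ennreal \<bar>h x\<bar> \<le> c)"
      by (rule AE_mu_split[symmetric]) measurable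
    also have "\<dots> \<longleftrightarrow> esssup mu (\<lambda>x. ennreal \<bar>h x\<bar>) \<le> c"
      by (subst esssup_le_iff) auto
    finally show ?thesis .
  qed
  note eq = this
  have "max (esssup (lebesgue_on Omega) (\<lambda>x. ennreal \<bar>F x\<bar>)) (esssup surface_measure (\<lambda>x. ennreal \<bar>G x\<bar>))
     = esssup mu (\<lambda>x. ennreal \<bar>h x\<bar>)"
    by (rule order.antisym) (simp_all only: eq order_refl eq[symmetric])
  then show ?thesis
    using True by (simp add: joint_norm_def Lnorm_def)
next
  case False
  define p where "p = enn2real q"
  have p: "1 \<le> p" using enn2real_ge_1[OF q] False by (simp add: p_def less_top)
  have "(\<integral>\<^sup>+x. ennreal (\<bar>F x\<bar> powr p) \<partial>lebesgue_on Omega) = (\<integral>\<^sup>+x. ennreal (\<bar>h x\<bar> powr p) \<partial>lebesgue_on Omega)"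
    using F(2) by (intro nn_integral_cong_AE) (auto elim!: eventually_mono)
  moreover have "(\<integral>\<^sup>+x. ennreal (\<bar>G x\<bar> powr p) \<partial>surface_measure) = (\<integral>\<^sup>+x. ennreal (\<bar>h x\<bar> powr p) \<partial>surface_measure)"
    using G(2) by (intro nn_integral_cong_AE) (auto elim!: eventually_mono)
  ultimately show ?thesis
    using False p by (simp add: joint_norm_def Lnorm_def p_def[symmetric] ennpow_inverse nn_integral_mu_split)
qed

text \<open>The p-th power is superadditive for p >= 1, because z^p <= z (x + y)^(p - 1) for z = x
  and for z = y.\<close>

lemma joint_norm_le_pair_norm:
  assumes q: "1 \<le> q"
  shows "joint_norm q F G \<le> pair_norm q F G"
proof (cases "q = \<infinity>")
  case True
  then show ?thesis by (simp add: joint_norm_def pair_norm_def add_increasing add_increasing2)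
next
  case False
  define p where "p = enn2real q"
  have p: "1 \<le> p" using enn2real_ge_1[OF q] False by (simp add: p_def less_top)
  have "ennpow a p + ennpow b p \<le> ennpow (a + b) p" for a b :: ennreal
  proof (cases "a = \<infinity> \<or> b = \<infinity>")
    case True
    then show ?thesis by (auto simp: ennpow_def)
  next
    case False
    define x y where "x = enn2real a" and "y = enn2real b"
    have xy: "0 \<le> x" "0 \<le> y" "enn2real (a + b) = x + y"
      using False by (auto simp: x_def y_def enn2real_plus less_top)
    have "z powr p \<le> z * (x + y) powr (p - 1)" if "0 \<le> z" "z \<le> x + y" for z
    proof -
      have "z powr p = z * z powr (p - 1)" using that by (simp add: powr_mult_base)
      also have "\<dots> \<le> z * (x + y) powr (p - 1)" using that p by (intro mult_left_mono powr_mono2) auto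
      finally show ?thesis .
    qed
    from this[of x] this[of y] have "x powr p + y powr p \<le> (x + y) * (x + y) powr (p - 1)"
      using xy by (simp add: distrib_right)
    also have "\<dots> = (x + y) powr p" using xy by (simp add: powr_mult_base)
    finally have "ennreal (x powr p) + ennreal (y powr p) \<le> ennreal ((x + y) powr p)"
      by (simp add: ennreal_plus[symmetric] ennreal_leI del: ennreal_plus)
    then show ?thesis using False xy by (simp add: ennpow_def x_def y_def)
  qed
  then have "ennpow (ennpow (Lnorm q (lebesgue_on Omega) F) p + ennpow (Lnorm q surface_measure G) p) (1 / p)
    \<le> ennpow (ennpow (Lnorm q (lebesgue_on Omega) F + Lnorm q surface_measure G) p) (1 / p)"
    using p by (intro ennpow_mono) auto
  then show ?thesis
    using False p by (simp add: joint_norm_def pair_norm_def p_def[symmetric] ennpow_inverse')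
qed

lemma pair_norm_le_joint_norm:
  assumes q: "1 \<le> q"
  shows "pair_norm q F G \<le> 2 * joint_norm q F G"
proof -
  have "Lnorm q (lebesgue_on Omega) F \<le> joint_norm q F G \<and> Lnorm q surface_measure G \<le> joint_norm q F G"
  proof (cases "q = \<infinity>")
    case True
    then show ?thesis by (simp add: joint_norm_def)
  next
    case False
    define p where "p = enn2real q"
    have p: "1 \<le> p" using enn2real_ge_1[OF q] False by (simp add: p_def less_top)
    let ?a = "Lnorm q (lebesgue_on Omega) F" and ?b = "Lnorm q surface_measure G"
    have "ennpow (ennpow ?a p) (1 / p) \<le> ennpow (ennpow ?a p + ennpow ?b p) (1 / p)"
      "ennpow (ennpow ?b p) (1 / p) \<le> ennpow (ennpow ?a p + ennpow ?b p) (1 / p)"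
      using p by (intro ennpow_mono; simp)+
    then show ?thesis
      using False p by (simp add: joint_norm_def p_def[symmetric] ennpow_inverse')
  qed
  then show ?thesis by (simp add: pair_norm_def mult_2 add_mono)
qed

lemma Lnorm_mu_eq_Np: "q \<noteq> \<infinity> \<Longrightarrow> Lnorm q mu \<phi> = ennpow (Np (enn2real q) \<phi>) (1 / enn2real q)"
  by (simp add: Lnorm_def Np_def)

lemma Np_finite_of_Lnorm: "q \<noteq> \<infinity> \<Longrightarrow> Lnorm q mu \<phi> < \<infinity> \<Longrightarrow> Np (enn2real q) \<phi> < \<infinity>"
  by (auto simp: Lnorm_mu_eq_Np ennpow_def less_top split: if_splits)

lemma AE_le_of_Lnorm_infinity:
  assumes "Lnorm \<infinity> mu \<phi> < \<infinity>"
  shows "AE y in mu. \<bar>\<phi> y\<bar> \<le> enn2real (Lnorm \<infinity> mu \<phi>)"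
proof -
  have "AE y in mu. ennreal \<bar>\<phi> y\<bar> \<le> Lnorm \<infinity> mu \<phi>"
    using esssup_AE[of "\<lambda>y. ennreal \<bar>\<phi> y\<bar>" mu] by (simp add: Lnorm_def)
  then show ?thesis
  proof eventually_elim
    case (elim y)
    then have "enn2real (ennreal \<bar>\<phi> y\<bar>) \<le> enn2real (Lnorm \<infinity> mu \<phi>)"
      using assms by (intro enn2real_mono) auto
    then show ?case by simp
  qed
qed

lemma datum_of_Lnorm:
  assumes "\<phi> \<in> borel_measurable borel" "1 \<le> q" "Lnorm q mu \<phi> < \<infinity>"
  shows "datum \<phi>"
proof (cases "q = \<infinity>")
  case True
  then show ?thesis using assms AE_le_of_Lnorm_infinity by (blast intro: datum_of_bounded)
next
  case False
  then show ?thesis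
    using assms by (intro datum_of_Np[of _ "enn2real q"] Np_finite_of_Lnorm enn2real_ge_1) (auto simp: less_top)
qed

lemma Gsup_pos: "0 < t \<Longrightarrow> 0 < Gsup N t"
  unfolding Gsup_def by (intro add_pos_nonneg mult_pos_pos mult_nonneg_nonneg flux_const_nonneg) auto

text \<open>The theorem forms 1 / q in \<open>ennreal\<close>, where infinite exponents have
  reciprocal 0; for finite ones this recovers the real reciprocal.\<close>

lemma enn2real_inverse: "1 \<le> q \<Longrightarrow> q \<noteq> \<infinity> \<Longrightarrow> enn2real (1 / q) = 1 / enn2real q"
proof -
  assume q: "1 \<le> q" "q \<noteq> \<infinity>"
  then have "1 \<le> enn2real q" by (intro enn2real_ge_1) (auto simp: less_top)
  then have "ennreal 1 / ennreal (enn2real q) = ennreal (1 / enn2real q)"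
    by (intro divide_ennreal) auto
  then have "1 / q = ennreal (1 / enn2real q)" using q by (simp add: less_top)
  then show ?thesis by simp
qed

section \<open>The smoothing estimate by interpolation\<close>

text \<open>For finite r the s-th power of |P_t \<phi>|, with s = r, is split into powers s - p and
  p, with p = q: the pointwise bound controls the first factor and contraction the second. For r
  infinite the pointwise bound alone is used, and for q infinite the maximum principle.\<close>

lemma (in datum) Lnorm_Pt_le:
  assumes t: "0 < t" and q: "1 \<le> q" "q \<le> r" and fin: "Lnorm q mu \<phi> < \<infinity>"
  shows "Lnorm r mu (Pt t \<phi>) \<le> ennreal (Gsup CARD('n) t powr (enn2real (1 / q) - enn2real (1 / r))) * Lnorm q mu \<phi>"
proof -
  let ?A = "Gsup CARD('n) t"
  have A: "0 < ?A" by (rule Gsup_pos[OF t])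
  have mP [measurable]: "Pt t \<phi> \<in> borel_measurable borel" by measurable
  show ?thesis
  proof (cases "q = \<infinity>")
    case True
    then have r: "r = \<infinity>" using q by (simp add: top_unique)
    have "AE x in mu. ennreal \<bar>Pt t \<phi> x\<bar> \<le> Lnorm \<infinity> mu \<phi>"
      using AE_mu_closure
    proof eventually_elim
      case (elim x)
      have "\<bar>Pt t \<phi> x\<bar> \<le> enn2real (Lnorm \<infinity> mu \<phi>)"
        using fin True by (intro Pt_le_of_bounded elim t AE_le_of_Lnorm_infinity) auto
      then have "ennreal \<bar>Pt t \<phi> x\<bar> \<le> ennreal (enn2real (Lnorm \<infinity> mu \<phi>))" by (rule ennreal_leI)
      also have "\<dots> = Lnorm \<infinity> mu \<phi>" using fin True by (intro ennreal_enn2real) simp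
      finally show ?case .
    qed
    then have "Lnorm \<infinity> mu (Pt t \<phi>) \<le> Lnorm \<infinity> mu \<phi>"
      unfolding Lnorm_def[of _ _ "Pt t \<phi>"] by (simp, intro esssup_I) auto
    then show ?thesis using True r A by simp
  next
    case False
    define p where "p = enn2real q"
    have p: "1 \<le> p" using enn2real_ge_1[OF q(1)] False by (simp add: p_def less_top)
    have Nfin: "Np p \<phi> < \<infinity>" unfolding p_def using False fin by (rule Np_finite_of_Lnorm)
    define n where "n = enn2real (Np p \<phi>)"
    have n: "Np p \<phi> = ennreal n" "0 \<le> n" using Nfin by (auto simp: n_def)
    have Lq: "Lnorm q mu \<phi> = ennreal (n powr (1 / p))"
      using False n by (simp add: Lnorm_mu_eq_Np p_def[symmetric] ennpow_def)
    have sup: "\<bar>Pt t \<phi> x\<bar> powr p \<le> ?A * n" if "x \<in> closure Omega" for x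
    proof -
      have "ennreal (\<bar>Pt t \<phi> x\<bar> powr p) \<le> ennreal (?A * n)"
        using Pt_powr_le_sup[OF that t p] A n by (simp add: ennreal_mult)
      then show ?thesis using A n by (subst (asm) ennreal_le_iff) auto
    qed
    have sup': "\<bar>Pt t \<phi> x\<bar> \<le> (?A * n) powr (1 / p)" if "x \<in> closure Omega" for x
    proof -
      have "(\<bar>Pt t \<phi> x\<bar> powr p) powr (1 / p) \<le> (?A * n) powr (1 / p)"
        using p by (intro powr_mono2 sup that) auto
      then show ?thesis using p by (simp add: powr_powr)
    qed
    show ?thesis
    proof (cases "r = \<infinity>")
      case True
      have "AE x in mu. ennreal \<bar>Pt t \<phi> x\<bar> \<le> ennreal ((?A * n) powr (1 / p))"
        using AE_mu_closure by eventually_elim (intro ennreal_leI sup')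
      then have "Lnorm \<infinity> mu (Pt t \<phi>) \<le> ennreal ((?A * n) powr (1 / p))"
        unfolding Lnorm_def[of _ _ "Pt t \<phi>"] by (simp, intro esssup_I) auto
      also have "\<dots> = ennreal (?A powr (1 / p)) * ennreal (n powr (1 / p))"
        using A n by (simp add: powr_mult ennreal_mult)
      finally show ?thesis using True by (simp add: Lq enn2real_inverse[OF q(1) False] p_def)
    next
      case rfin: False
      define s where "s = enn2real r"
      have s: "p \<le> s" unfolding p_def s_def using q rfin by (intro enn2real_mono) (auto simp: less_top)
      \<comment> \<open>Chosen so that p e + p = s. After the s-th root the exponents are e / s = 1
        / p - 1 / s for the kernel bound and (e + 1) / s = 1 / p for the datum.\<close>
      define e where "e = (s - p) / p"
      have e: "0 \<le> e" using s p by (simp add: e_def)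
      have "Np s (Pt t \<phi>) \<le> (\<integral>\<^sup>+x. ennreal ((?A * n) powr e) * ennreal (\<bar>Pt t \<phi> x\<bar> powr p) \<partial>mu)"
        unfolding Np_def
      proof (rule nn_integral_mono_AE)
        show "AE x in mu. ennreal (\<bar>Pt t \<phi> x\<bar> powr s) \<le> ennreal ((?A * n) powr e) * ennreal (\<bar>Pt t \<phi> x\<bar> powr p)"
          using AE_mu_closure
        proof eventually_elim
          case (elim x)
          have "p * e + p = s" using p by (simp add: e_def)
          then have "\<bar>Pt t \<phi> x\<bar> powr s = (\<bar>Pt t \<phi> x\<bar> powr p) powr e * \<bar>Pt t \<phi> x\<bar> powr p"
            by (simp add: powr_powr powr_add[symmetric])
          also have "\<dots> \<le> (?A * n) powr e * \<bar>Pt t \<phi> x\<bar> powr p"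
            using e by (intro mult_right_mono powr_mono2 sup elim) auto
          finally show ?case by (simp add: ennreal_mult[symmetric] ennreal_leI)
        qed
      qed
      also have "\<dots> = ennreal ((?A * n) powr e) * Np p (Pt t \<phi>)"
        unfolding Np_def by (rule nn_integral_cmult) auto
      also have "\<dots> \<le> ennreal ((?A * n) powr e) * ennreal n"
        using Np_Pt_le[OF t p] n by (intro mult_left_mono) auto
      also have "\<dots> = ennreal ((?A * n) powr e * n)" using n by (simp add: ennreal_mult)
      finally have "ennpow (Np s (Pt t \<phi>)) (1 / s) \<le> ennpow (ennreal ((?A * n) powr e * n)) (1 / s)"
        using s p by (intro ennpow_mono) auto
      also have "\<dots> = ennreal (((?A * n) powr e * n) powr (1 / s))"
        using n by (simp add: ennpow_def)
      also have "((?A * n) powr e * n) powr (1 / s) = ?A powr (1 / p - 1 / s) * n powr (1 / p)"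
      proof -
        have 1: "e * (1 / s) = 1 / p - 1 / s" using s p by (simp add: e_def field_simps)
        have "((?A * n) powr e * n) powr (1 / s) = (?A powr e * (n powr e * n)) powr (1 / s)"
          using A n by (simp add: powr_mult mult.assoc)
        also have "\<dots> = ?A powr (e * (1 / s)) * (n powr e * n) powr (1 / s)"
          using A n by (simp add: powr_mult powr_powr)
        also have "(n powr e * n) powr (1 / s) = n powr (1 / p)"
        proof (cases "n = 0")
          case False
          have "n powr e * n = n powr (e + 1)" using n False by (simp add: powr_add)
          moreover have "(e + 1) * (1 / s) = 1 / p" using s p by (simp add: e_def field_simps)
          ultimately show ?thesis by (simp only: powr_powr)
        qed simp
        finally show ?thesis by (simp only: 1)
      qed
      finally have "ennpow (Np s (Pt t \<phi>)) (1 / s) \<le> ennreal (?A powr (1 / p - 1 / s)) * ennreal (n powr (1 / p))"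
        by (simp add: ennreal_mult)
      moreover have "1 \<le> r" using q by (rule order_trans)
      ultimately show ?thesis
        using rfin by (simp add: Lq Lnorm_mu_eq_Np s_def[symmetric] enn2real_inverse[OF q(1) False] enn2real_inverse p_def[symmetric])
    qed
  qed
qed

lemma (in datum) Gop_eq:
  assumes \<phi>i: "\<phi>i \<in> borel_measurable (lebesgue_on Omega)" "AE x in lebesgue_on Omega. \<phi>i x = \<phi> x"
    and \<phi>b: "\<phi>b \<in> borel_measurable surface_measure" "AE x in surface_measure. \<phi>b x = \<phi> x"
    and p: "(x, t) \<in> Ubd"
  shows "Gop_well_defined t \<phi>i \<phi>b x" "Gop t \<phi>i \<phi>b x = GG (x, t)"
proof -
  have i: "integrable mu (\<lambda>y. Gker x y t * \<phi> y)" using GG_eq(2)[OF p] by simp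
  note s = integral_mu_split[OF i]
  have mG: "(\<lambda>y. Gker x y t) \<in> borel_measurable borel" by measurable
  have m1: "(\<lambda>y. Gker x y t * \<phi>i y) \<in> borel_measurable (lebesgue_on Omega)"
    by (intro borel_measurable_times \<phi>i(1) borel_measurable_lebesgue_on_Omega mG)
  have m2: "(\<lambda>y. Gker x y t * \<phi>b y) \<in> borel_measurable surface_measure"
    by (intro borel_measurable_times \<phi>b(1) borel_measurable_surface_measure mG)
  have a1: "AE y in lebesgue_on Omega. Gker x y t * \<phi>i y = Gker x y t * \<phi> y"
    using \<phi>i(2) by eventually_elim simp
  have a2: "AE y in surface_measure. Gker x y t * \<phi>b y = Gker x y t * \<phi> y"
    using \<phi>b(2) by eventually_elim simp
  show "Gop_well_defined t \<phi>i \<phi>b x"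
    unfolding Gop_well_defined_def
    using s(1,2) integrable_cong_AE[OF m1 borel_measurable_integrable[OF s(1)] a1]
      integrable_cong_AE[OF m2 borel_measurable_integrable[OF s(2)] a2] by blast
  show "Gop t \<phi>i \<phi>b x = GG (x, t)"
    unfolding Gop_def GG_def
    using s(3) integral_cong_AE[OF m1 borel_measurable_integrable[OF s(1)] a1]
      integral_cong_AE[OF m2 borel_measurable_integrable[OF s(2)] a2] by simp
qed

lemma vector_derivative_cong_within:
  assumes "\<And>h. h \<in> S \<Longrightarrow> f h = g h" "a \<in> S"
  shows "vector_derivative f (at a within S) = vector_derivative g (at a within S)"
proof -
  have "(f has_vector_derivative v) (at a within S) \<longleftrightarrow> (g has_vector_derivative v) (at a within S)" for v
    using has_vector_derivative_transform[OF assms(2), of g f] has_vector_derivative_transform[OF assms(2), of f g] assms(1) by metis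
  then show ?thesis unfolding vector_derivative_def by simp
qed

section \<open>Transfer to pairs of data\<close>

text \<open>A pair together with its Borel representative \<phi>. Integrals do not see null sets of
  the data, so the operator on the pair equals the one on \<phi> at every point of
  \<open>Ubd\<close>, and pointwise statements about derivatives transfer.\<close>

locale glued = datum \<phi> for \<phi> :: "real ^ 'n::{finite,linorder} \<Rightarrow> real" +
  fixes q :: ennreal and \<phi>i \<phi>b :: "real ^ 'n::{finite,linorder} \<Rightarrow> real"
  assumes q: "1 \<le> q"
    and phi_i: "\<phi>i \<in> borel_measurable (lebesgue_on Omega)" "AE x in lebesgue_on Omega. \<phi>i x = \<phi> x"
    and phi_b: "\<phi>b \<in> borel_measurable surface_measure" "AE x in surface_measure. \<phi>b x = \<phi> x"
    and fin: "Lnorm q mu \<phi> < \<infinity>"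
begin

lemmas Gop_GG = Gop_eq[OF phi_i phi_b]

lemma in_Ubd: "x \<in> closure Omega \<Longrightarrow> 0 < t \<Longrightarrow> (x, t) \<in> Ubd"
  using closure_times_subset_Ubd by auto

lemma Gop_Pt: "x \<in> closure Omega \<Longrightarrow> 0 < t \<Longrightarrow> Gop t \<phi>i \<phi>b x = Pt t \<phi> x"
  by (simp add: Gop_GG(2)[OF in_Ubd] GG_Pt)

lemma bounded_Gop:
  assumes T: "0 < T"
  shows "bounded ((\<lambda>(x, t). Gop t \<phi>i \<phi>b x) ` (closure Omega \<times> {T..}))"
proof -
  have "\<exists>C. \<forall>x\<in>closure Omega. \<forall>t\<ge>T. \<bar>Pt t \<phi> x\<bar> \<le> C"
  proof (cases "q = \<infinity>")
    case True
    then show ?thesis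
      using fin T by (intro exI[of _ "enn2real (Lnorm \<infinity> mu \<phi>)"] ballI allI impI Pt_le_of_bounded AE_le_of_Lnorm_infinity) auto
  next
    case False
    define p where "p = enn2real q"
    have p: "1 \<le> p" using enn2real_ge_1[OF q] False by (simp add: p_def less_top)
    have Nfin: "Np p \<phi> < \<infinity>" unfolding p_def using False fin by (rule Np_finite_of_Lnorm)
    define n where "n = enn2real (Np p \<phi>)"
    have n: "Np p \<phi> = ennreal n" "0 \<le> n" using Nfin by (auto simp: n_def)
    \<comment> \<open>Adding 1 avoids a p-th root: a value above 1 is at most its own p-th power.
      The bound is uniform in t >= T because \<open>Gsup\<close> does not increase with
      time.\<close>
    have "\<bar>Pt t \<phi> x\<bar> \<le> 1 + Gsup CARD('n) T * n" if x: "x \<in> closure Omega" and t: "T \<le> t" for x t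
    proof -
      have t0: "0 < t" using T t by simp
      have "ennreal (\<bar>Pt t \<phi> x\<bar> powr p) \<le> ennreal (Gsup CARD('n) t * n)"
        using Pt_powr_le_sup[OF x t0 p] Gsup_pos[OF t0, of "CARD('n)"] n by (simp add: ennreal_mult)
      then have "\<bar>Pt t \<phi> x\<bar> powr p \<le> Gsup CARD('n) t * n"
        using Gsup_pos[OF t0, of "CARD('n)"] n by (subst (asm) ennreal_le_iff) auto
      also have "Gsup CARD('n) t \<le> Gsup CARD('n) T"
        unfolding Gsup_def using T t by (intro add_mono mult_left_mono powr_mono2' flux_const_nonneg) (auto simp: Suc_le_eq)
      finally have *: "\<bar>Pt t \<phi> x\<bar> powr p \<le> Gsup CARD('n) T * n" using n by (simp add: mult_right_mono)
      show ?thesis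
      proof (cases "\<bar>Pt t \<phi> x\<bar> \<le> 1")
        case True
        moreover have "0 \<le> Gsup CARD('n) T * n" using Gsup_pos[OF T, of "CARD('n)"] n by simp
        ultimately show ?thesis by linarith
      next
        case False
        then have "\<bar>Pt t \<phi> x\<bar> powr 1 \<le> \<bar>Pt t \<phi> x\<bar> powr p" using p by (intro powr_mono) auto
        then show ?thesis using * by simp
      qed
    qed
    then show ?thesis by blast
  qed
  then obtain C where C: "\<And>x t. x \<in> closure Omega \<Longrightarrow> T \<le> t \<Longrightarrow> \<bar>Pt t \<phi> x\<bar> \<le> C" by blast
  then show ?thesis
    using T by (intro boundedI[of _ C]) (auto simp: Gop_Pt)
qed

lemma smooth_Gop:
  assumes T: "0 < T"
  shows "smooth_on (closure Omega \<times> {T..}) (\<lambda>(x, t). Gop t \<phi>i \<phi>b x)"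
  unfolding smooth_on_def
proof
  fix k
  have sub: "closure Omega \<times> {T..} \<subseteq> Ubd" using T by (auto intro: in_Ubd)
  show "Ck_on k (closure Omega \<times> {T..}) (\<lambda>(x, t). Gop t \<phi>i \<phi>b x)"
    using Ck_on_mono[OF Ck_on_GG sub]
    by (rule Ck_on_cong) (auto simp: Gop_GG(2)[OF subsetD[OF sub]])
qed

lemma heat_Gop:
  assumes "x \<in> Omega" "0 < t"
  shows "deriv (\<lambda>s. Gop s \<phi>i \<phi>b x) t - laplacian (\<lambda>z. Gop t \<phi>i \<phi>b z) x = 0"
proof -
  have "caloric Ubd (\<lambda>p. Gop (snd p) \<phi>i \<phi>b (fst p))"
    by (rule caloric_cong[OF caloric_GG open_Ubd]) (auto simp: Gop_GG(2))
  moreover have "(x, t) \<in> Ubd" using assms closure_subset by (auto intro!: in_Ubd)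
  ultimately show ?thesis
    using heat_equation_of_caloric[of Ubd "\<lambda>p. Gop (snd p) \<phi>i \<phi>b (fst p)" x t] open_Ubd by simp
qed

lemma boundary_Gop:
  assumes x: "x \<in> frontier Omega" and t: "0 < t"
  shows "deriv (\<lambda>s. Gop s \<phi>i \<phi>b x) t + normal_deriv (\<lambda>z. Gop t \<phi>i \<phi>b z) x = 0"
proof -
  have xc: "x \<in> closure Omega" using x frontier_subset_closure_Omega by auto
  have "eventually (\<lambda>s. 0 < s) (nhds t)" using t by (rule order_tendstoD(1)[OF filterlim_ident])
  then have "eventually (\<lambda>s. Gop s \<phi>i \<phi>b x = GG (x, s)) (nhds t)"
    by eventually_elim (simp add: Gop_GG(2) in_Ubd xc)
  then have 1: "deriv (\<lambda>s. Gop s \<phi>i \<phi>b x) t = deriv (\<lambda>s. GG (x, s)) t"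
    by (rule deriv_cong_ev) simp
  have "vector_derivative (\<lambda>h. Gop t \<phi>i \<phi>b (x + h *\<^sub>R eN)) (at 0 within {0..})
     = vector_derivative (\<lambda>h. GG (x + h *\<^sub>R eN, t)) (at 0 within {0..})"
  proof (rule vector_derivative_cong_within)
    fix h :: real assume "h \<in> {0..}"
    then have "x + h *\<^sub>R eN \<in> closure Omega" using xc by (simp add: closure_Omega)
    then show "Gop t \<phi>i \<phi>b (x + h *\<^sub>R eN) = GG (x + h *\<^sub>R eN, t)"
      using t by (simp add: Gop_GG(2) in_Ubd)
  qed simp
  then have "normal_deriv (\<lambda>z. Gop t \<phi>i \<phi>b z) x = normal_deriv (\<lambda>z. GG (z, t)) x"
    by (simp add: normal_deriv_def)
  then show ?thesis using 1 GG_boundary[OF x t] by simp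
qed

lemma joint_phi: "joint_norm q \<phi>i \<phi>b = Lnorm q mu \<phi>"
  by (rule joint_norm_eq_Lnorm_mu[OF phi_i phi_b borel_phi q])

lemma Gop_glue:
  assumes t: "0 < t"
  shows "Gop t \<phi>i \<phi>b \<in> borel_measurable (lebesgue_on Omega)" "AE x in lebesgue_on Omega. Gop t \<phi>i \<phi>b x = Pt t \<phi> x"
    "Gop t \<phi>i \<phi>b \<in> borel_measurable surface_measure" "AE x in surface_measure. Gop t \<phi>i \<phi>b x = Pt t \<phi> x"
proof -
  have P: "Pt t \<phi> \<in> borel_measurable borel" by measurable
  have e1: "Gop t \<phi>i \<phi>b x = Pt t \<phi> x" if "x \<in> space (lebesgue_on Omega)" for x
    using that t closure_subset by (intro Gop_Pt) auto
  have e2: "Gop t \<phi>i \<phi>b x = Pt t \<phi> x" if "x \<in> space surface_measure" for x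
    using that t frontier_subset_closure_Omega by (intro Gop_Pt) (auto simp: space_surface_measure)
  show "Gop t \<phi>i \<phi>b \<in> borel_measurable (lebesgue_on Omega)"
    using measurable_cong[where f = "Gop t \<phi>i \<phi>b" and g = "Pt t \<phi>", OF e1] borel_measurable_lebesgue_on_Omega[OF P] by blast
  show "Gop t \<phi>i \<phi>b \<in> borel_measurable surface_measure"
    using measurable_cong[where f = "Gop t \<phi>i \<phi>b" and g = "Pt t \<phi>", OF e2] borel_measurable_surface_measure[OF P] by blast
  show "AE x in lebesgue_on Omega. Gop t \<phi>i \<phi>b x = Pt t \<phi> x" by (rule AE_I2[OF e1])
  show "AE x in surface_measure. Gop t \<phi>i \<phi>b x = Pt t \<phi> x" by (rule AE_I2[OF e2])
qed

lemma joint_Gop: "0 < t \<Longrightarrow> 1 \<le> r \<Longrightarrow> joint_norm r (Gop t \<phi>i \<phi>b) (Gop t \<phi>i \<phi>b) = Lnorm r mu (Pt t \<phi>)"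
  by (rule joint_norm_eq_Lnorm_mu[OF Gop_glue borel_measurable_Pt]) auto

lemma initial_Gop:
  assumes "q < \<infinity>"
  shows "((\<lambda>t. pair_norm q (\<lambda>x. Gop t \<phi>i \<phi>b x - \<phi>i x) (\<lambda>x. Gop t \<phi>i \<phi>b x - \<phi>b x)) \<longlongrightarrow> 0) (at_right 0)"
proof -
  define p where "p = enn2real q"
  have p: "1 \<le> p" using enn2real_ge_1[OF q assms] by (simp add: p_def)
  have Nfin: "Np p \<phi> < \<infinity>" unfolding p_def using assms fin by (intro Np_finite_of_Lnorm) auto
  let ?N = "\<lambda>t. Np p (\<lambda>x. Pt t \<phi> x - \<phi> x)"
  have lim: "(?N \<longlongrightarrow> 0) (at_right 0)" by (rule Np_Pt_diff_tendsto[OF p borel_phi Nfin])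
  have le: "pair_norm q (\<lambda>x. Gop t \<phi>i \<phi>b x - \<phi>i x) (\<lambda>x. Gop t \<phi>i \<phi>b x - \<phi>b x) \<le> 2 * ennpow (?N t) (1 / p)"
    if t: "0 < t" for t
  proof -
    have "pair_norm q (\<lambda>x. Gop t \<phi>i \<phi>b x - \<phi>i x) (\<lambda>x. Gop t \<phi>i \<phi>b x - \<phi>b x)
      \<le> 2 * joint_norm q (\<lambda>x. Gop t \<phi>i \<phi>b x - \<phi>i x) (\<lambda>x. Gop t \<phi>i \<phi>b x - \<phi>b x)"
      by (rule pair_norm_le_joint_norm[OF q])
    also have "joint_norm q (\<lambda>x. Gop t \<phi>i \<phi>b x - \<phi>i x) (\<lambda>x. Gop t \<phi>i \<phi>b x - \<phi>b x) = Lnorm q mu (\<lambda>x. Pt t \<phi> x - \<phi> x)"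
    proof (rule joint_norm_eq_Lnorm_mu)
      show "(\<lambda>x. Gop t \<phi>i \<phi>b x - \<phi>i x) \<in> borel_measurable (lebesgue_on Omega)"
        by (intro borel_measurable_diff Gop_glue t phi_i)
      show "(\<lambda>x. Gop t \<phi>i \<phi>b x - \<phi>b x) \<in> borel_measurable surface_measure"
        by (intro borel_measurable_diff Gop_glue t phi_b)
      show "AE x in lebesgue_on Omega. Gop t \<phi>i \<phi>b x - \<phi>i x = Pt t \<phi> x - \<phi> x"
        using Gop_glue(2)[OF t] phi_i(2) by eventually_elim simp
      show "AE x in surface_measure. Gop t \<phi>i \<phi>b x - \<phi>b x = Pt t \<phi> x - \<phi> x"
        using Gop_glue(4)[OF t] phi_b(2) by eventually_elim simp
    qed (use q in measurable)
    also have "\<dots> = ennpow (?N t) (1 / p)" using assms by (simp add: Lnorm_mu_eq_Np p_def)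
    finally show ?thesis .
  qed
  have "((\<lambda>t. ennpow (?N t) (1 / p)) \<longlongrightarrow> 0) (at_right 0)"
  proof (rule order_tendstoI)
    fix e :: ennreal assume e: "0 < e"
    \<comment> \<open>The tolerance e may be infinite, so it is cut off at 1 before it is turned
      into a real number.\<close>
    define d where "d = min 1 (enn2real (min 1 e))"
    have d: "0 < d" "ennreal d \<le> e"
    proof -
      have m: "0 < min 1 e" "min 1 e < \<infinity>"
        using e le_less_trans[OF min.cobounded1[of 1 e], of \<infinity>] by auto
      then show "0 < d" by (simp add: d_def enn2real_positive_iff)
      have "ennreal d \<le> ennreal (enn2real (min 1 e))" by (rule ennreal_leI) (simp add: d_def)
      also have "\<dots> = min 1 e" using m by simp
      finally show "ennreal d \<le> e" by simp
    qed
    have "eventually (\<lambda>t. ?N t < ennreal ((d / 2) powr p)) (at_right 0)"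
      using lim by (rule order_tendstoD(2)) (use d in simp)
    then show "eventually (\<lambda>t. ennpow (?N t) (1 / p) < e) (at_right 0)"
    proof eventually_elim
      case (elim t)
      have "ennpow (?N t) (1 / p) \<le> ennpow (ennreal ((d / 2) powr p)) (1 / p)"
        using elim p by (intro ennpow_mono) auto
      also have "\<dots> = ennreal (d / 2)" using d p by (simp add: ennpow_def powr_powr)
      also have "\<dots> < ennreal d" using d by (simp add: ennreal_less_iff)
      finally show ?case using d by simp
    qed
  qed simp
  then have "((\<lambda>t. 2 * ennpow (?N t) (1 / p)) \<longlongrightarrow> 2 * 0) (at_right 0)"
    by (intro ennreal_tendsto_cmult) auto
  then have "((\<lambda>t. 2 * ennpow (?N t) (1 / p)) \<longlongrightarrow> 0) (at_right 0)" by simp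
  then show ?thesis
  proof (rule tendsto_sandwich[OF _ _ tendsto_const, rotated -1])
    show "\<forall>\<^sub>F t in at_right 0. pair_norm q (\<lambda>x. Gop t \<phi>i \<phi>b x - \<phi>i x) (\<lambda>x. Gop t \<phi>i \<phi>b x - \<phi>b x) \<le> 2 * ennpow (?N t) (1 / p)"
      using le by (auto simp: eventually_at_filter)
  qed simp
qed

text \<open>As \<theta> lies between 0 and 1, a constant c >= 1 satisfies c^\<theta> <= c, which
  makes the final constant independent of q and r. In the 4, one factor 2 passes from the joint to
  the pair norm, the other from a + b to max a b.\<close>

lemma smoothing_Gop:
  assumes t: "0 < t" and r: "q \<le> r"
  defines "N \<equiv> real CARD('n)" and "\<theta> \<equiv> enn2real (1 / q) - enn2real (1 / r)"
  shows "pair_norm r (Gop t \<phi>i \<phi>b) (Gop t \<phi>i \<phi>b)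
    \<le> ennreal (4 * (5 + flux_const CARD('n)) * (t powr (- (N / 2) * \<theta>) + t powr (- (N - 1) * \<theta>))) * pair_norm q \<phi>i \<phi>b"
proof -
  let ?A = "Gsup CARD('n) t" and ?c = "5 + flux_const CARD('n)"
  have r1: "1 \<le> r" using q r by (rule order_trans)
  have inv: "0 \<le> enn2real (1 / s)" "enn2real (1 / s) \<le> 1" if "1 \<le> s" for s :: ennreal
  proof -
    show "0 \<le> enn2real (1 / s)" by simp
    show "enn2real (1 / s) \<le> 1"
    proof (cases "s = \<infinity>")
      case False
      then have "1 \<le> enn2real s" using that by (intro enn2real_ge_1) (auto simp: less_top)
      then show ?thesis using enn2real_inverse[OF that False] by simp
    qed simp
  qed
  have \<theta>: "0 \<le> \<theta>" "\<theta> \<le> 1"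
  proof -
    have "enn2real (1 / r) \<le> enn2real (1 / q)"
    proof (cases "r = \<infinity>")
      case False
      then have qf: "q \<noteq> \<infinity>" using r by (auto simp: top_unique)
      have "enn2real q \<le> enn2real r" using r False by (intro enn2real_mono) (auto simp: less_top)
      moreover have "1 \<le> enn2real q" using qf q by (intro enn2real_ge_1) (auto simp: less_top)
      ultimately show ?thesis
        using enn2real_inverse[OF q qf] enn2real_inverse[OF r1 False] by (simp add: frac_le)
    qed simp
    then show "0 \<le> \<theta>" by (simp add: \<theta>_def)
    show "\<theta> \<le> 1" using inv[OF q] inv[OF r1] unfolding \<theta>_def by linarith
  qed
  define a b where "a = t powr (- (N / 2))" and "b = t powr (- (N - 1))"
  have ab: "0 < a" "0 < b" using t by (auto simp: a_def b_def)
  have c: "5 \<le> ?c" "1 \<le> ?c" using flux_const_nonneg[of "CARD('n)"] by auto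
  have "?A \<le> ?c * (a + b)"
    unfolding Gsup_def a_def b_def N_def using flux_const_nonneg[of "CARD('n)"] t
    by (simp add: distrib_left distrib_right mult_nonneg_nonneg)
  also have "\<dots> \<le> ?c * (2 * max a b)" using c by (intro mult_left_mono) auto
  finally have "?A powr \<theta> \<le> (?c * (2 * max a b)) powr \<theta>"
    using Gsup_pos[OF t, of "CARD('n)"] \<theta> by (intro powr_mono2) auto
  also have "\<dots> = ?c powr \<theta> * (2 powr \<theta> * max a b powr \<theta>)"
    using c ab by (simp add: powr_mult)
  also have "\<dots> \<le> ?c * (2 * (a powr \<theta> + b powr \<theta>))"
  proof (intro mult_mono)
    show "?c powr \<theta> \<le> ?c" using powr_mono[of \<theta> 1 ?c] \<theta> c by simp
    show "2 powr \<theta> \<le> (2::real)" using powr_mono[of \<theta> 1 "2::real"] \<theta> by simp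
    show "max a b powr \<theta> \<le> a powr \<theta> + b powr \<theta>" by (auto simp: max_def)
  qed (use c in auto)
  finally have "?A powr \<theta> \<le> ?c * (2 * (a powr \<theta> + b powr \<theta>))" .
  from mult_left_mono[OF this, of 2] have A: "2 * ?A powr \<theta> \<le> 4 * ?c * (a powr \<theta> + b powr \<theta>)"
    by (simp add: algebra_simps)
  have "pair_norm r (Gop t \<phi>i \<phi>b) (Gop t \<phi>i \<phi>b) \<le> 2 * joint_norm r (Gop t \<phi>i \<phi>b) (Gop t \<phi>i \<phi>b)"
    by (rule pair_norm_le_joint_norm[OF r1])
  also have "\<dots> = 2 * Lnorm r mu (Pt t \<phi>)" by (simp add: joint_Gop[OF t r1])
  also have "\<dots> \<le> 2 * (ennreal (?A powr \<theta>) * Lnorm q mu \<phi>)"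
    unfolding \<theta>_def by (intro mult_left_mono Lnorm_Pt_le t q r fin) auto
  also have "\<dots> = ennreal (2 * ?A powr \<theta>) * Lnorm q mu \<phi>"
    by (simp add: ennreal_mult mult.assoc)
  also have "\<dots> \<le> ennreal (4 * ?c * (a powr \<theta> + b powr \<theta>)) * pair_norm q \<phi>i \<phi>b"
    using joint_norm_le_pair_norm[OF q, of \<phi>i \<phi>b] by (intro mult_mono[OF ennreal_leI[OF A]]) (auto simp: joint_phi)
  finally show ?thesis by (simp add: a_def b_def powr_powr)
qed

text \<open>The case r = q of \<open>Lnorm_Pt_le\<close>: the exponent of the kernel bound is zero,
  so its factor is 1, and the joint norm is the L^q norm for \<open>mu\<close> without loss.\<close>

lemma contraction_Gop:
  assumes "0 < t"
  shows "joint_norm q (Gop t \<phi>i \<phi>b) (Gop t \<phi>i \<phi>b) \<le> joint_norm q \<phi>i \<phi>b"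
  using Lnorm_Pt_le[OF assms q order_refl fin] Gsup_pos[OF assms, of "CARD('n)"]
  by (simp add: joint_Gop[OF assms q] joint_phi)

end

lemma glued_of_in_Lq_pair:
  fixes \<phi>i \<phi>b :: "real ^ 'n::{finite,linorder} \<Rightarrow> real"
  assumes q: "1 \<le> q" and "in_Lq_pair q \<phi>i \<phi>b"
  obtains \<phi> where "glued \<phi> q \<phi>i \<phi>b"
proof -
  have m: "\<phi>i \<in> borel_measurable (lebesgue_on Omega)" "\<phi>b \<in> borel_measurable surface_measure"
    and fin: "pair_norm q \<phi>i \<phi>b < \<infinity>"
    using assms(2) by (auto simp: in_Lq_pair_def in_Lq_def pair_norm_def)
  obtain \<phi> where \<phi>: "\<phi> \<in> borel_measurable borel" "AE x in lebesgue_on Omega. \<phi>i x = \<phi> x"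
    "AE x in surface_measure. \<phi>b x = \<phi> x" by (rule glue[OF m])
  have "Lnorm q mu \<phi> = joint_norm q \<phi>i \<phi>b"
    by (rule joint_norm_eq_Lnorm_mu[OF m(1) \<phi>(2) m(2) \<phi>(3) \<phi>(1) q, symmetric])
  also have "\<dots> \<le> pair_norm q \<phi>i \<phi>b" by (rule joint_norm_le_pair_norm[OF q])
  finally have L: "Lnorm q mu \<phi> < \<infinity>" using fin by (rule le_less_trans)
  interpret datum \<phi> by (rule datum_of_Lnorm[OF \<phi>(1) q L])
  have "glued \<phi> q \<phi>i \<phi>b" using q m \<phi> L by unfold_locales
  then show ?thesis by (rule that)
qed

lemma Gop_nn_lower:
  fixes \<phi>i \<phi>b :: "real ^ 'n::{finite,linorder} \<Rightarrow> ennreal"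
  assumes \<phi>i: "\<phi>i \<in> borel_measurable (lebesgue_on Omega)" and \<phi>b: "\<phi>b \<in> borel_measurable surface_measure"
    and x: "x \<in> closure Omega" and t: "1 \<le> t"
  shows "ennreal (lower_const CARD('n)) * (\<integral>\<^sup>+y. ennreal (Gauss (x - refl_pt y) (t / 2)) * \<phi>i y \<partial>lebesgue_on Omega)
     + ennreal (lower_const CARD('n)) * (\<integral>\<^sup>+y. ennreal (Gauss (x - refl_pt y) (t / 2)) * \<phi>b y \<partial>surface_measure)
     \<le> Gop_nn t \<phi>i \<phi>b x"
proof -
  let ?c = "lower_const CARD('n)"
  have mG: "(\<lambda>y. ennreal (Gauss (x - refl_pt y) (t / 2))) \<in> borel_measurable borel" by measurable
  have m1: "(\<lambda>y. ennreal (Gauss (x - refl_pt y) (t / 2)) * \<phi>i y) \<in> borel_measurable (lebesgue_on Omega)"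
    by (intro borel_measurable_times_ennreal \<phi>i borel_measurable_lebesgue_on_Omega mG)
  have m2: "(\<lambda>y. ennreal (Gauss (x - refl_pt y) (t / 2)) * \<phi>b y) \<in> borel_measurable surface_measure"
    by (intro borel_measurable_times_ennreal \<phi>b borel_measurable_surface_measure mG)
  have le: "ennreal ?c * (ennreal (Gauss (x - refl_pt y) (t / 2)) * z) \<le> ennreal (Gker x y t) * z"
    if "y \<in> closure Omega" for y z
  proof -
    have "ennreal (?c * Gauss (x - refl_pt y) (t / 2)) \<le> ennreal (Gker x y t)"
      by (intro ennreal_leI Gker_lower x t that)
    then have "ennreal ?c * ennreal (Gauss (x - refl_pt y) (t / 2)) \<le> ennreal (Gker x y t)"
    proof -
      have "0 \<le> ?c" by (simp add: lower_const_def)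
      then show ?thesis using \<open>ennreal (?c * _) \<le> _\<close> by (simp only: ennreal_mult Gauss_nonneg)
    qed
    then have "ennreal ?c * ennreal (Gauss (x - refl_pt y) (t / 2)) * z \<le> ennreal (Gker x y t) * z"
      by (rule mult_right_mono) simp
    then show ?thesis by (simp add: mult.assoc)
  qed
  have "ennreal ?c * (\<integral>\<^sup>+y. ennreal (Gauss (x - refl_pt y) (t / 2)) * \<phi>i y \<partial>lebesgue_on Omega)
      \<le> (\<integral>\<^sup>+y. ennreal (Gker x y t) * \<phi>i y \<partial>lebesgue_on Omega)"
    unfolding nn_integral_cmult[OF m1, symmetric] using closure_subset by (intro nn_integral_mono le) auto
  moreover have "ennreal ?c * (\<integral>\<^sup>+y. ennreal (Gauss (x - refl_pt y) (t / 2)) * \<phi>b y \<partial>surface_measure)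
      \<le> (\<integral>\<^sup>+y. ennreal (Gker x y t) * \<phi>b y \<partial>surface_measure)"
    unfolding nn_integral_cmult[OF m2, symmetric] using frontier_subset_closure_Omega
    by (intro nn_integral_mono le) (auto simp: space_surface_measure)
  ultimately show ?thesis unfolding Gop_nn_def by (rule add_mono)
qed

theorem corollary1p1:
  shows
    "(\<forall>q \<phi>i (\<phi>b :: real ^ 'n::{finite,linorder} \<Rightarrow> real).
        1 \<le> q \<longrightarrow> in_Lq_pair q \<phi>i \<phi>b \<longrightarrow>
          (\<forall>x\<in>closure Omega. \<forall>t>0. Gop_well_defined t \<phi>i \<phi>b x) \<and>
          (\<forall>T>0. bounded ((\<lambda>(x, t). Gop t \<phi>i \<phi>b x) ` (closure Omega \<times> {T..})) \<and>
                  smooth_on (closure Omega \<times> {T..}) (\<lambda>(x, t). Gop t \<phi>i \<phi>b x)) \<and>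
          (\<forall>x\<in>Omega. \<forall>t>0.
             deriv (\<lambda>s. Gop s \<phi>i \<phi>b x) t - laplacian (\<lambda>z. Gop t \<phi>i \<phi>b z) x = 0) \<and>
          (\<forall>x\<in>frontier Omega. \<forall>t>0.
             deriv (\<lambda>s. Gop s \<phi>i \<phi>b x) t + normal_deriv (\<lambda>z. Gop t \<phi>i \<phi>b z) x = 0) \<and>
          (q < \<infinity> \<longrightarrow>
             ((\<lambda>t. pair_norm q (\<lambda>x. Gop t \<phi>i \<phi>b x - \<phi>i x) (\<lambda>x. Gop t \<phi>i \<phi>b x - \<phi>b x))
                \<longlongrightarrow> 0) (at_right 0)))
     \<and>
     (\<exists>C1>0. \<forall>t>0. \<forall>q r \<phi>i (\<phi>b :: real ^ 'n::{finite,linorder} \<Rightarrow> real).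
        1 \<le> q \<longrightarrow> q \<le> r \<longrightarrow> in_Lq_pair q \<phi>i \<phi>b \<longrightarrow>
          pair_norm r (Gop t \<phi>i \<phi>b) (Gop t \<phi>i \<phi>b)
            \<le> ennreal (C1 *
                 (t powr (- (real CARD('n) / 2) * (enn2real (1 / q) - enn2real (1 / r)))
                  + t powr (- (real CARD('n) - 1) * (enn2real (1 / q) - enn2real (1 / r)))))
              * pair_norm q \<phi>i \<phi>b)
     \<and>
     (\<forall>t>0. \<forall>q \<phi>i (\<phi>b :: real ^ 'n::{finite,linorder} \<Rightarrow> real).
        1 \<le> q \<longrightarrow> in_Lq_pair q \<phi>i \<phi>b \<longrightarrow>
          joint_norm q (Gop t \<phi>i \<phi>b) (Gop t \<phi>i \<phi>b) \<le> joint_norm q \<phi>i \<phi>b)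
     \<and>
     (\<exists>C2>0. \<forall>\<phi>i (\<phi>b :: real ^ 'n::{finite,linorder} \<Rightarrow> ennreal).
        \<phi>i \<in> borel_measurable (lebesgue_on Omega) \<longrightarrow> \<phi>b \<in> borel_measurable surface_measure \<longrightarrow>
          (\<forall>x\<in>closure Omega. \<forall>t\<ge>1.
             (\<forall>y\<in>closure Omega. 0 \<le> Gker x y t) \<and>
             Gop_nn t \<phi>i \<phi>b x
               \<ge> ennreal C2 * (\<integral>\<^sup>+ y. ennreal (Gauss (x - refl_pt y) (t / 2)) * \<phi>i y \<partial>lebesgue_on Omega)
                 + ennreal C2 * (\<integral>\<^sup>+ y. ennreal (Gauss (x - refl_pt y) (t / 2)) * \<phi>b y \<partial>surface_measure)))"
proof (intro conjI, goal_cases)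
  case 1
  show ?case
  proof (intro allI impI)
    fix q and \<phi>i \<phi>b :: "(real, 'n) vec \<Rightarrow> real" assume q: "1 \<le> q" "in_Lq_pair q \<phi>i \<phi>b"
    obtain \<phi> where "glued \<phi> q \<phi>i \<phi>b" by (rule glued_of_in_Lq_pair[OF q])
    then interpret glued \<phi> q \<phi>i \<phi>b .
    show "(\<forall>x\<in>closure Omega. \<forall>t>0. Gop_well_defined t \<phi>i \<phi>b x) \<and>
          (\<forall>T>0. bounded ((\<lambda>(x, t). Gop t \<phi>i \<phi>b x) ` (closure Omega \<times> {T..})) \<and>
                  smooth_on (closure Omega \<times> {T..}) (\<lambda>(x, t). Gop t \<phi>i \<phi>b x)) \<and>
          (\<forall>x\<in>Omega. \<forall>t>0.
             deriv (\<lambda>s. Gop s \<phi>i \<phi>b x) t - laplacian (\<lambda>z. Gop t \<phi>i \<phi>b z) x = 0) \<and>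
          (\<forall>x\<in>frontier Omega. \<forall>t>0.
             deriv (\<lambda>s. Gop s \<phi>i \<phi>b x) t + normal_deriv (\<lambda>z. Gop t \<phi>i \<phi>b z) x = 0) \<and>
          (q < \<infinity> \<longrightarrow>
             ((\<lambda>t. pair_norm q (\<lambda>x. Gop t \<phi>i \<phi>b x - \<phi>i x) (\<lambda>x. Gop t \<phi>i \<phi>b x - \<phi>b x))
                \<longlongrightarrow> 0) (at_right 0))"
      by (intro conjI ballI allI impI Gop_GG(1) in_Ubd bounded_Gop smooth_Gop heat_Gop boundary_Gop initial_Gop)
  qed
next
  case 2
  have "0 < 4 * (5 + flux_const CARD('n))" using flux_const_nonneg[of "CARD('n)"] by simp
  then show ?case
    using glued_of_in_Lq_pair glued.smoothing_Gop by (metis (no_types, lifting))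
next
  case 3
  show ?case
    using glued_of_in_Lq_pair glued.contraction_Gop by metis
next
  case 4
  have "0 < lower_const CARD('n)" by (simp add: lower_const_def)
  then show ?case
    by (intro exI[of _ "lower_const CARD('n)"]) (auto intro: Gop_nn_lower Gker_nonneg)
qed

end
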